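(* Let $p$ be a prime, $\alpha>0$, and let $(\mathfrak D^\alpha,\mathcal D)$ be the operator of $p$-adic fractional derivative of order $\alpha$ on $\mathbb Q_p$. Then $(\mathfrak D^\alpha,\mathcal D)$ is essentially self-adjoint and non-negative definite in $L^2(\mathbb Q_p,m)$, and it coincides with the hierarchical Laplacian $(L_C,\mathcal D)$ corresponding to the choice function $$C(B)=(1-p^{-\alpha})\operatorname{diam}(B)^{-\alpha},$$ or equivalently, the eigenvalues $\lambda(B)$ are of the form $\lambda(B)=\operatorname{diam}(B)^{-\alpha}$. In particular, $$\mathsf{Spec}(\mathfrak D^\alpha)=\{p^{k\alpha}:k\in\mathbb Z\}\cup\{0\},$$ where each $p^{k\alpha}$, $k\in\mathbb Z$, is an eigenvalue of infinite multiplicity and $0$ is an accumulation point of the spectrum; the eigenspace corresponding to the eigenvalue $p^{k\alpha}$ is spanned by the function $$f_k=\frac1{m(p^k\mathbb Z_p)}\mathbf 1_{p^k\mathbb Z_p}-\frac1{m(p^{k-1}\mathbb Z_p)}\mathbf 1_{p^{k-1}\mathbb Z_p}$$ and all its shifts $f_k(\cdot+a)$ with $a\in\mathbb Q_p/p^k\mathbb Z_p$.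
   Context: $\mathbb Q_p$ carries the $p$-adic norm $\|\cdot\|_p$, the ultrametric $d(x,y)=\|x-y\|_p$ and the Haar measure $m$ with $m(\mathbb Z_p)=1$, where $\mathbb Z_p$ is the set of $p$-adic integers. The balls are the cosets $p^k\mathbb Z_p+a$, with $\operatorname{diam}(p^k\mathbb Z_p+a)=m(p^k\mathbb Z_p+a)=p^{-k}$; $\mathcal B$ is the set of all balls. $\mathcal D$ is the set of locally constant functions with compact support. With $\widetilde u$ denoting the Fourier transform on the locally compact Abelian group $\mathbb Q_p$ (normalized so that the annihilator of $p^{-l}\mathbb Z_p$ is $p^{l}\mathbb Z_p$), which is a linear isomorphism of $\mathcal D$ onto itself, the operator $\mathfrak D^\alpha$ is defined on $\mathcal D$ by $\widetilde{\mathfrak D^\alpha u}(\xi)=\|\xi\|_p^\alpha\,\widetilde u(\xi)$. A choice function is a function $C:\mathcal B\to(0,\infty)$ with $\lambda(B):=\sum_{T\in\mathcal B:\,B\subseteq T}C(T)<\infty$ for all $B$ and $\lambda(B)\to\infty$ as $B$ shrinks to a point. The corresponding hierarchical Laplacian is $$L_Cf(x)=-\sum_{B\in\mathcal B:\,x\in B}C(B)\bigl(P_Bf-f(x)\bigr),\quad f\in\mathcal D,\qquad P_Bf=\frac1{m(B)}\int_Bf\,dm.$$ $\mathsf{Spec}(\mathfrak D^\alpha)$ is the spectrum of the unique self-adjoint extension.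
   Formalization: diam(B) is replaced by diam(B)/p in C(B) and in λ(B): with the stated formulas L_C f_k = p^{(k-1)α} f_k while D^α f_k = p^{kα} f_k, so the two operators would differ by the factor p^α. *)

theory Defs
  imports "HOL-Analysis.Analysis" "HOL-Computational_Algebra.Primes"
begin

section \<open>The field of $p$-adic numbers\<close>

text \<open>
  The prime \<open>p\<close> is carried by the type: \<open>'p\<close> ranges over the types of prime cardinality,
  and \<open>p = CARD('p)\<close>.
\<close>

class prime_card =
  assumes prime_card: "prime CARD('a)"

definition pval :: "nat \<Rightarrow> rat \<Rightarrow> int" where
  "pval p x = int (multiplicity (int p) (fst (quotient_of x)))
            - int (multiplicity (int p) (snd (quotient_of x)))"

definition pabs :: "nat \<Rightarrow> rat \<Rightarrow> real" where
  "pabs p x = (if x = 0 then 0 else real p powi (- pval p x))"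

lemma pval_fraction:
  assumes p: "prime p" and nz: "a \<noteq> 0" "b \<noteq> 0"
  shows "pval p (of_int a / of_int b)
       = int (multiplicity (int p) a) - int (multiplicity (int p) b)"
proof -
  obtain n d where q: "quotient_of (of_int a / of_int b) = (n, d)" by fastforce
  have d: "d > 0" using q by (rule quotient_of_denom_pos)
  have eq: "(of_int a / of_int b :: rat) = of_int n / of_int d" using q by (rule quotient_of_div)
  have "(of_int (a * d) :: rat) = of_int (n * b)"
    using eq d nz by (simp add: field_simps)
  then have e: "a * d = n * b" by (simp only: of_int_eq_iff)
  then have n: "n \<noteq> 0" using d nz by auto
  have pr: "prime_elem (int p)" using p by simp
  have "multiplicity (int p) (a * d) = multiplicity (int p) (n * b)" using e by simp
  then have "multiplicity (int p) a + multiplicity (int p) d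
           = multiplicity (int p) n + multiplicity (int p) b"
    using prime_elem_multiplicity_mult_distrib[OF pr] nz d n by simp
  then show ?thesis unfolding pval_def q by simp
qed

lemma multiplicity_minus: "multiplicity q (- a) = multiplicity q (a :: int)"
  unfolding multiplicity_def by simp

lemma rat_fraction: "\<exists>a b. b \<noteq> 0 \<and> (x::rat) = of_int a / of_int b"
proof -
  obtain n d where q: "quotient_of x = (n, d)" by fastforce
  show ?thesis using quotient_of_div[OF q] quotient_of_denom_pos[OF q] by (intro exI[of _ n] exI[of _ d]) auto
qed

lemma pabs_0 [simp]: "pabs p 0 = 0" by (simp add: pabs_def)

lemma pabs_nonneg [simp]: "0 \<le> pabs p x" by (simp add: pabs_def)

lemma pabs_eq_0: "prime p \<Longrightarrow> pabs p x = 0 \<longleftrightarrow> x = 0"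
  by (auto simp: pabs_def prime_gt_0_nat)

lemma pabs_mult:
  assumes p: "prime p"
  shows "pabs p (x * y) = pabs p x * pabs p y"
proof (cases "x = 0 \<or> y = 0")
  case False
  obtain a b where x: "b \<noteq> 0" "x = of_int a / of_int b" using rat_fraction by blast
  obtain c d where y: "d \<noteq> 0" "y = of_int c / of_int d" using rat_fraction by blast
  have nz: "a \<noteq> 0" "c \<noteq> 0" using False x y by auto
  have pr: "prime_elem (int p)" using p by simp
  have xy: "x * y = of_int (a * c) / of_int (b * d)" by (simp add: x y)
  have "pval p (x * y) = pval p x + pval p y"
    unfolding xy unfolding x(2) y(2)
    using nz x(1) y(1) prime_elem_multiplicity_mult_distrib[OF pr]
    by (simp add: pval_fraction[OF p] del: of_int_mult)
  then show ?thesis using False p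
    by (simp add: pabs_def power_int_add prime_gt_0_nat power_int_diff field_simps power_int_minus)
qed (auto simp: pabs_def)

lemma pabs_1 [simp]: "prime p \<Longrightarrow> pabs p 1 = 1"
  using pval_fraction[of p 1 1] by (simp add: pabs_def)

lemma pabs_uminus:
  assumes p: "prime p" shows "pabs p (- x) = pabs p x"
proof (cases "x = 0")
  case False
  obtain a b where x: "b \<noteq> 0" "x = of_int a / of_int b" using rat_fraction by blast
  have a: "a \<noteq> 0" using False x by auto
  have "pval p (- x) = pval p x"
    using pval_fraction[OF p, of "- a" b] pval_fraction[OF p, of a b] x a
    by (simp add: multiplicity_minus)
  then show ?thesis by (simp add: pabs_def)
qed simp

lemma pabs_minus_commute: "prime p \<Longrightarrow> pabs p (x - y) = pabs p (y - x)"
  using pabs_uminus[of p "x - y"] by simp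

lemma pabs_add_max:
  assumes p: "prime p"
  shows "pabs p (x + y) \<le> max (pabs p x) (pabs p y)"
proof (cases "x = 0 \<or> y = 0 \<or> x + y = 0")
  case True
  then show ?thesis by (auto simp: le_max_iff_disj)
next
  case False
  obtain a0 b0 where x0: "b0 \<noteq> 0" "x = of_int a0 / of_int b0" using rat_fraction by blast
  obtain c0 d0 where y0: "d0 \<noteq> 0" "y = of_int c0 / of_int d0" using rat_fraction by blast
  define a b c where "a = a0 * d0" and "b = b0 * d0" and "c = c0 * b0"
  have b: "b \<noteq> 0" and x: "x = of_int a / of_int b" and y: "y = of_int c / of_int b"
    using x0 y0 by (auto simp: a_def b_def c_def)
  have xy: "x + y = of_int (a + c) / of_int b" by (simp add: x y add_divide_distrib)
  have nz: "a \<noteq> 0" "c \<noteq> 0" "a + c \<noteq> 0"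
    using False x y xy by (auto simp del: of_int_add)
  have np: "\<not> is_unit (int p)" using p prime_elem_not_unit by auto
  let ?k = "min (multiplicity (int p) a) (multiplicity (int p) c)"
  have "int p ^ ?k dvd a + c"
    by (intro dvd_add multiplicity_dvd') auto
  then have "?k \<le> multiplicity (int p) (a + c)"
    using nz np by (intro multiplicity_geI) auto
  then have "min (pval p x) (pval p y) \<le> pval p (x + y)"
    unfolding xy unfolding x y using nz b by (simp add: pval_fraction[OF p] del: of_int_add)
  then have "pval p x \<le> pval p (x + y) \<or> pval p y \<le> pval p (x + y)" by linarith
  then show ?thesis
    using False prime_ge_1_nat[OF p]
    by (auto simp: pabs_def le_max_iff_disj intro: power_int_increasing)
qed

lemma pabs_add_le: "prime p \<Longrightarrow> pabs p (x + y) \<le> pabs p x + pabs p y"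
  using pabs_add_max[of p x y] pabs_nonneg[of p x] pabs_nonneg[of p y] by linarith

lemma pabs_diff_abs:
  assumes p: "prime p" shows "\<bar>pabs p x - pabs p y\<bar> \<le> pabs p (x - y)"
  using pabs_add_le[OF p, of "x - y" y] pabs_add_le[OF p, of "y - x" x]
    pabs_minus_commute[OF p, of x y] by simp

lemma pabs_inverse: "prime p \<Longrightarrow> pabs p (inverse x) = inverse (pabs p x)"
proof (cases "x = 0")
  case False
  assume p: "prime p"
  have "pabs p (inverse x) * pabs p x = 1"
    using False pabs_mult[OF p, of "inverse x" x] p by simp
  then show ?thesis by (metis inverse_unique mult.commute)
qed simp

definition pnull :: "nat \<Rightarrow> (nat \<Rightarrow> rat) \<Rightarrow> bool" where
  "pnull p X \<longleftrightarrow> (\<lambda>n. pabs p (X n)) \<longlonglongrightarrow> 0"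

definition pcauchy :: "nat \<Rightarrow> (nat \<Rightarrow> rat) \<Rightarrow> bool" where
  "pcauchy p X \<longleftrightarrow> (\<forall>e>0. \<exists>N. \<forall>i\<ge>N. \<forall>j\<ge>N. pabs p (X i - X j) < e)"

lemma pnull_bound:
  assumes "Y \<longlonglongrightarrow> 0" and "eventually (\<lambda>n. pabs p (X n) \<le> Y n) sequentially"
  shows "pnull p X"
  unfolding pnull_def
  by (rule Lim_null_comparison[OF _ assms(1)]) (use assms(2) in \<open>simp add: eventually_mono\<close>)

lemma pnull_add: "prime p \<Longrightarrow> pnull p X \<Longrightarrow> pnull p Y \<Longrightarrow> pnull p (\<lambda>n. X n + Y n)"
  by (rule pnull_bound[of "\<lambda>n. pabs p (X n) + pabs p (Y n)"])
    (auto simp: pnull_def pabs_add_le intro: tendsto_add_zero)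

lemma pnull_uminus: "prime p \<Longrightarrow> pnull p X \<Longrightarrow> pnull p (\<lambda>n. - X n)"
  by (simp add: pnull_def pabs_uminus)

lemma pnull_const: "prime p \<Longrightarrow> pnull p (\<lambda>n. c) \<longleftrightarrow> c = 0"
  by (simp add: pnull_def pabs_eq_0 tendsto_const_iff)

lemma pcauchy_const [simp]: "pcauchy p (\<lambda>n. c)"
  by (simp add: pcauchy_def)

lemma pcauchy_add:
  assumes p: "prime p" and X: "pcauchy p X" and Y: "pcauchy p Y"
  shows "pcauchy p (\<lambda>n. X n + Y n)"
  unfolding pcauchy_def
proof (intro allI impI)
  fix e :: real assume e: "e > 0"
  obtain N where N: "\<forall>i\<ge>N. \<forall>j\<ge>N. pabs p (X i - X j) < e" using X e by (auto simp: pcauchy_def)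
  obtain M where M: "\<forall>i\<ge>M. \<forall>j\<ge>M. pabs p (Y i - Y j) < e" using Y e by (auto simp: pcauchy_def)
  have "pabs p (X i + Y i - (X j + Y j)) < e" if "i \<ge> max N M" "j \<ge> max N M" for i j
  proof -
    have "pabs p (X i + Y i - (X j + Y j)) \<le> max (pabs p (X i - X j)) (pabs p (Y i - Y j))"
      using pabs_add_max[OF p, of "X i - X j" "Y i - Y j"] by (simp add: algebra_simps)
    also have "\<dots> < e" using N M that by simp
    finally show ?thesis .
  qed
  then show "\<exists>N. \<forall>i\<ge>N. \<forall>j\<ge>N. pabs p (X i + Y i - (X j + Y j)) < e" by blast
qed

lemma pcauchy_uminus: "prime p \<Longrightarrow> pcauchy p X \<Longrightarrow> pcauchy p (\<lambda>n. - X n)"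
  unfolding pcauchy_def using pabs_minus_commute[of p] by simp

lemma pcauchy_Cauchy_pabs:
  assumes p: "prime p" and X: "pcauchy p X"
  shows "Cauchy (\<lambda>n. pabs p (X n))"
  unfolding Cauchy_def dist_real_def
proof (intro allI impI)
  fix e :: real assume e: "e > 0"
  then obtain N where "\<forall>i\<ge>N. \<forall>j\<ge>N. pabs p (X i - X j) < e" using X by (auto simp: pcauchy_def)
  then show "\<exists>N. \<forall>m\<ge>N. \<forall>n\<ge>N. \<bar>pabs p (X m) - pabs p (X n)\<bar> < e"
    using pabs_diff_abs[OF p] by (meson le_less_trans)
qed

lemma pcauchy_convergent_pabs:
  "prime p \<Longrightarrow> pcauchy p X \<Longrightarrow> convergent (\<lambda>n. pabs p (X n))"
  using pcauchy_Cauchy_pabs by (simp add: Cauchy_convergent_iff)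

lemma pcauchy_bounded:
  assumes p: "prime p" and X: "pcauchy p X"
  shows "\<exists>b>0. \<forall>n. pabs p (X n) \<le> b"
proof -
  have "Bseq (\<lambda>n. pabs p (X n))"
    using pcauchy_Cauchy_pabs[OF assms] Cauchy_Bseq by blast
  then obtain b where "b > 0" "\<forall>n. norm (pabs p (X n)) \<le> b" by (auto elim: BseqE)
  then show ?thesis by auto
qed

lemma pnull_mult_bounded:
  assumes p: "prime p" and b: "\<And>n. pabs p (X n) \<le> b" and Y: "pnull p Y"
  shows "pnull p (\<lambda>n. X n * Y n)"
proof (rule pnull_bound)
  show "(\<lambda>n. b * pabs p (Y n)) \<longlonglongrightarrow> 0"
    using Y tendsto_mult_right_zero unfolding pnull_def by blast
qed (use b in \<open>simp add: pabs_mult[OF p] mult_right_mono\<close>)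

lemma pcauchy_mult:
  assumes p: "prime p" and X: "pcauchy p X" and Y: "pcauchy p Y"
  shows "pcauchy p (\<lambda>n. X n * Y n)"
  unfolding pcauchy_def
proof (intro allI impI)
  fix e :: real assume e: "e > 0"
  obtain a where a: "a > 0" "\<forall>n. pabs p (X n) \<le> a" using pcauchy_bounded[OF p X] by blast
  obtain b where b: "b > 0" "\<forall>n. pabs p (Y n) \<le> b" using pcauchy_bounded[OF p Y] by blast
  obtain N where N: "\<forall>i\<ge>N. \<forall>j\<ge>N. pabs p (X i - X j) < e / b"
    using X e b unfolding pcauchy_def by (meson divide_pos_pos)
  obtain M where M: "\<forall>i\<ge>M. \<forall>j\<ge>M. pabs p (Y i - Y j) < e / a"
    using Y e a unfolding pcauchy_def by (meson divide_pos_pos)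
  have "pabs p (X i * Y i - X j * Y j) < e" if ij: "i \<ge> max N M" "j \<ge> max N M" for i j
  proof -
    have "X i * Y i - X j * Y j = X i * (Y i - Y j) + (X i - X j) * Y j"
      by (simp add: algebra_simps)
    then have "pabs p (X i * Y i - X j * Y j)
        \<le> max (pabs p (X i) * pabs p (Y i - Y j)) (pabs p (X i - X j) * pabs p (Y j))"
      using pabs_add_max[OF p, of "X i * (Y i - Y j)" "(X i - X j) * Y j"]
      by (simp add: pabs_mult[OF p])
    moreover have "pabs p (X i) * pabs p (Y i - Y j) \<le> a * pabs p (Y i - Y j)"
      using a by (simp add: mult_right_mono)
    moreover have "a * pabs p (Y i - Y j) < e" using M ij a by (simp add: field_simps)
    moreover have "pabs p (X i - X j) * pabs p (Y j) \<le> pabs p (X i - X j) * b"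
      using b by (simp add: mult_left_mono)
    moreover have "pabs p (X i - X j) * b < e" using N ij b by (simp add: field_simps)
    ultimately show ?thesis by linarith
  qed
  then show "\<exists>N. \<forall>i\<ge>N. \<forall>j\<ge>N. pabs p (X i * Y i - X j * Y j) < e" by blast
qed

lemma pcauchy_not_pnull:
  assumes p: "prime p" and X: "pcauchy p X" and nz: "\<not> pnull p X"
  shows "\<exists>b>0. \<exists>N. \<forall>n\<ge>N. b < pabs p (X n)"
proof -
  obtain l where l: "(\<lambda>n. pabs p (X n)) \<longlonglongrightarrow> l"
    using pcauchy_convergent_pabs[OF p X] by (auto simp: convergent_def)
  have "l \<ge> 0" by (rule LIMSEQ_le_const[OF l]) auto
  moreover have "l \<noteq> 0" using nz l by (auto simp: pnull_def)
  ultimately have "l > 0" by simp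
  then have "eventually (\<lambda>n. l / 2 < pabs p (X n)) sequentially"
    using order_tendstoD(1)[OF l, of "l / 2"] by simp
  then show ?thesis
    using \<open>l > 0\<close> unfolding eventually_sequentially by (intro exI[of _ "l / 2"]) simp
qed

lemma pabs_inverse_diff:
  assumes p: "prime p" and b: "b > 0" "b < pabs p x" "c > 0" "c < pabs p y"
  shows "pabs p (inverse x - inverse y) \<le> pabs p (x - y) / (b * c)"
proof -
  have nz: "x \<noteq> 0" "y \<noteq> 0" using b by auto
  have "inverse x - inverse y = (y - x) * (inverse x * inverse y)"
    using nz by (simp add: field_simps)
  then have "pabs p (inverse x - inverse y) = pabs p (x - y) * inverse (pabs p x * pabs p y)"
    by (simp add: pabs_mult[OF p] pabs_inverse[OF p] pabs_minus_commute[OF p, of y x])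
  also have "\<dots> \<le> pabs p (x - y) * inverse (b * c)"
    using b by (intro mult_left_mono le_imp_inverse_le mult_mono) auto
  finally show ?thesis by (simp add: divide_inverse)
qed

lemma pcauchy_inverse:
  assumes p: "prime p" and X: "pcauchy p X" and nz: "\<not> pnull p X"
  shows "pcauchy p (\<lambda>n. inverse (X n))"
  unfolding pcauchy_def
proof (intro allI impI)
  fix e :: real assume e: "e > 0"
  obtain b N where b: "b > 0" "\<forall>n\<ge>N. b < pabs p (X n)"
    using pcauchy_not_pnull[OF assms] by blast
  have "e * (b * b) > 0" using e b by simp
  then obtain M where M: "\<forall>i\<ge>M. \<forall>j\<ge>M. pabs p (X i - X j) < e * (b * b)"
    using X unfolding pcauchy_def by blast
  have "pabs p (inverse (X i) - inverse (X j)) < e" if ij: "i \<ge> max N M" "j \<ge> max N M" for i j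
  proof -
    have "pabs p (inverse (X i) - inverse (X j)) \<le> pabs p (X i - X j) / (b * b)"
      using b ij by (intro pabs_inverse_diff[OF p]) auto
    also have "\<dots> < e" using M ij b by (simp add: pos_divide_less_eq)
    finally show ?thesis .
  qed
  then show "\<exists>N. \<forall>i\<ge>N. \<forall>j\<ge>N. pabs p (inverse (X i) - inverse (X j)) < e" by blast
qed

lemma pnull_inverse_diff:
  assumes p: "prime p" and X: "pcauchy p X" "\<not> pnull p X" and Y: "pcauchy p Y" "\<not> pnull p Y"
    and XY: "pnull p (\<lambda>n. X n - Y n)"
  shows "pnull p (\<lambda>n. inverse (X n) - inverse (Y n))"
proof -
  obtain b N where b: "b > 0" "\<forall>n\<ge>N. b < pabs p (X n)"
    using pcauchy_not_pnull[OF p X] by blast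
  obtain c M where c: "c > 0" "\<forall>n\<ge>M. c < pabs p (Y n)"
    using pcauchy_not_pnull[OF p Y] by blast
  show ?thesis
  proof (rule pnull_bound)
    show "(\<lambda>n. pabs p (X n - Y n) / (b * c)) \<longlonglongrightarrow> 0"
      using XY unfolding pnull_def by (rule tendsto_divide_zero)
    show "eventually (\<lambda>n. pabs p (inverse (X n) - inverse (Y n)) \<le> pabs p (X n - Y n) / (b * c))
      sequentially"
      unfolding eventually_sequentially
      using b c by (intro exI[of _ "max N M"]) (auto intro!: pabs_inverse_diff[OF p])
  qed
qed

typedef (overloaded) 'p padic_cauchy = "{X. pcauchy CARD('p::prime_card) X}"
  by (rule exI[of _ "\<lambda>n. 0"]) simp

setup_lifting type_definition_padic_cauchy

instantiation padic_cauchy :: (prime_card) comm_ring_1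
begin

lift_definition zero_padic_cauchy :: "'a padic_cauchy" is "\<lambda>n. 0" by simp

lift_definition one_padic_cauchy :: "'a padic_cauchy" is "\<lambda>n. 1" by simp

lift_definition plus_padic_cauchy :: "'a padic_cauchy \<Rightarrow> 'a padic_cauchy \<Rightarrow> 'a padic_cauchy"
  is "\<lambda>X Y n. X n + Y n" by (rule pcauchy_add[OF prime_card])

lift_definition uminus_padic_cauchy :: "'a padic_cauchy \<Rightarrow> 'a padic_cauchy"
  is "\<lambda>X n. - X n" by (rule pcauchy_uminus[OF prime_card])

lift_definition minus_padic_cauchy :: "'a padic_cauchy \<Rightarrow> 'a padic_cauchy \<Rightarrow> 'a padic_cauchy"
  is "\<lambda>X Y n. X n - Y n"
  using pcauchy_add[OF prime_card _ pcauchy_uminus[OF prime_card]] by simp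

lift_definition times_padic_cauchy :: "'a padic_cauchy \<Rightarrow> 'a padic_cauchy \<Rightarrow> 'a padic_cauchy"
  is "\<lambda>X Y n. X n * Y n" by (rule pcauchy_mult[OF prime_card])

instance
  by standard (transfer; force simp: algebra_simps fun_eq_iff)+

end

lift_definition cnull :: "'p::prime_card padic_cauchy \<Rightarrow> bool" is "pnull CARD('p)" .

lift_definition cinv :: "'p::prime_card padic_cauchy \<Rightarrow> 'p padic_cauchy"
  is "\<lambda>X. if pnull CARD('p) X then (\<lambda>n. 0) else (\<lambda>n. inverse (X n))"
  by (simp add: pcauchy_inverse[OF prime_card])

lift_definition cnorm :: "'p::prime_card padic_cauchy \<Rightarrow> real"
  is "\<lambda>X. lim (\<lambda>n. pabs CARD('p) (X n))" .

lemma cnull_0 [simp]: "cnull 0"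
  by transfer (simp add: pnull_def)

lemma cnull_1 [simp]: "\<not> cnull 1"
  by transfer (simp add: pnull_const[OF prime_card])

lemma cnull_add: "cnull X \<Longrightarrow> cnull Y \<Longrightarrow> cnull (X + Y)"
  by transfer (rule pnull_add[OF prime_card])

lemma cnull_uminus: "cnull X \<Longrightarrow> cnull (- X)"
  by transfer (rule pnull_uminus[OF prime_card])

lemma cnull_diff: "cnull X \<Longrightarrow> cnull Y \<Longrightarrow> cnull (X - Y)"
  using cnull_add[OF _ cnull_uminus, of X Y] by simp

lemma cnull_minus_commute: "cnull (X - Y) \<Longrightarrow> cnull (Y - X)"
  using cnull_uminus[of "X - Y"] by simp

lemma cnull_mult: "cnull Y \<Longrightarrow> cnull (X * Y)"
  by transfer (metis pcauchy_bounded pnull_mult_bounded prime_card)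

lemma cnull_iff_cong: "cnull (X - Y) \<Longrightarrow> cnull X \<longleftrightarrow> cnull Y"
  using cnull_add[of "X - Y" Y] cnull_add[of "Y - X" X] cnull_minus_commute[of X Y] by auto

lemma cnull_cinv_diff: "cnull (X - Y) \<Longrightarrow> cnull (cinv X - cinv Y)"
proof -
  assume XY: "cnull (X - Y)"
  show ?thesis
  proof (cases "cnull X")
    case True
    then have "cnull Y" using cnull_iff_cong[OF XY] by simp
    with True show ?thesis by transfer (simp add: pnull_def)
  next
    case False
    then have "\<not> cnull Y" using cnull_iff_cong[OF XY] by simp
    with False XY show ?thesis
      by transfer (simp add: pnull_inverse_diff[OF prime_card])
  qed
qed

lemma cnull_cinv: "\<not> cnull X \<Longrightarrow> cnull (cinv X * X - 1)"
proof transfer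
  fix X assume X: "pcauchy CARD('a) X" "\<not> pnull CARD('a) X"
  obtain b N where b: "b > 0" "\<forall>n\<ge>N. b < pabs CARD('a) (X n)"
    using pcauchy_not_pnull[OF prime_card X] by blast
  have "X n \<noteq> 0" if "n \<ge> N" for n
    using b that by (metis less_asym pabs_0)
  then have "eventually (\<lambda>n. pabs CARD('a) (inverse (X n) * X n - 1) \<le> 0) sequentially"
    unfolding eventually_sequentially by (intro exI[of _ N]) simp
  then have "pnull CARD('a) (\<lambda>n. inverse (X n) * X n - 1)"
    by (rule pnull_bound[rotated]) simp
  then show "pnull CARD('a)
      (\<lambda>n. (if pnull CARD('a) X then \<lambda>n. 0 else (\<lambda>n. inverse (X n))) n * X n - 1)"
    using X by simp
qed

lemma cnorm_tendsto:
  "(\<lambda>n. pabs CARD('p) (Rep_padic_cauchy X n)) \<longlonglongrightarrow> cnorm (X :: 'p::prime_card padic_cauchy)"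
  by transfer (simp add: pcauchy_convergent_pabs[OF prime_card] convergent_LIMSEQ_iff[symmetric])

lemma cnorm_eq_0: "cnorm X = 0 \<longleftrightarrow> cnull (X :: 'p::prime_card padic_cauchy)"
proof -
  have "cnull X \<longleftrightarrow> (\<lambda>n. pabs CARD('p) (Rep_padic_cauchy X n)) \<longlonglongrightarrow> 0"
    by (simp add: cnull.rep_eq pnull_def)
  then show ?thesis using cnorm_tendsto[of X] LIMSEQ_unique by metis
qed

lemma cnorm_nonneg: "0 \<le> cnorm X"
  by (rule LIMSEQ_le_const[OF cnorm_tendsto]) auto

lemma cnorm_uminus: "cnorm (- X) = cnorm X"
  by transfer (simp add: pabs_uminus[OF prime_card])

lemma cnorm_1: "cnorm 1 = 1"
  by transfer (simp add: prime_card)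

lemma cnorm_mult: "cnorm (X * Y) = cnorm X * cnorm (Y :: 'p::prime_card padic_cauchy)"
proof (rule LIMSEQ_unique[OF cnorm_tendsto])
  show "(\<lambda>n. pabs CARD('p) (Rep_padic_cauchy (X * Y) n)) \<longlonglongrightarrow> cnorm X * cnorm Y"
    using tendsto_mult[OF cnorm_tendsto[of X] cnorm_tendsto[of Y]]
    by (simp add: times_padic_cauchy.rep_eq pabs_mult[OF prime_card])
qed

lemma cnorm_add_max: "cnorm (X + Y) \<le> max (cnorm X) (cnorm (Y :: 'p::prime_card padic_cauchy))"
proof (rule LIMSEQ_le[OF cnorm_tendsto])
  show "(\<lambda>n. max (pabs CARD('p) (Rep_padic_cauchy X n)) (pabs CARD('p) (Rep_padic_cauchy Y n)))
      \<longlonglongrightarrow> max (cnorm X) (cnorm Y)"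
    by (intro tendsto_max cnorm_tendsto)
qed (simp add: plus_padic_cauchy.rep_eq pabs_add_max[OF prime_card])

lemma cnorm_cong: "cnull (X - Y) \<Longrightarrow> cnorm X = cnorm Y"
proof -
  assume XY: "cnull (X - Y)"
  have "cnorm (X - Y) = 0" using XY by (simp add: cnorm_eq_0)
  moreover have "cnorm (Y - X) = 0" using XY cnull_minus_commute by (simp add: cnorm_eq_0)
  ultimately show ?thesis
    using cnorm_add_max[of "X - Y" Y] cnorm_add_max[of "Y - X" X] cnorm_nonneg[of X]
      cnorm_nonneg[of Y] by auto
qed

definition padic_rel :: "'p::prime_card padic_cauchy \<Rightarrow> 'p padic_cauchy \<Rightarrow> bool" where
  "padic_rel X Y \<longleftrightarrow> cnull (X - Y)"

lemma equivp_padic_rel: "equivp padic_rel"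
proof (rule equivpI)
  show "reflp padic_rel" by (simp add: reflp_def padic_rel_def)
  show "symp padic_rel" by (auto simp: symp_def padic_rel_def intro: cnull_minus_commute)
  show "transp padic_rel"
    unfolding transp_def padic_rel_def using cnull_add
    by (metis diff_add_cancel add_diff_eq)
qed

quotient_type (overloaded) 'p padic = "'p::prime_card padic_cauchy" / padic_rel
  by (rule equivp_padic_rel)

instantiation padic :: (prime_card) field
begin

lift_definition zero_padic :: "'a padic" is 0 .

lift_definition one_padic :: "'a padic" is 1 .

lift_definition plus_padic :: "'a padic \<Rightarrow> 'a padic \<Rightarrow> 'a padic" is "(+)"
  unfolding padic_rel_def using cnull_add by (metis add_diff_add)

lift_definition uminus_padic :: "'a padic \<Rightarrow> 'a padic" is "uminus"
  unfolding padic_rel_def using cnull_minus_commute by (metis minus_diff_minus cnull_uminus)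

lift_definition minus_padic :: "'a padic \<Rightarrow> 'a padic \<Rightarrow> 'a padic" is "(-)"
  unfolding padic_rel_def
proof -
  fix X Y Z W :: "'a padic_cauchy"
  assume "cnull (X - Y)" "cnull (Z - W)"
  then have "cnull ((X - Y) - (Z - W))" by (rule cnull_diff)
  then show "cnull (X - Z - (Y - W))" by (simp add: algebra_simps)
qed

lift_definition times_padic :: "'a padic \<Rightarrow> 'a padic \<Rightarrow> 'a padic" is "(*)"
  unfolding padic_rel_def
proof -
  fix X Y Z W :: "'a padic_cauchy"
  assume "cnull (X - Y)" "cnull (Z - W)"
  then have "cnull (X * (Z - W) + W * (X - Y))" by (intro cnull_add cnull_mult)
  then show "cnull (X * Z - Y * W)" by (simp add: algebra_simps)
qed

lift_definition inverse_padic :: "'a padic \<Rightarrow> 'a padic" is cinv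
  unfolding padic_rel_def by (rule cnull_cinv_diff)

definition divide_padic :: "'a padic \<Rightarrow> 'a padic \<Rightarrow> 'a padic" where
  "divide_padic x y = x * inverse y"

instance
proof
  fix a b c :: "'a padic"
  show "a + b + c = a + (b + c)" by transfer (simp add: padic_rel_def algebra_simps)
  show "a + b = b + a" by transfer (simp add: padic_rel_def algebra_simps)
  show "0 + a = a" by transfer (simp add: padic_rel_def)
  show "- a + a = 0" by transfer (simp add: padic_rel_def)
  show "a - b = a + - b" by transfer (simp add: padic_rel_def)
  show "a * b * c = a * (b * c)" by transfer (simp add: padic_rel_def algebra_simps)
  show "a * b = b * a" by transfer (simp add: padic_rel_def algebra_simps)
  show "1 * a = a" by transfer (simp add: padic_rel_def)
  show "(a + b) * c = a * c + b * c" by transfer (simp add: padic_rel_def algebra_simps)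
  show "(0 :: 'a padic) \<noteq> 1"
    by transfer (use cnull_iff_cong[of 0 1] in \<open>auto simp: padic_rel_def\<close>)
  show "a \<noteq> 0 \<Longrightarrow> inverse a * a = 1"
    by transfer (simp add: padic_rel_def cnull_cinv)
  show "a div b = a * inverse b" by (simp add: divide_padic_def)
  show "inverse (0 :: 'a padic) = 0"
    by transfer (simp add: padic_rel_def, transfer, simp add: pnull_def)
qed

end

text \<open>The overloaded \<open>norm\<close> is reserved for real normed vector spaces, hence a separate constant.\<close>

lift_definition pnorm :: "'p::prime_card padic \<Rightarrow> real" is cnorm
  unfolding padic_rel_def by (rule cnorm_cong)

lemma pnorm_eq_0 [simp]: "pnorm x = 0 \<longleftrightarrow> x = (0 :: 'p::prime_card padic)"
  by transfer (simp add: padic_rel_def cnorm_eq_0)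

lemma pnorm_nonneg [simp]: "0 \<le> pnorm (x :: 'p::prime_card padic)"
  by transfer (rule cnorm_nonneg)

lemma pnorm_1 [simp]: "pnorm (1 :: 'p::prime_card padic) = 1"
  by transfer (rule cnorm_1)

lemma pnorm_uminus [simp]: "pnorm (- x) = pnorm (x :: 'p::prime_card padic)"
  by transfer (rule cnorm_uminus)

lemma pnorm_mult: "pnorm (x * y) = pnorm x * pnorm (y :: 'p::prime_card padic)"
  by transfer (rule cnorm_mult)

lemma pnorm_add_max: "pnorm (x + y) \<le> max (pnorm x) (pnorm (y :: 'p::prime_card padic))"
  by transfer (rule cnorm_add_max)

instantiation padic :: (prime_card) "metric_space"
begin

definition dist_padic :: "'a padic \<Rightarrow> 'a padic \<Rightarrow> real" where
  "dist_padic x y = pnorm (x - y)"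

definition uniformity_padic :: "('a padic \<times> 'a padic) filter" where
  "uniformity_padic = (INF e\<in>{0<..}. principal {(x, y). dist x y < e})"

definition open_padic :: "'a padic set \<Rightarrow> bool" where
  "open_padic U \<longleftrightarrow> (\<forall>x\<in>U. eventually (\<lambda>(x', y). x' = x \<longrightarrow> y \<in> U) uniformity)"

instance
proof
  fix x y z :: "'a padic"
  show "dist x y = 0 \<longleftrightarrow> x = y" by (simp add: dist_padic_def)
  show "dist x y \<le> dist x z + dist y z"
    using pnorm_add_max[of "x - z" "z - y"] pnorm_uminus[of "y - z"]
      pnorm_nonneg[of "x - z"] pnorm_nonneg[of "y - z"]
    unfolding dist_padic_def by (simp add: max_def split: if_splits; linarith)
qed (auto simp: uniformity_padic_def open_padic_def)

end

lemma pnorm_of_nat: "pnorm (of_nat n :: 'p::prime_card padic) = pabs CARD('p) (of_nat n)"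
proof -
  have "Rep_padic_cauchy (of_nat n :: 'p padic_cauchy) = (\<lambda>_. of_nat n)"
    by (induction n) (simp_all add: zero_padic_cauchy.rep_eq one_padic_cauchy.rep_eq
        plus_padic_cauchy.rep_eq fun_eq_iff)
  then have "cnorm (of_nat n :: 'p padic_cauchy) = pabs CARD('p) (of_nat n)"
    by (simp add: cnorm.rep_eq)
  moreover have "(of_nat n :: 'p padic) = abs_padic (of_nat n)"
    by (induction n) (simp_all add: zero_padic_def one_padic_def plus_padic.abs_eq)
  ultimately show ?thesis by (simp add: pnorm.abs_eq)
qed

lemma pnorm_prime: "pnorm (of_nat CARD('p) :: 'p::prime_card padic) = 1 / real CARD('p)"
proof -
  have p: "prime CARD('p)" by (rule prime_card)
  have "pval CARD('p) (of_nat CARD('p)) = 1"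
    using pval_fraction[OF p, of "int CARD('p)" 1] prime_gt_0_nat[OF p] p
    by (simp add: multiplicity_self)
  then show ?thesis
    using prime_gt_0_nat[OF p] by (simp add: pnorm_of_nat pabs_def power_int_minus divide_inverse)
qed


section \<open>Balls, Haar measure and Fourier transform\<close>

definition Zp :: "'p::prime_card padic set" where
  "Zp = {x. pnorm x \<le> 1}"

definition padic_ball :: "int \<Rightarrow> 'p::prime_card padic \<Rightarrow> 'p padic set" where
  "padic_ball k a = (\<lambda>z. of_nat CARD('p) powi k * z + a) ` Zp"

definition padic_balls :: "'p::prime_card padic set set" where
  "padic_balls = {padic_ball k a | k a. True}"

definition normalized_haar :: "'p::prime_card padic measure \<Rightarrow> bool" where
  "normalized_haar m \<longleftrightarrow> sets m = sets borel
     \<and> (\<forall>a. \<forall>A\<in>sets borel. emeasure m ((\<lambda>x. x + a) ` A) = emeasure m A)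
     \<and> emeasure m Zp = 1"

definition test_functions :: "('p::prime_card padic \<Rightarrow> complex) set" where
  "test_functions = {u. (\<forall>x. \<exists>e>0. \<forall>y. dist y x < e \<longrightarrow> u y = u x) \<and> compact (closure {x. u x \<noteq> 0})}"

text \<open>
  \<open>frac_part x\<close> is the number \<open>r\<close> in $\mathbb Z[1/p] \cap [0,1)$ with $x - r \in \mathbb Z_p$, and
  \<open>padic_char\<close> is the standard additive character. Its kernel is $\mathbb Z_p$, so that the
  annihilator of $p^{-l}\mathbb Z_p$ with respect to the pairing \<open>padic_char (x * \<xi>)\<close> is
  $p^l\mathbb Z_p$.
\<close>

definition frac_part :: "'p::prime_card padic \<Rightarrow> real" where
  "frac_part x = (THE r. \<exists>n k. n < CARD('p) ^ k \<and> x - of_nat n / of_nat CARD('p) ^ k \<in> Zp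
                           \<and> r = real n / real CARD('p) ^ k)"

definition padic_char :: "'p::prime_card padic \<Rightarrow> complex" where
  "padic_char x = cis (2 * pi * frac_part x)"

definition fourier :: "'p::prime_card padic measure \<Rightarrow> ('p padic \<Rightarrow> complex) \<Rightarrow> 'p padic \<Rightarrow> complex" where
  "fourier m u \<xi> = (LINT x|m. u x * cnj (padic_char (x * \<xi>)))"

definition inv_fourier :: "'p::prime_card padic measure \<Rightarrow> ('p padic \<Rightarrow> complex) \<Rightarrow> 'p padic \<Rightarrow> complex" where
  "inv_fourier m v x = (LINT \<xi>|m. v \<xi> * padic_char (x * \<xi>))"

definition frac_deriv ::
    "'p::prime_card padic measure \<Rightarrow> real \<Rightarrow> ('p padic \<Rightarrow> complex) \<Rightarrow> 'p padic \<Rightarrow> complex" where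
  "frac_deriv m \<alpha> u = inv_fourier m (\<lambda>\<xi>. of_real (pnorm \<xi> powr \<alpha>) * fourier m u \<xi>)"


section \<open>Hierarchical Laplacians\<close>

definition ball_eigenvalue :: "('p::prime_card padic set \<Rightarrow> real) \<Rightarrow> 'p padic set \<Rightarrow> real" where
  "ball_eigenvalue C B = (\<Sum>\<^sub>\<infinity>T\<in>{T \<in> padic_balls. B \<subseteq> T}. C T)"

text \<open>Only the values of a choice function on balls are relevant.\<close>

definition choice_function :: "('p::prime_card padic set \<Rightarrow> real) \<Rightarrow> bool" where
  "choice_function C \<longleftrightarrow>
     (\<forall>B\<in>padic_balls. 0 < C B)
   \<and> (\<forall>B\<in>padic_balls. C summable_on {T \<in> padic_balls. B \<subseteq> T})
   \<and> (\<forall>x K. \<exists>\<delta>>0. \<forall>B\<in>padic_balls. x \<in> B \<and> diameter B < \<delta> \<longrightarrow> K < ball_eigenvalue C B)"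

definition ball_average ::
    "'p::prime_card padic measure \<Rightarrow> 'p padic set \<Rightarrow> ('p padic \<Rightarrow> complex) \<Rightarrow> complex" where
  "ball_average m B f = (LINT x:B|m. f x) / of_real (measure m B)"

definition hier_laplacian ::
    "'p::prime_card padic measure \<Rightarrow> ('p padic set \<Rightarrow> real) \<Rightarrow> ('p padic \<Rightarrow> complex) \<Rightarrow> 'p padic \<Rightarrow> complex" where
  "hier_laplacian m C f x =
     - (\<Sum>\<^sub>\<infinity>B\<in>{B \<in> padic_balls. x \<in> B}. of_real (C B) * (ball_average m B f - f x))"

definition ball_wave ::
    "'p::prime_card padic measure \<Rightarrow> int \<Rightarrow> 'p padic \<Rightarrow> complex" where
  "ball_wave m k x =
     1 / of_real (measure m (padic_ball k 0)) * indicator (padic_ball k 0) x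
   - 1 / of_real (measure m (padic_ball (k - 1) 0)) * indicator (padic_ball (k - 1) 0) x"


section \<open>Unbounded operators in $L^2$\<close>

text \<open>
  Elements of $L^2(M)$ are represented by functions. Operators are represented by their graphs,
  which are relations on square-integrable functions closed under equality almost everywhere.
\<close>

definition L2 :: "'a measure \<Rightarrow> ('a \<Rightarrow> complex) set" where
  "L2 M = {f \<in> borel_measurable M. integrable M (\<lambda>x. (cmod (f x))\<^sup>2)}"

definition l2_inner :: "'a measure \<Rightarrow> ('a \<Rightarrow> complex) \<Rightarrow> ('a \<Rightarrow> complex) \<Rightarrow> complex" where
  "l2_inner M f g = (LINT x|M. f x * cnj (g x))"

definition l2_norm :: "'a measure \<Rightarrow> ('a \<Rightarrow> complex) \<Rightarrow> real" where
  "l2_norm M f = sqrt (LINT x|M. (cmod (f x))\<^sup>2)"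

definition l2_closure :: "'a measure \<Rightarrow> ('a \<Rightarrow> complex) set \<Rightarrow> ('a \<Rightarrow> complex) set" where
  "l2_closure M S = {f \<in> L2 M. \<forall>e>0. \<exists>g\<in>S. l2_norm M (\<lambda>x. f x - g x) < e}"

definition fun_span :: "('a \<Rightarrow> complex) set \<Rightarrow> ('a \<Rightarrow> complex) set" where
  "fun_span S = {(\<lambda>x. \<Sum>u\<in>F. c u * u x) | F c. finite F \<and> F \<subseteq> S}"

definition l2_infinite_dim :: "'a measure \<Rightarrow> ('a \<Rightarrow> complex) set \<Rightarrow> bool" where
  "l2_infinite_dim M V \<longleftrightarrow>
     \<not> (\<exists>F. finite F \<and> F \<subseteq> V \<and> (\<forall>f\<in>V. \<exists>g\<in>fun_span F. AE x in M. f x = g x))"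

type_synonym 'a l2_graph = "('a \<Rightarrow> complex) rel"

definition l2_operator ::
    "'a measure \<Rightarrow> (('a \<Rightarrow> complex) \<Rightarrow> ('a \<Rightarrow> complex)) \<Rightarrow> ('a \<Rightarrow> complex) set \<Rightarrow> bool" where
  "l2_operator M A S \<longleftrightarrow>
     S \<subseteq> L2 M \<and> A ` S \<subseteq> L2 M \<and> fun_span S \<subseteq> S
   \<and> (\<forall>u\<in>S. \<forall>v\<in>S. (AE x in M. u x = v x) \<longrightarrow> (AE x in M. A u x = A v x))
   \<and> (\<forall>u\<in>S. \<forall>v\<in>S. AE x in M. A (\<lambda>y. u y + v y) x = A u x + A v x)
   \<and> (\<forall>u\<in>S. \<forall>c. AE x in M. A (\<lambda>y. c * u y) x = c * A u x)"

definition operator_graph ::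
    "'a measure \<Rightarrow> (('a \<Rightarrow> complex) \<Rightarrow> ('a \<Rightarrow> complex)) \<Rightarrow> ('a \<Rightarrow> complex) set \<Rightarrow> 'a l2_graph" where
  "operator_graph M A S =
     {(f, g). f \<in> L2 M \<and> g \<in> L2 M \<and> (\<exists>u\<in>S. (AE x in M. f x = u x) \<and> (AE x in M. g x = A u x))}"

definition graph_closure :: "'a measure \<Rightarrow> 'a l2_graph \<Rightarrow> 'a l2_graph" where
  "graph_closure M G =
     {(f, g). f \<in> L2 M \<and> g \<in> L2 M \<and>
        (\<forall>e>0. \<exists>(u, v)\<in>G. l2_norm M (\<lambda>x. f x - u x) < e \<and> l2_norm M (\<lambda>x. g x - v x) < e)}"

definition graph_adjoint :: "'a measure \<Rightarrow> 'a l2_graph \<Rightarrow> 'a l2_graph" where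
  "graph_adjoint M G =
     {(f, g). f \<in> L2 M \<and> g \<in> L2 M \<and> (\<forall>(u, v)\<in>G. l2_inner M v f = l2_inner M u g)}"

definition self_adjoint :: "'a measure \<Rightarrow> 'a l2_graph \<Rightarrow> bool" where
  "self_adjoint M H \<longleftrightarrow> l2_closure M (Domain H) = L2 M \<and> graph_adjoint M H = H"

definition essentially_self_adjoint ::
    "'a measure \<Rightarrow> (('a \<Rightarrow> complex) \<Rightarrow> ('a \<Rightarrow> complex)) \<Rightarrow> ('a \<Rightarrow> complex) set \<Rightarrow> bool" where
  "essentially_self_adjoint M A S \<longleftrightarrow>
     l2_operator M A S \<and> l2_closure M S = L2 M \<and> self_adjoint M (graph_closure M (operator_graph M A S))"

definition nonneg_definite ::
    "'a measure \<Rightarrow> (('a \<Rightarrow> complex) \<Rightarrow> ('a \<Rightarrow> complex)) \<Rightarrow> ('a \<Rightarrow> complex) set \<Rightarrow> bool" where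
  "nonneg_definite M A S \<longleftrightarrow> (\<forall>u\<in>S. l2_inner M (A u) u \<in> \<real> \<and> 0 \<le> Re (l2_inner M (A u) u))"

definition self_adjoint_extension ::
    "'a measure \<Rightarrow> (('a \<Rightarrow> complex) \<Rightarrow> ('a \<Rightarrow> complex)) \<Rightarrow> ('a \<Rightarrow> complex) set \<Rightarrow> 'a l2_graph" where
  "self_adjoint_extension M A S = (THE H. self_adjoint M H \<and> operator_graph M A S \<subseteq> H)"

text \<open>A point is in the resolvent set if \<open>H - z\<close> is a bijection onto $L^2$ with bounded inverse.\<close>

definition resolvent_set :: "'a measure \<Rightarrow> 'a l2_graph \<Rightarrow> complex set" where
  "resolvent_set M H =
     {z. (\<exists>c. \<forall>(f, g)\<in>H. l2_norm M f \<le> c * l2_norm M (\<lambda>x. g x - z * f x))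
       \<and> (\<forall>h\<in>L2 M. \<exists>(f, g)\<in>H. AE x in M. g x - z * f x = h x)}"

definition spectrum :: "'a measure \<Rightarrow> 'a l2_graph \<Rightarrow> complex set" where
  "spectrum M H = - resolvent_set M H"

definition eigenspace :: "'a measure \<Rightarrow> 'a l2_graph \<Rightarrow> complex \<Rightarrow> ('a \<Rightarrow> complex) set" where
  "eigenspace M H z = {f. (f, \<lambda>x. z * f x) \<in> H}"

definition eigenvalue :: "'a measure \<Rightarrow> 'a l2_graph \<Rightarrow> complex \<Rightarrow> bool" where
  "eigenvalue M H z \<longleftrightarrow> (\<exists>f\<in>eigenspace M H z. \<not> (AE x in M. f x = 0))"

end

(*
  Let P_k f(x) be the average of f over the coset of p^k Z_p containing x.  Writing |xi|^alpha
  as a step function on the spheres |xi| = p^j, whose Fourier transforms are differences of normalized ball indicators, gives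
    D^alpha u = sum over k of p^(k alpha) Q_k u,  where Q_k = P_k - P_(k-1),
  and summation by parts turns this series into the hierarchical Laplacian.  The Q_k are mutually
  orthogonal projections that resolve the identity of L^2.  The averages are defined at every point
  and depend only on the class of f modulo null sets, so the closure of the operator is the set of
  all pairs (f, g) with Q_k g = p^(k alpha) Q_k f everywhere, and self-adjointness, spectrum and
  eigenspaces can be read off from this description.
*)

theory Submission
  imports Defs "HOL-Library.Function_Algebras"
begin

section \<open>Arithmetic and topology of the $p$-adic field\<close>

text \<open>The constant diam(B)/p in the weights comes from an index shift. A function in the range
  of Q_k is constant on balls of level k and has mean zero on balls of level k - 1. In the Laplacian
  only the balls of level at most k - 1 act on it, so its eigenvalue is \<lambda>(B) for a ball B of
  diameter p^(1-k). This has to be p^(k \<alpha>), which is the diameter of the subballs of B,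
  namely diam(B)/p, to the power -\<alpha>; the power diam(B)^(-\<alpha>) would produce
  p^(-\<alpha>) D^\<alpha> instead. The closure must be shown to be the largest possible graph, so
  an arbitrary pair (f, g) has to be approximated by test functions and their images. Truncating to
  finitely many scales and then to the ball p^(-n) Z_p does this without any commutator error: the
  ball is a union of cosets of p^(k-1) Z_p for k > -n, so the cutoff commutes exactly with Q_k. That
  the Q_k resolve the identity depends on both ends: fine averages converge to f by density of the
  test functions, coarse ones converge to 0 because the total mass is infinite.\<close>

lift_definition rat_cauchy :: "rat \<Rightarrow> 'p::prime_card padic_cauchy" is "\<lambda>r n. r" by simp

lift_definition padic_of_rat :: "rat \<Rightarrow> 'p::prime_card padic" is rat_cauchy .

lemma padic_of_rat_add: "padic_of_rat (r + s) = (padic_of_rat r + padic_of_rat s :: 'p::prime_card padic)"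
proof transfer
  fix r s
  have "rat_cauchy (r + s) = (rat_cauchy r + rat_cauchy s :: 'p padic_cauchy)" by transfer simp
  then show "padic_rel (rat_cauchy (r + s)) (rat_cauchy r + rat_cauchy s :: 'p padic_cauchy)"
    by (simp add: padic_rel_def)
qed

lemma padic_of_rat_diff: "padic_of_rat (r - s) = (padic_of_rat r - padic_of_rat s :: 'p::prime_card padic)"
proof -
  have "padic_of_rat r = (padic_of_rat (r - s) + padic_of_rat s :: 'p padic)"
    by (metis padic_of_rat_add diff_add_cancel)
  then show ?thesis by (simp only: add_diff_cancel_right')
qed

lemma pnorm_padic_of_rat:
  "pnorm (padic_of_rat r :: 'p::prime_card padic) = pabs CARD('p) r"
proof transfer
  fix r
  show "cnorm (rat_cauchy r :: 'p padic_cauchy) = pabs CARD('p) r"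
    by transfer simp
qed

lemma padic_of_rat_0: "padic_of_rat 0 = (0 :: 'p::prime_card padic)"
  using pnorm_padic_of_rat[where 'p='p, of 0] by simp

lemma padic_of_rat_1: "padic_of_rat 1 = (1 :: 'p::prime_card padic)"
proof transfer
  have "rat_cauchy 1 = (1 :: 'p padic_cauchy)" by transfer simp
  then show "padic_rel (rat_cauchy 1) (1 :: 'p padic_cauchy)" by (simp add: padic_rel_def)
qed

lemma padic_of_rat_of_nat: "padic_of_rat (of_nat n) = (of_nat n :: 'p::prime_card padic)"
  by (induction n) (simp_all add: padic_of_rat_0 padic_of_rat_1 padic_of_rat_add)

lemma padic_of_rat_of_int: "padic_of_rat (of_int n) = (of_int n :: 'p::prime_card padic)"
proof (cases n)
  case (nonneg k)
  then show ?thesis by (simp add: padic_of_rat_of_nat)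
next
  case (neg k)
  then show ?thesis
    using padic_of_rat_diff[where 'p='p, of 0 "of_nat (Suc k)"]
    by (simp add: padic_of_rat_0 padic_of_rat_of_nat del: of_nat_Suc)
qed

lemma pnorm_of_int: "pnorm (of_int n :: 'p::prime_card padic) = pabs CARD('p) (of_int n)"
  by (metis padic_of_rat_of_int pnorm_padic_of_rat)

text \<open>The norm of a class is the limit of the rational absolute values along a representing
  sequence, so the distance from the n-th term to the class is a limit over k of \<open>pabs\<close>
  of \<open>X n - X k\<close>, which the Cauchy condition bounds. Density of the rationals and
  completeness both rest on this.\<close>

lemma pcauchy_tendsto:
  assumes X: "pcauchy CARD('p::prime_card) X"
  shows "(\<lambda>n. padic_of_rat (X n)) \<longlonglongrightarrow> abs_padic (Abs_padic_cauchy X :: 'p padic_cauchy)"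
    (is "_ \<longlonglongrightarrow> ?x")
proof (rule metric_LIMSEQ_I)
  fix e :: real assume e: "0 < e"
  then obtain N where N: "\<forall>i\<ge>N. \<forall>j\<ge>N. pabs CARD('p) (X i - X j) < e / 2"
    using X unfolding pcauchy_def by (meson half_gt_zero)
  have "dist (padic_of_rat (X n)) ?x < e" if n: "n \<ge> N" for n
  proof -
    have R: "Rep_padic_cauchy (rat_cauchy (X n) - Abs_padic_cauchy X :: 'p padic_cauchy) = (\<lambda>k. X n - X k)"
      using X by (simp add: minus_padic_cauchy.rep_eq rat_cauchy.rep_eq Abs_padic_cauchy_inverse)
    have "dist (padic_of_rat (X n)) ?x = cnorm (rat_cauchy (X n) - Abs_padic_cauchy X :: 'p padic_cauchy)"
      by (simp add: dist_padic_def padic_of_rat.abs_eq minus_padic.abs_eq pnorm.abs_eq)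
    also have "\<dots> \<le> e / 2"
      by (rule LIMSEQ_le_const2[OF cnorm_tendsto]) (use N n R in \<open>auto intro!: exI[of _ N] less_imp_le\<close>)
    finally show ?thesis using e by simp
  qed
  then show "\<exists>no. \<forall>n\<ge>no. dist (padic_of_rat (X n)) ?x < e" by blast
qed

lemma pnorm_minus_commute: "pnorm (x - y) = pnorm (y - x :: 'p::prime_card padic)"
  using pnorm_uminus[of "x - y"] by simp

lemma padic_rat_dense:
  fixes x :: "'p::prime_card padic"
  assumes "e > 0"
  obtains r where "pnorm (x - padic_of_rat r) < e"
proof -
  obtain Y :: "'p padic_cauchy" where "x = abs_padic Y" using Quotient_abs_rep[OF Quotient_padic] by metis
  then have "x = abs_padic (Abs_padic_cauchy (Rep_padic_cauchy Y))" by (simp add: Rep_padic_cauchy_inverse)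
  moreover have "pcauchy CARD('p) (Rep_padic_cauchy Y)" using Rep_padic_cauchy by blast
  ultimately have "(\<lambda>n. padic_of_rat (Rep_padic_cauchy Y n)) \<longlonglongrightarrow> x" using pcauchy_tendsto by metis
  from metric_LIMSEQ_D[OF this assms] show ?thesis
    using that by (auto simp: dist_padic_def pnorm_minus_commute[of x])
qed

lemma pnorm_diff_max: "pnorm (x - y) \<le> max (pnorm x) (pnorm (y :: 'p::prime_card padic))"
  using pnorm_add_max[of x "- y"] by simp

text \<open>Compactness of balls is later derived from completeness and total boundedness. Replacing
  \<open>X n\<close> by a rational within 1/(n+1) gives a Cauchy sequence of rationals, which
  represents the limit.\<close>

instance padic :: (prime_card) complete_space
proof
  fix X :: "nat \<Rightarrow> 'a padic" assume X: "Cauchy X"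
  have "\<forall>n. \<exists>r. pnorm (X n - padic_of_rat r) < inverse (real (Suc n))"
  proof
    fix n
    obtain r where "pnorm (X n - padic_of_rat r) < inverse (real (Suc n))"
      by (rule padic_rat_dense[of "inverse (real (Suc n))" "X n"]) auto
    then show "\<exists>r. pnorm (X n - padic_of_rat r) < inverse (real (Suc n))" by blast
  qed
  then obtain r where r: "\<And>n. pnorm (X n - padic_of_rat (r n)) < inverse (real (Suc n))" by metis
  have "(\<lambda>n. dist (X n) (padic_of_rat (r n))) \<longlonglongrightarrow> 0"
    by (rule tendsto_sandwich[OF _ _ tendsto_const LIMSEQ_inverse_real_of_nat])
      (use r in \<open>auto simp: dist_padic_def intro!: always_eventually less_imp_le\<close>)
  note d0 = this
  have "pcauchy CARD('a) r"
    unfolding pcauchy_def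
  proof (intro allI impI)
    fix e :: real assume e: "e > 0"
    from metric_CauchyD[OF X this] obtain N where N: "\<forall>m\<ge>N. \<forall>n\<ge>N. dist (X m) (X n) < e" by blast
    obtain M where M: "\<forall>n\<ge>M. dist (X n) (padic_of_rat (r n)) < e"
      using metric_LIMSEQ_D[OF d0 e] by (auto simp: dist_real_def)
    \<comment> \<open>The ultrametric inequality takes the maximum of the three differences, so the
      same e serves for each of them.\<close>
    have "pabs CARD('a) (r i - r j) < e" if "i \<ge> max N M" "j \<ge> max N M" for i j
    proof -
      have "pabs CARD('a) (r i - r j) = pnorm ((padic_of_rat (r i) - X i) + ((X i - X j) + (X j - padic_of_rat (r j))))"
        by (simp flip: pnorm_padic_of_rat add: padic_of_rat_diff)
      also have "\<dots> \<le> max (pnorm (padic_of_rat (r i) - X i)) (max (pnorm (X i - X j)) (pnorm (X j - padic_of_rat (r j))))"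
        by (rule order_trans[OF pnorm_add_max max.mono[OF order_refl pnorm_add_max]])
      also have "\<dots> < e"
        using N M that by (simp add: dist_padic_def pnorm_minus_commute)
      finally show ?thesis .
    qed
    then show "\<exists>N. \<forall>i\<ge>N. \<forall>j\<ge>N. pabs CARD('a) (r i - r j) < e" by blast
  qed
  from pcauchy_tendsto[OF this] obtain x where rx: "(\<lambda>n. padic_of_rat (r n)) \<longlonglongrightarrow> (x :: 'a padic)" by blast
  have "X \<longlonglongrightarrow> x"
  proof (rule metric_LIMSEQ_I)
    fix e :: real assume "e > 0"
    then have "e / 2 > 0" by simp
    then obtain N M where N: "\<forall>n\<ge>N. dist (padic_of_rat (r n)) x < e / 2"
      and M: "\<forall>n\<ge>M. dist (dist (X n) (padic_of_rat (r n))) 0 < e / 2"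
      using metric_LIMSEQ_D[OF rx] metric_LIMSEQ_D[OF d0] by meson
    have "dist (X n) x < e" if "n \<ge> max N M" for n
      using N[rule_format, of n] M[rule_format, of n] that
        dist_triangle[of "X n" x "padic_of_rat (r n)"] by (simp add: dist_real_def)
    then show "\<exists>N. \<forall>n\<ge>N. dist (X n) x < e" by blast
  qed
  then show "convergent X" by (auto simp: convergent_def)
qed

section \<open>Powers of p, values of the norm, residues\<close>

lemma CARD_prime_gt_Suc_0 [simp]: "Suc 0 < CARD('p::prime_card)"
  using prime_gt_1_nat[OF prime_card[where 'a='p]] by (simp only: One_nat_def)

lemma CARD_prime_gt_1 [simp]: "1 < real CARD('p::prime_card)"
  by (metis CARD_prime_gt_Suc_0 One_nat_def of_nat_1 of_nat_less_iff)

lemma CARD_prime_gt_0 [simp]: "0 < real CARD('p::prime_card)" "CARD('p::prime_card) \<noteq> 0"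
  using prime_gt_0_nat[OF prime_card[where 'a='p]] by simp_all

lemma CARD_powi_pos [simp]: "0 < real CARD('p::prime_card) powi k"
  by (rule zero_less_power_int[OF CARD_prime_gt_0(1)])

lemma powi_le_iff: "1 < (a::real) \<Longrightarrow> a powi i \<le> a powi j \<longleftrightarrow> i \<le> j"
  using power_int_increasing[of i j a] power_int_strict_increasing[of j i a] by linarith

lemma CARD_powi_le_iff [simp]: "real CARD('p::prime_card) powi i \<le> real CARD('p) powi j \<longleftrightarrow> i \<le> j"
  by (rule powi_le_iff) simp

lemma CARD_powi_less_iff [simp]: "real CARD('p::prime_card) powi i < real CARD('p) powi j \<longleftrightarrow> i < j"
  using CARD_powi_le_iff[where 'p='p, of j i] by linarith

lemma CARD_powi_eq_iff [simp]: "real CARD('p::prime_card) powi i = real CARD('p) powi j \<longleftrightarrow> i = j"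
  using CARD_powi_le_iff[where 'p='p, of j i] CARD_powi_le_iff[where 'p='p, of i j] by linarith

lemma pnorm_0 [simp]: "pnorm (0 :: 'p::prime_card padic) = 0"
  by simp

text \<open>Norm bounds become divisibility statements here; every count of cosets goes through this
  equivalence.\<close>

lemma pabs_of_int_le_iff:
  assumes p: "prime p"
  shows "pabs p (of_int n) \<le> real p powi (- int k) \<longleftrightarrow> int p ^ k dvd n"
proof (cases "n = 0")
  case True
  then show ?thesis using prime_gt_0_nat[OF p] by simp
next
  case False
  have u: "\<not> is_unit (int p)" using p prime_elem_not_unit by auto
  have "pval p (of_int n) = int (multiplicity (int p) n)"
    using pval_fraction[OF p, of n 1] False by simp
  then have "pabs p (of_int n) = real p powi (- int (multiplicity (int p) n))"
    using False by (simp add: pabs_def)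
  then have "pabs p (of_int n) \<le> real p powi (- int k) \<longleftrightarrow> k \<le> multiplicity (int p) n"
    using prime_gt_1_nat[OF p] powi_le_iff[of "real p"] by simp
  also have "\<dots> \<longleftrightarrow> int p ^ k dvd n"
    using False u by (intro power_dvd_iff_le_multiplicity[symmetric]) auto
  finally show ?thesis .
qed

lemma pabs_of_int_le_1: "prime p \<Longrightarrow> pabs p (of_int n) \<le> 1"
  using pabs_of_int_le_iff[of p n 0] by simp

lemma pnorm_eqI:
  fixes x :: "'p::prime_card padic"
  assumes "pnorm (x - y) < pnorm x"
  shows "pnorm y = pnorm x"
  using assms pnorm_add_max[of "x - y" y] pnorm_diff_max[of x "x - y"] by auto

text \<open>In an ultrametric field a point closer to x than 0 is has the norm of x. A rational
  close to x therefore shares its norm, and for rationals the norm is a power of p by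
  definition.\<close>

lemma pnorm_value:
  fixes x :: "'p::prime_card padic"
  assumes "x \<noteq> 0"
  obtains k :: int where "pnorm x = real CARD('p) powi k"
proof -
  have "pnorm x > 0" using assms pnorm_nonneg[of x] pnorm_eq_0[of x] by linarith
  then obtain r where "pnorm (x - padic_of_rat r) < pnorm x" by (rule padic_rat_dense)
  then have eq: "pnorm x = pabs CARD('p) r" using pnorm_eqI by (metis pnorm_padic_of_rat)
  then have "r \<noteq> 0" using assms by auto
  then show ?thesis using that eq by (simp add: pabs_def)
qed

text \<open>A rational of norm at most 1 has a denominator prime to p, which is invertible modulo
  p^k; hence the natural numbers are dense in \<open>Zp\<close>. These residues give the cosets of
  p^k Z_p and, later, the fractional part.\<close>

lemma padic_residue:
  fixes x :: "'p::prime_card padic"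
  assumes x: "pnorm x \<le> 1"
  obtains n where "n < CARD('p) ^ k" "pnorm (x - of_nat n) \<le> real CARD('p) powi (- int k)"
proof -
  let ?p = "CARD('p)"
  have p: "prime ?p" by (rule prime_card)
  have e: "0 < real ?p powi (- int k)" by simp
  obtain r where r: "pnorm (x - padic_of_rat r) < real ?p powi (- int k)"
    using padic_rat_dense[OF e] .
  have "real ?p powi (- int k) \<le> 1"
    using prime_ge_1_nat[OF p] by (simp add: power_int_minus field_simps)
  then have "pnorm (padic_of_rat r :: 'p padic) \<le> 1"
    using r x pnorm_diff_max[of x "x - padic_of_rat r"] by auto
  then have r1: "pabs ?p r \<le> 1" by (simp add: pnorm_padic_of_rat)
  obtain a b where q: "quotient_of r = (a, b)" by fastforce
  have b: "b > 0" and cop: "coprime a b" and rab: "r = of_int a / of_int b"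
    using quotient_of_denom_pos[OF q] quotient_of_coprime[OF q] quotient_of_div[OF q] by auto
  have pr: "prime (int ?p)" using p by simp
  have nb: "\<not> int ?p dvd b"
  proof
    \<comment> \<open>In lowest terms p cannot divide the numerator too, yet |a| = |r| |b| \<le> 1/p
      says that it does.\<close>
    assume d: "int ?p dvd b"
    then have na: "\<not> int ?p dvd a" using cop pr by (meson coprime_common_divisor not_prime_unit)
    have "a \<noteq> 0" using na by auto
    have "pabs ?p r * pabs ?p (of_int b) = pabs ?p (of_int a)"
      using rab b by (simp flip: pabs_mult[OF p])
    moreover have "pabs ?p (of_int b) \<le> inverse (real ?p)"
      using pabs_of_int_le_iff[OF p, of b 1] d by (simp add: power_int_minus)
    moreover have "pabs ?p r * pabs ?p (of_int b) \<le> pabs ?p (of_int b)"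
      using mult_right_mono[OF r1 pabs_nonneg] by simp
    ultimately have "pabs ?p (of_int a) \<le> inverse (real ?p)" by simp
    then show False using na pabs_of_int_le_iff[OF p, of a 1] by (simp add: power_int_minus)
  qed
  then have "coprime b (int ?p ^ k)" using pr
    by (metis coprime_commute coprime_power_right_iff prime_imp_coprime)
  \<comment> \<open>u inverts b modulo p^k, so a u represents a/b modulo p^k.\<close>
  then obtain u v where uv: "u * b + v * int ?p ^ k = 1"
    using bezout_int[of b "int ?p ^ k"] by (auto simp: coprime_iff_gcd_eq_1)
  define n where "n = nat ((a * u) mod int ?p ^ k)"
  have pk: "0 < int ?p ^ k" using prime_gt_0_nat[OF p] by simp
  have n: "int n = (a * u) mod int ?p ^ k" using pos_mod_sign[OF pk] by (simp add: n_def)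
  have "int ?p ^ k dvd a * u - int n" unfolding n by (rule dvd_minus_mod)
  \<comment> \<open>The added multiple of p^k completes u b to u b + v p^k = 1.\<close>
  then have "int ?p ^ k dvd b * (a * u - int n) + a * (v * int ?p ^ k)" by simp
  also have "b * (a * u - int n) + a * (v * int ?p ^ k) = a * (u * b + v * int ?p ^ k) - b * int n"
    by (simp add: algebra_simps)
  finally have dv: "int ?p ^ k dvd a - b * int n" using uv by simp
  have pb: "pabs ?p (of_int b) = 1"
  proof -
    have "multiplicity (int ?p) b = 0" using nb by (rule not_dvd_imp_multiplicity_0)
    then show ?thesis using b pval_fraction[OF p, of b 1] by (simp add: pabs_def)
  qed
  \<comment> \<open>b has norm 1, so multiplying by it clears the denominator without changing the
    norm.\<close>
  have "pabs ?p (r - of_nat n) = pabs ?p (r - of_nat n) * pabs ?p (of_int b)" using pb by simp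
  also have "\<dots> = pabs ?p ((r - of_nat n) * of_int b)" by (simp only: pabs_mult[OF p])
  also have "pabs ?p ((r - of_nat n) * of_int b) = pabs ?p (of_int (a - b * int n))"
    using b by (simp add: rab left_diff_distrib mult.commute[of _ "of_int b"] right_diff_distrib)
  also have "\<dots> \<le> real ?p powi (- int k)" using dv pabs_of_int_le_iff[OF p] by blast
  finally have "pnorm (padic_of_rat r - of_nat n :: 'p padic) \<le> real ?p powi (- int k)"
    by (simp flip: pnorm_padic_of_rat padic_of_rat_of_nat padic_of_rat_diff)
  then have "pnorm (x - of_nat n) \<le> real ?p powi (- int k)"
    using r pnorm_add_max[of "x - padic_of_rat r" "padic_of_rat r - of_nat n"] by simp
  moreover have "n < ?p ^ k"
  proof -
    have "int n < int (?p ^ k)" unfolding n using pos_mod_bound[OF pk] by simp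
    then show ?thesis by linarith
  qed
  ultimately show ?thesis using that by blast
qed

lemma pnorm_inverse: "pnorm (inverse x) = inverse (pnorm (x :: 'p::prime_card padic))"
proof (cases "x = 0")
  case False
  then have "pnorm (inverse x) * pnorm x = 1" by (simp flip: pnorm_mult)
  then show ?thesis by (metis inverse_unique mult.commute)
qed simp

lemma pnorm_power: "pnorm (x ^ n) = pnorm (x :: 'p::prime_card padic) ^ n"
  by (induction n) (simp_all add: pnorm_mult)

lemma pnorm_prime_power_int:
  "pnorm (of_nat CARD('p) powi k :: 'p::prime_card padic) = real CARD('p) powi (- k)"
proof (cases k)
  case (nonneg n)
  then show ?thesis
    by (simp add: pnorm_power pnorm_prime power_int_minus power_one_over field_simps)
next
  case (neg n)
  then have "of_nat CARD('p) powi k = inverse (of_nat CARD('p) ^ Suc n :: 'p padic)"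
    by (metis power_int_minus power_int_of_nat)
  then have "pnorm (of_nat CARD('p) powi k :: 'p padic) = inverse ((1 / real CARD('p)) ^ Suc n)"
    by (simp only: pnorm_inverse pnorm_power pnorm_prime)
  also have "\<dots> = real CARD('p) ^ Suc n"
    by (simp only: power_one_over inverse_inverse_eq power_inverse inverse_eq_divide [symmetric])
  also have "\<dots> = real CARD('p) powi (- k)"
    unfolding neg by (simp only: minus_minus power_int_of_nat)
  finally show ?thesis .
qed

lemma of_nat_CARD_padic_nonzero [simp]: "of_nat CARD('p) \<noteq> (0 :: 'p::prime_card padic)"
  using pnorm_prime[where 'p='p] by (metis CARD_prime_gt_0(1) divide_eq_0_iff less_irrefl pnorm_eq_0 zero_neq_one)

section \<open>Balls: nesting, counting, compactness, Borel sets\<close>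

lemma padic_ball_eq:
  "padic_ball k a = {x :: 'p::prime_card padic. pnorm (x - a) \<le> real CARD('p) powi (- k)}"
proof (intro set_eqI iffI)
  fix x assume "x \<in> padic_ball k a"
  then obtain z where z: "pnorm z \<le> 1" "x = of_nat CARD('p) powi k * z + a"
    by (auto simp: padic_ball_def Zp_def)
  then show "x \<in> {x. pnorm (x - a) \<le> real CARD('p) powi (- k)}"
    by (simp add: pnorm_mult pnorm_prime_power_int mult_left_le)
next
  fix x assume x: "x \<in> {x. pnorm (x - a) \<le> real CARD('p) powi (- k)}"
  define z where "z = of_nat CARD('p) powi (- k) * (x - a)"
  have "pnorm z \<le> real CARD('p) powi k * real CARD('p) powi (- k)"
    using x unfolding z_def pnorm_mult pnorm_prime_power_int by (intro mult_mono) auto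
  then have "pnorm z \<le> 1" by (simp add: power_int_minus)
  moreover have "x = of_nat CARD('p) powi k * z + a"
    by (simp add: z_def power_int_minus flip: mult.assoc)
  ultimately show "x \<in> padic_ball k a" by (auto simp: padic_ball_def Zp_def)
qed

lemma mem_padic_ball:
  "x \<in> padic_ball k a \<longleftrightarrow> pnorm (x - a :: 'p::prime_card padic) \<le> real CARD('p) powi (- k)"
  by (simp add: padic_ball_eq)

lemma padic_ball_self [simp]: "a \<in> padic_ball k a"
  by (simp add: mem_padic_ball)

lemma padic_ball_commute: "x \<in> padic_ball k y \<longleftrightarrow> y \<in> padic_ball k x"
  by (simp add: mem_padic_ball pnorm_minus_commute)

lemma padic_ball_trans: "x \<in> padic_ball k y \<Longrightarrow> y \<in> padic_ball k z \<Longrightarrow> x \<in> padic_ball k z"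
  using pnorm_add_max[of "x - y" "y - z"] by (simp add: mem_padic_ball)

lemma padic_ball_eqI: "x \<in> padic_ball k y \<Longrightarrow> padic_ball k x = padic_ball k y"
  by (meson padic_ball_commute padic_ball_trans subsetI subset_antisym)

lemma padic_ball_eq_iff: "padic_ball k x = padic_ball k y \<longleftrightarrow> x \<in> padic_ball k y"
  using padic_ball_eqI padic_ball_self by blast

lemma padic_ball_mono: "j \<le> k \<Longrightarrow> padic_ball k (a :: 'p::prime_card padic) \<subseteq> padic_ball j a"
  by (auto simp: mem_padic_ball elim!: order_trans)

lemma padic_ball_disjoint: "x \<notin> padic_ball k y \<Longrightarrow> padic_ball k x \<inter> padic_ball k y = {}"
  by (metis disjoint_iff padic_ball_commute padic_ball_trans)

lemma padic_ball_subset_iff: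
  "j \<le> k \<Longrightarrow> padic_ball k x \<subseteq> padic_ball j y \<longleftrightarrow> (x :: 'p::prime_card padic) \<in> padic_ball j y"
  using padic_ball_mono[of j k x] padic_ball_eqI[of x j y] padic_ball_self[of x k] by blast

lemma CARD_powi_tendsto_0: "(\<lambda>n. real CARD('p::prime_card) powi (- int n)) \<longlonglongrightarrow> 0"
proof -
  have "(\<lambda>n. inverse (real CARD('p)) ^ n) \<longlonglongrightarrow> 0"
    by (intro LIMSEQ_power_zero) (simp add: inverse_less_1_iff)
  then show ?thesis by (simp add: power_int_minus power_inverse)
qed

lemma CARD_powi_less:
  assumes "e > 0" obtains n where "real CARD('p::prime_card) powi (- int n) < e"
  using order_tendstoD(2)[OF CARD_powi_tendsto_0 assms] by (auto simp: eventually_sequentially)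

lemma CARD_powi_greater:
  obtains n where "c < real CARD('p::prime_card) powi (int n)"
proof -
  obtain n where "c < real CARD('p) ^ n" using real_arch_pow[OF CARD_prime_gt_1] by blast
  then show ?thesis using that by simp
qed

lemma padic_ball_small:
  assumes "e > 0" obtains n where "\<And>a :: 'p::prime_card padic. padic_ball (int n) a \<subseteq> ball a e"
proof -
  obtain n where "real CARD('p) powi (- int n) < e" using CARD_powi_less[OF assms] by blast
  then have "\<And>a :: 'p padic. padic_ball (int n) a \<subseteq> ball a e"
    by (auto simp: mem_padic_ball dist_padic_def pnorm_minus_commute)
  then show ?thesis by (rule that)
qed

lemma open_padic_ball [simp]: "open (padic_ball k (a :: 'p::prime_card padic))"
  unfolding open_dist
proof
  fix x assume x: "x \<in> padic_ball k a"
  have "y \<in> padic_ball k a" if "dist y x < real CARD('p) powi (- k)" for y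
    using that x by (auto simp: dist_padic_def intro: padic_ball_trans[of y k x] simp: mem_padic_ball[of y k x])
  then show "\<exists>e>0. \<forall>y. dist y x < e \<longrightarrow> y \<in> padic_ball k a"
    by (intro exI[of _ "real CARD('p) powi (- k)"]) auto
qed

lemma closed_padic_ball [simp]: "closed (padic_ball k (a :: 'p::prime_card padic))"
proof -
  have "- padic_ball k a = (\<Union>x\<in>- padic_ball k a. padic_ball k x)"
  proof (intro set_eqI iffI)
    fix y assume "y \<in> (\<Union>x\<in>- padic_ball k a. padic_ball k x)"
    then obtain x where "x \<notin> padic_ball k a" "y \<in> padic_ball k x" by blast
    then show "y \<in> - padic_ball k a" using padic_ball_disjoint by blast
  qed (use padic_ball_self in blast)
  moreover have "open (\<Union>x\<in>- padic_ball k a. padic_ball k x)" by (intro open_UN) auto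
  ultimately show ?thesis by (simp add: closed_def)
qed

text \<open>Writing x = p^j z + a with z integral, the residue of z modulo p^(k-j) names the subball
  of level k that contains x.\<close>

lemma padic_ball_decompose:
  fixes a :: "'p::prime_card padic"
  assumes "j \<le> k"
  shows "padic_ball j a = (\<Union>n<CARD('p) ^ nat (k - j). padic_ball k (a + of_nat CARD('p) powi j * of_nat n))"
    (is "_ = ?U")
proof
  show "padic_ball j a \<subseteq> ?U"
  proof
    fix x assume x: "x \<in> padic_ball j a"
    then obtain z where z: "pnorm z \<le> 1" "x = of_nat CARD('p) powi j * z + a"
      by (auto simp: padic_ball_def Zp_def)
    obtain n where n: "n < CARD('p) ^ nat (k - j)"
      "pnorm (z - of_nat n) \<le> real CARD('p) powi (- int (nat (k - j)))"
      using padic_residue[OF z(1)] by blast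
    have "x - (a + of_nat CARD('p) powi j * of_nat n) = of_nat CARD('p) powi j * (z - of_nat n)"
      by (simp add: z algebra_simps)
    then have "pnorm (x - (a + of_nat CARD('p) powi j * of_nat n)) = real CARD('p) powi (- j) * pnorm (z - of_nat n)"
      by (simp add: pnorm_mult pnorm_prime_power_int)
    also have "\<dots> \<le> real CARD('p) powi (- j) * real CARD('p) powi (- (k - j))"
      using n(2) assms by (intro mult_left_mono) auto
    also have "\<dots> = real CARD('p) powi (- k)" by (simp flip: power_int_add)
    finally show "x \<in> ?U" using n(1) by (auto simp: mem_padic_ball)
  qed
  show "?U \<subseteq> padic_ball j a"
  proof
    fix x assume "x \<in> ?U"
    then obtain n where "x \<in> padic_ball k (a + of_nat CARD('p) powi j * of_nat n)" by blast
    then have "x \<in> padic_ball j (a + of_nat CARD('p) powi j * of_nat n)"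
      using padic_ball_mono[OF assms] by blast
    moreover have "a + of_nat CARD('p) powi j * of_nat n \<in> padic_ball j a"
      using pabs_of_int_le_1[OF prime_card[where 'a='p], of "int n"]
      by (auto simp: mem_padic_ball pnorm_mult pnorm_prime_power_int pnorm_of_nat mult_left_le)
    ultimately show "x \<in> padic_ball j a" by (rule padic_ball_trans)
  qed
qed

text \<open>Centres in a common ball of level k would have indices congruent modulo p^(k-j), while
  all indices are below p^(k-j). Together with the covering this makes the number of subballs exact,
  which fixes the measure of every ball.\<close>

lemma padic_ball_subball_inj:
  assumes "j \<le> k"
  shows "disjoint_family_on (\<lambda>n. padic_ball k (a + of_nat CARD('p) powi j * of_nat n :: 'p::prime_card padic))
    {..<CARD('p) ^ nat (k - j)}"
  unfolding disjoint_family_on_def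
proof (intro ballI impI)
  fix n n' assume n: "n \<in> {..<CARD('p) ^ nat (k - j)}" "n' \<in> {..<CARD('p) ^ nat (k - j)}" "n \<noteq> n'"
  have "a + of_nat CARD('p) powi j * of_nat n \<notin> padic_ball k (a + of_nat CARD('p) powi j * of_nat n')"
  proof
    assume "a + of_nat CARD('p) powi j * of_nat n \<in> padic_ball k (a + of_nat CARD('p) powi j * of_nat n')"
    moreover have "a + of_nat CARD('p) powi j * of_nat n - (a + of_nat CARD('p) powi j * of_nat n')
        = of_nat CARD('p) powi j * of_int (int n - int n')"
      by (simp add: right_diff_distrib)
    ultimately have "real CARD('p) powi (- j) * pnorm (of_int (int n - int n') :: 'p padic) \<le> real CARD('p) powi (- k)"
      by (simp only: mem_padic_ball pnorm_mult pnorm_prime_power_int)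
    then have "real CARD('p) powi j * (real CARD('p) powi (- j) * pnorm (of_int (int n - int n') :: 'p padic)) \<le> real CARD('p) powi j * real CARD('p) powi (- k)"
      by (intro mult_left_mono) (auto intro: less_imp_le)
    moreover have "real CARD('p) powi j * (real CARD('p) powi (- j) * c) = c" for c
      by (simp add: power_int_minus flip: mult.assoc)
    moreover have "real CARD('p) powi j * real CARD('p) powi (- k) = real CARD('p) powi (- int (nat (k - j)))"
      using assms by (simp flip: power_int_add)
    ultimately have "int CARD('p) ^ nat (k - j) dvd int n - int n'"
      by (metis pnorm_of_int pabs_of_int_le_iff[OF prime_card])
    then have "int (CARD('p) ^ nat (k - j)) dvd int n - int n'" by simp
    then have "int n mod int (CARD('p) ^ nat (k - j)) = int n' mod int (CARD('p) ^ nat (k - j))"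
      by (simp only: mod_eq_dvd_iff)
    then show False using n by (simp del: of_nat_power flip: of_nat_mod)
  qed
  then show "padic_ball k (a + of_nat CARD('p) powi j * of_nat n) \<inter> padic_ball k (a + of_nat CARD('p) powi j * of_nat n') = {}"
    by (rule padic_ball_disjoint)
qed

lemma compact_padic_ball [simp]: "compact (padic_ball k (a :: 'p::prime_card padic))"
  unfolding compact_eq_totally_bounded
proof (intro conjI allI impI)
  show "complete (padic_ball k a)" by (simp add: complete_eq_closed)
  fix e :: real assume "e > 0"
  then obtain n where n: "\<And>a :: 'p padic. padic_ball (int n) a \<subseteq> ball a e"
    by (rule padic_ball_small) blast
  \<comment> \<open>The maximum with k keeps l at or below the scale of the given ball, as the
    decomposition into subballs requires, even when e is large.\<close>
  define l where "l = max k (int n)"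
  define f where "f i = a + of_nat CARD('p) powi k * of_nat i" for i
  have "padic_ball k a = (\<Union>i<CARD('p) ^ nat (l - k). padic_ball l (f i))"
    unfolding f_def by (rule padic_ball_decompose) (simp add: l_def)
  also have "\<dots> \<subseteq> (\<Union>i<CARD('p) ^ nat (l - k). ball (f i) e)"
  proof (rule UN_mono)
    fix i assume "i \<in> {..<CARD('p) ^ nat (l - k)}"
    show "padic_ball l (f i) \<subseteq> ball (f i) e"
      using n[of "f i"] padic_ball_mono[of "int n" l "f i"] by (auto simp: l_def)
  qed auto
  finally show "\<exists>K. finite K \<and> padic_ball k a \<subseteq> (\<Union>x\<in>K. ball x e)"
    by (intro exI[of _ "f ` {..<CARD('p) ^ nat (l - k)}"]) (simp add: image_image)
qed

text \<open>Rational centres and integer levels leave only countably many balls; the generation of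
  the Borel sets and the enumeration of cosets by natural numbers both depend on this.\<close>

lemma padic_ball_rational:
  obtains r where "padic_ball k a = padic_ball k (padic_of_rat r :: 'p::prime_card padic)"
proof -
  have "0 < real CARD('p) powi (- k)" by simp
  then obtain r where "pnorm (a - padic_of_rat r) < real CARD('p) powi (- k)" by (rule padic_rat_dense)
  then have "a \<in> padic_ball k (padic_of_rat r)" by (simp add: mem_padic_ball)
  then show ?thesis using that padic_ball_eqI by blast
qed

lemma countable_padic_balls: "countable (padic_balls :: 'p::prime_card padic set set)"
proof (rule countable_subset)
  show "padic_balls \<subseteq> (\<lambda>(k, r). padic_ball k (padic_of_rat r :: 'p padic)) ` UNIV"
  proof
    fix B :: "'p padic set" assume "B \<in> padic_balls"
    then obtain k a where "B = padic_ball k a" by (auto simp: padic_balls_def)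
    moreover obtain r where "padic_ball k a = padic_ball k (padic_of_rat r)" by (rule padic_ball_rational)
    ultimately have "B = (\<lambda>(k, r). padic_ball k (padic_of_rat r)) (k, r)" by simp
    then show "B \<in> (\<lambda>(k, r). padic_ball k (padic_of_rat r :: 'p padic)) ` UNIV" by blast
  qed
qed auto

lemma padic_ballsI [simp]: "padic_ball k a \<in> padic_balls"
  by (auto simp: padic_balls_def)

text \<open>An open set is the union of the countably many balls inside it. The induction over Borel
  sets in the density proof can thus start from balls.\<close>

lemma borel_padic: "sets (borel :: 'p::prime_card padic measure) = sigma_sets UNIV padic_balls"
proof -
  have "sigma_sets UNIV {S :: 'p padic set. open S} = sigma_sets UNIV padic_balls"
  proof (rule sigma_sets_eqI)
    fix S :: "'p padic set" assume "S \<in> {S. open S}"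
    then have S: "open S" by simp
    have "S = \<Union>{B \<in> padic_balls. B \<subseteq> S}"
    proof (intro set_eqI iffI)
      fix x assume "x \<in> S"
      then obtain e where e: "e > 0" "ball x e \<subseteq> S" using S unfolding open_contains_ball by blast
      obtain n where "\<And>a :: 'p padic. padic_ball (int n) a \<subseteq> ball a e"
        using e(1) by (rule padic_ball_small) blast
      then have "padic_ball (int n) x \<subseteq> S" using e(2) by blast
      then show "x \<in> \<Union>{B \<in> padic_balls. B \<subseteq> S}"
        by (intro UnionI[of "padic_ball (int n) x"]) auto
    qed auto
    moreover have "\<Union>{B \<in> padic_balls. B \<subseteq> S} \<in> sigma_sets UNIV padic_balls"
      by (rule sigma_sets_UNION) (auto intro: countable_subset[OF _ countable_padic_balls])
    ultimately show "S \<in> sigma_sets UNIV padic_balls" by simp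
  next
    fix B :: "'p padic set" assume "B \<in> padic_balls"
    then show "B \<in> sigma_sets UNIV {S. open S}" by (auto simp: padic_balls_def)
  qed
  then show ?thesis by (simp add: borel_def)
qed

lemma padic_ball_borel [measurable]: "padic_ball k (a :: 'p::prime_card padic) \<in> sets borel"
  by (simp add: borel_closed)

lemma diameter_padic_ball: "diameter (padic_ball k (a :: 'p::prime_card padic)) = real CARD('p) powi (- k)"
proof (rule antisym)
  have le: "dist x y \<le> real CARD('p) powi (- k)" if "x \<in> padic_ball k a" "y \<in> padic_ball k a" for x y :: "'p padic"
    using that padic_ball_trans padic_ball_commute unfolding dist_padic_def by (metis mem_padic_ball)
  have "a \<in> padic_ball k a" by simp
  then show "diameter (padic_ball k a) \<le> real CARD('p) powi (- k)"
    unfolding diameter_def using le by (auto intro!: cSUP_least)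
  have "of_nat CARD('p) powi k + a \<in> padic_ball k a"
    by (simp add: mem_padic_ball pnorm_prime_power_int)
  moreover have "bounded (padic_ball k a)" by (simp add: compact_imp_bounded)
  ultimately have "dist (of_nat CARD('p) powi k + a) a \<le> diameter (padic_ball k a)"
    by (intro diameter_bounded_bound) auto
  then show "real CARD('p) powi (- k) \<le> diameter (padic_ball k a)"
    by (simp add: dist_padic_def pnorm_prime_power_int)
qed

text \<open>The diameter recovers the level. A ball through a fixed point is therefore the same
  thing as an integer, which turns sums over balls into sums over levels.\<close>

lemma padic_ball_level_inj:
  assumes "padic_ball j a = padic_ball k (b :: 'p::prime_card padic)" shows "j = k"
proof -
  have "real CARD('p) powi (- j) = real CARD('p) powi (- k)"
    by (metis assms diameter_padic_ball)
  then show ?thesis by simp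
qed

lemma padic_balls_containing:
  "{B \<in> padic_balls. x \<in> B} = (\<lambda>k. padic_ball k (x :: 'p::prime_card padic)) ` UNIV"
proof (intro set_eqI iffI)
  fix B assume "B \<in> {B \<in> padic_balls. x \<in> B}"
  then obtain k a where "B = padic_ball k a" "x \<in> padic_ball k a" by (auto simp: padic_balls_def)
  then have "B = padic_ball k x" by (simp add: padic_ball_eqI)
  then show "B \<in> (\<lambda>k. padic_ball k x) ` UNIV" by blast
qed auto

lemma padic_balls_above:
  "{T \<in> padic_balls. padic_ball k a \<subseteq> T} = (\<lambda>j. padic_ball j (a :: 'p::prime_card padic)) ` {..k}"
proof (intro set_eqI iffI)
  fix T assume "T \<in> {T \<in> padic_balls. padic_ball k a \<subseteq> T}"
  then obtain j b where T: "T = padic_ball j b" "padic_ball k a \<subseteq> T" by (auto simp: padic_balls_def)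
  then have "a \<in> padic_ball j b" using padic_ball_self[of a k] by blast
  then have Ta: "T = padic_ball j a" using T padic_ball_eqI by blast
  have "diameter (padic_ball k a) \<le> diameter T"
    using T by (intro diameter_subset) (auto simp: compact_imp_bounded)
  then have "j \<le> k" by (simp add: Ta diameter_padic_ball)
  then show "T \<in> (\<lambda>j. padic_ball j a) ` {..k}" using Ta by auto
next
  fix T assume "T \<in> (\<lambda>j. padic_ball j a) ` {..k}"
  then show "T \<in> {T \<in> padic_balls. padic_ball k a \<subseteq> T}" using padic_ball_mono by auto
qed

section \<open>The space $L^2$\<close>

lemma borel_measurable_cnj [measurable (raw)]:
  "f \<in> borel_measurable M \<Longrightarrow> (\<lambda>x. cnj (f x)) \<in> borel_measurable M"
  by (rule borel_measurable_continuous_on[where f = cnj]) (auto intro!: continuous_intros)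

lemma L2_measurable [measurable_dest]: "f \<in> L2 M \<Longrightarrow> f \<in> borel_measurable M"
  by (simp add: L2_def)

lemma L2_integrable: "f \<in> L2 M \<Longrightarrow> integrable M (\<lambda>x. (cmod (f x))\<^sup>2)"
  by (simp add: L2_def)

lemma L2_integrable_cmod_mult:
  assumes f: "f \<in> L2 M" and g: "g \<in> L2 M"
  shows "integrable M (\<lambda>x. cmod (f x) * cmod (g x))"
proof (rule Bochner_Integration.integrable_bound)
  show "integrable M (\<lambda>x. (cmod (f x))\<^sup>2 + (cmod (g x))\<^sup>2)"
    using f g by (simp add: L2_integrable)
  show "(\<lambda>x. cmod (f x) * cmod (g x)) \<in> borel_measurable M"
    using f g by measurable
  have "a * b \<le> a\<^sup>2 + b\<^sup>2" if "0 \<le> a" "0 \<le> b" for a b :: real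
    using sum_squares_bound[of a b] mult_nonneg_nonneg[OF that] by linarith
  then show "AE x in M. norm (cmod (f x) * cmod (g x)) \<le> norm ((cmod (f x))\<^sup>2 + (cmod (g x))\<^sup>2)"
    by (simp add: abs_mult)
qed

lemma L2_cnj: "f \<in> L2 M \<Longrightarrow> (\<lambda>x. cnj (f x)) \<in> L2 M"
  by (auto simp: L2_def)

lemma L2_integrable_mult:
  assumes f: "f \<in> L2 M" and g: "g \<in> L2 M"
  shows "integrable M (\<lambda>x. f x * g x)"
  by (rule Bochner_Integration.integrable_bound[OF L2_integrable_cmod_mult[OF f g]])
    (use f g in \<open>measurable, auto simp: norm_mult\<close>)

lemma L2_integrable_inner:
  "f \<in> L2 M \<Longrightarrow> g \<in> L2 M \<Longrightarrow> integrable M (\<lambda>x. f x * cnj (g x))"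
  using L2_integrable_mult L2_cnj by blast

lemma L2_add:
  assumes f: "f \<in> L2 M" and g: "g \<in> L2 M"
  shows "(\<lambda>x. f x + g x) \<in> L2 M"
proof -
  have "integrable M (\<lambda>x. (cmod (f x))\<^sup>2 + 2 * (cmod (f x) * cmod (g x)) + (cmod (g x))\<^sup>2)"
    using f g by (simp add: L2_integrable L2_integrable_cmod_mult)
  then have "integrable M (\<lambda>x. (cmod (f x + g x))\<^sup>2)"
  proof (rule Bochner_Integration.integrable_bound)
    show "(\<lambda>x. (cmod (f x + g x))\<^sup>2) \<in> borel_measurable M" using f g by measurable
    have "(cmod (f x + g x))\<^sup>2 \<le> (cmod (f x) + cmod (g x))\<^sup>2" for x
      by (intro power_mono norm_triangle_ineq) auto
    then show "AE x in M. norm ((cmod (f x + g x))\<^sup>2)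
        \<le> norm ((cmod (f x))\<^sup>2 + 2 * (cmod (f x) * cmod (g x)) + (cmod (g x))\<^sup>2)"
      by (simp add: power2_sum algebra_simps)
  qed
  then show ?thesis using f g by (auto simp: L2_def)
qed

lemma L2_scale: "f \<in> L2 M \<Longrightarrow> (\<lambda>x. c * f x) \<in> L2 M"
  by (auto simp: L2_def norm_mult power_mult_distrib)

lemma L2_0 [simp]: "(\<lambda>x. 0) \<in> L2 M"
  by (simp add: L2_def)

lemma L2_diff: "f \<in> L2 M \<Longrightarrow> g \<in> L2 M \<Longrightarrow> (\<lambda>x. f x - g x) \<in> L2 M"
  using L2_add[of f M "\<lambda>x. (- 1) * g x"] L2_scale[of g M "- 1"] by simp

lemma L2_sum: "(\<And>i. i \<in> I \<Longrightarrow> f i \<in> L2 M) \<Longrightarrow> (\<lambda>x. \<Sum>i\<in>I. f i x) \<in> L2 M"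
  by (induction I rule: infinite_finite_induct) (auto intro: L2_add)

lemma l2_norm_nonneg [simp]: "0 \<le> l2_norm M f"
  by (simp add: l2_norm_def)

lemma l2_norm_square: "(l2_norm M f)\<^sup>2 = (LINT x|M. (cmod (f x))\<^sup>2)"
  by (simp add: l2_norm_def)

lemma l2_inner_self: "l2_inner M f f = of_real ((l2_norm M f)\<^sup>2)"
  unfolding l2_inner_def l2_norm_square complex_norm_square[symmetric] by (rule integral_complex_of_real)

lemma l2_norm_AE_cong:
  assumes "f \<in> borel_measurable M" "g \<in> borel_measurable M" "AE x in M. f x = g x"
  shows "l2_norm M f = l2_norm M g"
proof -
  have "(LINT x|M. (cmod (f x))\<^sup>2) = (LINT x|M. (cmod (g x))\<^sup>2)"
    by (rule integral_cong_AE) (use assms in auto)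
  then show ?thesis by (simp add: l2_norm_def)
qed

lemma l2_norm_eq_0:
  assumes "f \<in> L2 M" shows "l2_norm M f = 0 \<longleftrightarrow> (AE x in M. f x = 0)"
  using integral_nonneg_eq_0_iff_AE[OF L2_integrable[OF assms]] by (simp add: l2_norm_def)

lemma l2_norm_scale: "l2_norm M (\<lambda>x. c * f x) = cmod c * l2_norm M f"
  by (simp add: l2_norm_def norm_mult power_mult_distrib real_sqrt_mult)

lemma l2_norm_minus_commute: "l2_norm M (\<lambda>x. f x - g x) = l2_norm M (\<lambda>x. g x - f x)"
  by (simp add: l2_norm_def norm_minus_commute)

text \<open>The inequality for extended nonnegative integrals is transferred to moduli; all three
  integrals are finite, so they can be compared as reals.\<close>

lemma l2_Cauchy_Schwarz_cmod:
  assumes f: "f \<in> L2 M" and g: "g \<in> L2 M"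
  shows "(LINT x|M. cmod (f x) * cmod (g x)) \<le> l2_norm M f * l2_norm M g"
proof -
  define S where "S = (LINT x|M. cmod (f x) * cmod (g x))"
  have S0: "S \<ge> 0" unfolding S_def by (simp add: integral_nonneg_AE)
  have "(\<integral>\<^sup>+x. ennreal (cmod (f x)) * ennreal (cmod (g x)) \<partial>M)\<^sup>2
      \<le> (\<integral>\<^sup>+x. (ennreal (cmod (f x)))\<^sup>2 \<partial>M) * (\<integral>\<^sup>+x. (ennreal (cmod (g x)))\<^sup>2 \<partial>M)"
    using L2_measurable[OF f] L2_measurable[OF g] by (intro Cauchy_Schwarz_nn_integral) auto
  also have "(\<integral>\<^sup>+x. ennreal (cmod (f x)) * ennreal (cmod (g x)) \<partial>M) = ennreal S"
    unfolding S_def using L2_integrable_cmod_mult[OF f g]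
    by (simp flip: ennreal_mult add: nn_integral_eq_integral)
  also have "(\<integral>\<^sup>+x. (ennreal (cmod (f x)))\<^sup>2 \<partial>M) = ennreal ((l2_norm M f)\<^sup>2)"
    using L2_integrable[OF f] by (simp add: ennreal_power nn_integral_eq_integral l2_norm_square)
  also have "(\<integral>\<^sup>+x. (ennreal (cmod (g x)))\<^sup>2 \<partial>M) = ennreal ((l2_norm M g)\<^sup>2)"
    using L2_integrable[OF g] by (simp add: ennreal_power nn_integral_eq_integral l2_norm_square)
  finally have "S\<^sup>2 \<le> (l2_norm M f * l2_norm M g)\<^sup>2"
    using S0 by (simp add: ennreal_power power_mult_distrib flip: ennreal_mult)
  then show ?thesis unfolding S_def by (rule power2_le_imp_le) simp
qed

lemma l2_Cauchy_Schwarz: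
  assumes f: "f \<in> L2 M" and g: "g \<in> L2 M"
  shows "cmod (l2_inner M f g) \<le> l2_norm M f * l2_norm M g"
proof -
  have "cmod (l2_inner M f g) \<le> (LINT x|M. cmod (f x * cnj (g x)))"
    unfolding l2_inner_def by (rule integral_norm_bound)
  then show ?thesis using l2_Cauchy_Schwarz_cmod[OF f g] by (simp add: norm_mult)
qed

lemma l2_norm_triangle:
  assumes f: "f \<in> L2 M" and g: "g \<in> L2 M"
  shows "l2_norm M (\<lambda>x. f x + g x) \<le> l2_norm M f + l2_norm M g"
proof (rule power2_le_imp_le)
  have "(l2_norm M (\<lambda>x. f x + g x))\<^sup>2 \<le> (LINT x|M. (cmod (f x))\<^sup>2 + 2 * (cmod (f x) * cmod (g x)) + (cmod (g x))\<^sup>2)"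
    unfolding l2_norm_square
  proof (rule integral_mono)
    show "integrable M (\<lambda>x. (cmod (f x + g x))\<^sup>2)" using L2_add[OF f g] by (rule L2_integrable)
    show "integrable M (\<lambda>x. (cmod (f x))\<^sup>2 + 2 * (cmod (f x) * cmod (g x)) + (cmod (g x))\<^sup>2)"
      using f g by (simp add: L2_integrable L2_integrable_cmod_mult)
    fix x
    have "(cmod (f x + g x))\<^sup>2 \<le> (cmod (f x) + cmod (g x))\<^sup>2"
      by (intro power_mono norm_triangle_ineq) auto
    then show "(cmod (f x + g x))\<^sup>2 \<le> (cmod (f x))\<^sup>2 + 2 * (cmod (f x) * cmod (g x)) + (cmod (g x))\<^sup>2"
      by (simp add: power2_sum algebra_simps)
  qed
  also have "\<dots> = (l2_norm M f)\<^sup>2 + 2 * (LINT x|M. cmod (f x) * cmod (g x)) + (l2_norm M g)\<^sup>2"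
    using f g by (simp add: L2_integrable L2_integrable_cmod_mult l2_norm_square)
  also have "\<dots> \<le> (l2_norm M f + l2_norm M g)\<^sup>2"
    using l2_Cauchy_Schwarz_cmod[OF f g] by (simp add: power2_sum)
  finally show "(l2_norm M (\<lambda>x. f x + g x))\<^sup>2 \<le> (l2_norm M f + l2_norm M g)\<^sup>2" .
qed simp

lemma l2_norm_triangle_diff:
  assumes "f \<in> L2 M" "g \<in> L2 M" "h \<in> L2 M"
  shows "l2_norm M (\<lambda>x. f x - h x) \<le> l2_norm M (\<lambda>x. f x - g x) + l2_norm M (\<lambda>x. g x - h x)"
  using l2_norm_triangle[OF L2_diff[OF assms(1,2)] L2_diff[OF assms(2,3)]] by simp

lemma l2_norm_sum_le:
  "(\<And>i. i \<in> I \<Longrightarrow> f i \<in> L2 M) \<Longrightarrow> l2_norm M (\<lambda>x. \<Sum>i\<in>I. f i x) \<le> (\<Sum>i\<in>I. l2_norm M (f i))"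
proof (induction I rule: infinite_finite_induct)
  case (insert i I)
  have "l2_norm M (\<lambda>x. f i x + (\<Sum>i\<in>I. f i x)) \<le> l2_norm M (f i) + l2_norm M (\<lambda>x. \<Sum>i\<in>I. f i x)"
    using insert by (intro l2_norm_triangle L2_sum) auto
  then show ?case using insert by simp
qed (simp_all add: l2_norm_def)

lemma l2_inner_commute: "l2_inner M g f = cnj (l2_inner M f g)"
  unfolding l2_inner_def Bochner_Integration.integral_cnj[symmetric] by (simp add: mult.commute)

lemma l2_inner_add_left:
  "f \<in> L2 M \<Longrightarrow> g \<in> L2 M \<Longrightarrow> h \<in> L2 M \<Longrightarrow>
    l2_inner M (\<lambda>x. f x + g x) h = l2_inner M f h + l2_inner M g h"
  unfolding l2_inner_def by (simp add: distrib_right L2_integrable_inner)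

lemma l2_inner_diff_left:
  "f \<in> L2 M \<Longrightarrow> g \<in> L2 M \<Longrightarrow> h \<in> L2 M \<Longrightarrow>
    l2_inner M (\<lambda>x. f x - g x) h = l2_inner M f h - l2_inner M g h"
  unfolding l2_inner_def by (simp add: left_diff_distrib L2_integrable_inner)

lemma l2_inner_scale_left: "l2_inner M (\<lambda>x. c * f x) h = c * l2_inner M f h"
  unfolding l2_inner_def by (simp add: mult.assoc)

lemma l2_inner_diff_right:
  "f \<in> L2 M \<Longrightarrow> g \<in> L2 M \<Longrightarrow> h \<in> L2 M \<Longrightarrow>
    l2_inner M f (\<lambda>x. g x - h x) = l2_inner M f g - l2_inner M f h"
  unfolding l2_inner_def by (simp add: right_diff_distrib L2_integrable_inner)

lemma l2_inner_AE_cong: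
  assumes "f \<in> L2 M" "f' \<in> L2 M" "h \<in> L2 M" "AE x in M. f x = f' x"
  shows "l2_inner M f h = l2_inner M f' h"
  unfolding l2_inner_def
  by (rule integral_cong_AE) (use assms L2_measurable in \<open>auto intro!: borel_measurable_times borel_measurable_cnj\<close>)

lemma l2_inner_tendsto:
  assumes F: "\<And>n. F n \<in> L2 M" "f \<in> L2 M" "(\<lambda>n. l2_norm M (\<lambda>x. f x - F n x)) \<longlonglongrightarrow> 0" and h: "h \<in> L2 M"
  shows "(\<lambda>n. l2_inner M (F n) h) \<longlonglongrightarrow> l2_inner M f h"
proof (rule LIM_zero_cancel, rule Lim_null_comparison)
  show "(\<lambda>n. l2_norm M (\<lambda>x. f x - F n x) * l2_norm M h) \<longlonglongrightarrow> 0"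
    using F(3) by (rule tendsto_mult_left_zero)
  have "cmod (l2_inner M (F n) h - l2_inner M f h) \<le> l2_norm M (\<lambda>x. f x - F n x) * l2_norm M h" for n
    using l2_Cauchy_Schwarz[OF L2_diff[OF F(1)[of n] F(2)] h] F h
    by (simp add: l2_inner_diff_left l2_norm_minus_commute)
  then show "\<forall>\<^sub>F n in sequentially. norm (l2_inner M (F n) h - l2_inner M f h) \<le> l2_norm M (\<lambda>x. f x - F n x) * l2_norm M h"
    by simp
qed

section \<open>Closures and absolutely convergent series in L^2\<close>

lemma l2_closure_subset: "S \<subseteq> L2 M \<Longrightarrow> S \<subseteq> l2_closure M S"
  unfolding l2_closure_def by (force simp: l2_norm_def)

lemma l2_closure_idem:
  assumes S: "S \<subseteq> L2 M" and f: "f \<in> L2 M"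
    and appr: "\<And>e. e > 0 \<Longrightarrow> \<exists>g\<in>l2_closure M S. l2_norm M (\<lambda>x. f x - g x) < e"
  shows "f \<in> l2_closure M S"
proof -
  have "\<exists>h\<in>S. l2_norm M (\<lambda>x. f x - h x) < e" if e: "e > 0" for e
  proof -
    obtain g where g: "g \<in> L2 M" "g \<in> l2_closure M S" "l2_norm M (\<lambda>x. f x - g x) < e / 2"
      using appr[of "e / 2"] e by (auto simp: l2_closure_def)
    then obtain h where h: "h \<in> S" "l2_norm M (\<lambda>x. g x - h x) < e / 2"
      using half_gt_zero[OF e] unfolding l2_closure_def by blast
    have "h \<in> L2 M" using h(1) S by blast
    then have "l2_norm M (\<lambda>x. f x - h x) < e"
      using l2_norm_triangle_diff[OF f g(1), of h] g(3) h(2) by simp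
    then show ?thesis using h(1) by blast
  qed
  then show ?thesis using f by (simp add: l2_closure_def)
qed

text \<open>The Riesz-Fischer argument for absolutely convergent series. The limit is taken as the
  pointwise sum because the fractional derivative will be given pointwise by such a series; on the
  null set where the moduli are not summable, \<open>suminf\<close> may return a default
  value.\<close>

lemma L2_suminf:
  fixes f :: "nat \<Rightarrow> 'a \<Rightarrow> complex"
  assumes f: "\<And>n. f n \<in> L2 M" and sm: "summable (\<lambda>n. l2_norm M (f n))"
  defines "F \<equiv> \<lambda>x. \<Sum>n. f n x"
  shows "F \<in> L2 M" and "(\<lambda>n. l2_norm M (\<lambda>x. F x - (\<Sum>i<n. f i x))) \<longlonglongrightarrow> 0"
proof -
  have [measurable]: "f n \<in> borel_measurable M" for n using f by (rule L2_measurable)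
  define S where "S = (\<Sum>n. l2_norm M (f n))"
  define G where "G n x = (\<Sum>i<n. cmod (f i x))" for n x
  define g where "g x = (\<Sum>i. cmod (f i x))" for x
  have G0: "0 \<le> G n x" for n x by (simp add: G_def sum_nonneg)
  have [measurable]: "G n \<in> borel_measurable M" for n unfolding G_def by measurable
  have [measurable]: "g \<in> borel_measurable M" unfolding g_def by measurable
  have [measurable]: "F \<in> borel_measurable M" unfolding F_def by measurable
  have incG: "incseq (\<lambda>n. G n x)" for x
    unfolding G_def by (intro incseq_SucI) simp
  have cf: "(\<lambda>x. complex_of_real (cmod (f n x))) \<in> L2 M" for n
    using f[of n] by (simp add: L2_def)
  have ncf: "l2_norm M (\<lambda>x. complex_of_real (cmod (f n x))) = l2_norm M (f n)" for n
    by (simp add: l2_norm_def)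
  have GL: "(\<lambda>x. complex_of_real (G n x)) \<in> L2 M" for n
    using L2_sum[of "{..<n}", OF cf] by (simp add: G_def)
  have "l2_norm M (\<lambda>x. complex_of_real (G n x)) \<le> (\<Sum>i<n. l2_norm M (f i))" for n
    using l2_norm_sum_le[of "{..<n}", OF cf] by (simp add: G_def ncf)
  also have "(\<Sum>i<n. l2_norm M (f i)) \<le> S" for n
    unfolding S_def by (rule sum_le_suminf[OF sm]) auto
  finally have GS: "l2_norm M (\<lambda>x. complex_of_real (G n x)) \<le> S" for n .
  then have S0: "S \<ge> 0" using l2_norm_nonneg order_trans by blast
  have "(\<integral>\<^sup>+x. ennreal ((G n x)\<^sup>2) \<partial>M) \<le> ennreal (S\<^sup>2)" for n
  proof -
    have "(\<integral>\<^sup>+x. ennreal ((G n x)\<^sup>2) \<partial>M) = ennreal ((l2_norm M (\<lambda>x. complex_of_real (G n x)))\<^sup>2)"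
      unfolding l2_norm_square using L2_integrable[OF GL[of n]]
      by (subst nn_integral_eq_integral) auto
    also have "\<dots> \<le> ennreal (S\<^sup>2)" using GS[of n] by (intro ennreal_leI power_mono) auto
    finally show ?thesis .
  qed
  \<comment> \<open>Monotone convergence carries the uniform bound on the partial sums
    \<open>G n\<close> over to their supremum, which is thus finite almost everywhere.\<close>
  then have "(SUP n. \<integral>\<^sup>+x. ennreal ((G n x)\<^sup>2) \<partial>M) \<le> ennreal (S\<^sup>2)" by (rule SUP_least)
  moreover have "(SUP n. \<integral>\<^sup>+x. ennreal ((G n x)\<^sup>2) \<partial>M) = (\<integral>\<^sup>+x. (SUP n. ennreal ((G n x)\<^sup>2)) \<partial>M)"
    using incG G0
    by (intro nn_integral_monotone_convergence_SUP[symmetric])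
      (auto simp: incseq_def le_fun_def intro!: ennreal_leI power_mono)
  ultimately have bnd: "(\<integral>\<^sup>+x. (SUP n. ennreal ((G n x)\<^sup>2)) \<partial>M) \<le> ennreal (S\<^sup>2)" by simp
  have "AE x in M. (SUP n. ennreal ((G n x)\<^sup>2)) \<noteq> \<infinity>"
    by (rule nn_integral_PInf_AE) (use bnd in \<open>auto simp: top_unique\<close>)
  then have ae: "AE x in M. summable (\<lambda>i. cmod (f i x))"
  proof (eventually_elim)
    case (elim x)
    then obtain c where c: "c \<ge> 0" "(SUP n. ennreal ((G n x)\<^sup>2)) = ennreal c"
      by (cases "SUP n. ennreal ((G n x)\<^sup>2)") auto
    have "(G n x)\<^sup>2 \<le> c" for n
    proof -
      have "ennreal ((G n x)\<^sup>2) \<le> ennreal c" using c(2) by (metis SUP_upper UNIV_I)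
      then show ?thesis using c(1) by simp
    qed
    then have "G n x \<le> sqrt c" for n by (simp add: real_le_rsqrt)
    then show ?case
      by (intro summableI_nonneg_bounded[of _ "sqrt c"]) (auto simp: G_def)
  qed
  have gint: "integrable M (\<lambda>x. (g x)\<^sup>2)"
  proof (rule integrableI_bounded)
    have "AE x in M. ennreal (norm ((g x)\<^sup>2)) = (SUP n. ennreal ((G n x)\<^sup>2))"
      using ae
    proof eventually_elim
      case (elim x)
      then have "(\<lambda>n. G n x) \<longlonglongrightarrow> g x"
        unfolding G_def g_def by (rule summable_LIMSEQ)
      then have "(\<lambda>n. ennreal ((G n x)\<^sup>2)) \<longlonglongrightarrow> ennreal ((g x)\<^sup>2)"
        by (intro tendsto_intros)
      moreover have "incseq (\<lambda>n. ennreal ((G n x)\<^sup>2))"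
        using incG[of x] G0 by (auto simp: incseq_def intro!: ennreal_leI power_mono)
      from LIMSEQ_unique[OF calculation LIMSEQ_SUP[OF this]] show ?case by simp
    qed
    from nn_integral_cong_AE[OF this] bnd
    have "(\<integral>\<^sup>+x. ennreal (norm ((g x)\<^sup>2)) \<partial>M) \<le> ennreal (S\<^sup>2)" by simp
    then show "(\<integral>\<^sup>+x. ennreal (norm ((g x)\<^sup>2)) \<partial>M) < \<infinity>"
      by (simp add: le_less_trans)
  qed measurable
  \<comment> \<open>The majorant g is the same for every n, so its square dominates all squared
    tails; the case n = 0 shows that F is square integrable.\<close>
  have tail: "AE x in M. cmod (F x - (\<Sum>i<n. f i x)) \<le> g x" for n
    using ae
  proof eventually_elim
    case (elim x)
    then have s: "summable (\<lambda>i. f i x)" by (rule summable_norm_cancel)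
    have "cmod (F x - (\<Sum>i<n. f i x)) = cmod (\<Sum>i. f (i + n) x)"
      unfolding F_def using suminf_minus_initial_segment[OF s, of n] by simp
    also have "\<dots> \<le> (\<Sum>i. cmod (f (i + n) x))"
      using summable_ignore_initial_segment[OF elim, of n] by (rule summable_norm)
    also have "\<dots> = g x - (\<Sum>i<n. cmod (f i x))"
      unfolding g_def using suminf_minus_initial_segment[OF elim, of n] by simp
    also have "\<dots> \<le> g x" by (simp add: sum_nonneg)
    finally show ?case .
  qed
  have "integrable M (\<lambda>x. (cmod (F x))\<^sup>2)"
    by (rule Bochner_Integration.integrable_bound[OF gint])
      (measurable, use tail[of 0] in \<open>auto elim!: eventually_mono intro: power_mono\<close>)
  then show F: "F \<in> L2 M" by (simp add: L2_def)
  have "(\<lambda>n. LINT x|M. (cmod (F x - (\<Sum>i<n. f i x)))\<^sup>2) \<longlonglongrightarrow> (LINT x|M. 0)"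
  proof (rule integral_dominated_convergence[where w = "\<lambda>x. (g x)\<^sup>2"])
    show "AE x in M. (\<lambda>n. (cmod (F x - (\<Sum>i<n. f i x)))\<^sup>2) \<longlonglongrightarrow> 0"
      using ae
    proof eventually_elim
      case (elim x)
      then have "(\<lambda>n. \<Sum>i<n. f i x) \<longlonglongrightarrow> F x"
        unfolding F_def by (intro summable_LIMSEQ) (rule summable_norm_cancel)
      then have "(\<lambda>n. F x - (\<Sum>i<n. f i x)) \<longlonglongrightarrow> F x - F x" by (intro tendsto_intros)
      then have "(\<lambda>n. (cmod (F x - (\<Sum>i<n. f i x)))\<^sup>2) \<longlonglongrightarrow> (cmod (F x - F x))\<^sup>2"
        by (intro tendsto_power tendsto_norm)
      then show ?case by simp
    qed
    show "AE x in M. norm ((cmod (F x - (\<Sum>i<n. f i x)))\<^sup>2) \<le> (g x)\<^sup>2" for n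
      using tail[of n] by eventually_elim (simp add: power_mono)
  qed (use gint in measurable)
  from tendsto_real_sqrt[OF this] show "(\<lambda>n. l2_norm M (\<lambda>x. F x - (\<Sum>i<n. f i x))) \<longlonglongrightarrow> 0"
    by (simp add: l2_norm_def)
qed

lemma l2_norm_dominated_tendsto_0:
  fixes F :: "nat \<Rightarrow> 'a \<Rightarrow> complex"
  assumes F: "\<And>n. F n \<in> borel_measurable M" and g: "integrable M g"
    and lim: "\<And>x. x \<in> space M \<Longrightarrow> (\<lambda>n. F n x) \<longlonglongrightarrow> 0"
    and bnd: "\<And>n x. x \<in> space M \<Longrightarrow> (cmod (F n x))\<^sup>2 \<le> g x"
  shows "(\<lambda>n. l2_norm M (F n)) \<longlonglongrightarrow> 0"
proof -
  have "(\<lambda>n. LINT x|M. (cmod (F n x))\<^sup>2) \<longlonglongrightarrow> (LINT x|M. 0)"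
  proof (rule integral_dominated_convergence[where w = g])
    have "(\<lambda>n. (cmod (F n x))\<^sup>2) \<longlonglongrightarrow> 0" if "x \<in> space M" for x
      using tendsto_power[OF tendsto_norm[OF lim[OF that]], of 2] by simp
    then show "AE x in M. (\<lambda>n. (cmod (F n x))\<^sup>2) \<longlonglongrightarrow> 0" by simp
    show "AE x in M. norm ((cmod (F n x))\<^sup>2) \<le> g x" for n using bnd by simp
  qed (use F g in auto)
  from tendsto_real_sqrt[OF this] show ?thesis by (simp add: l2_norm_def)
qed

lemma l2_closure_add:
  assumes S: "S \<subseteq> L2 M" and add: "\<And>u v. u \<in> S \<Longrightarrow> v \<in> S \<Longrightarrow> (\<lambda>x. u x + v x) \<in> S"
    and f: "f \<in> l2_closure M S" and g: "g \<in> l2_closure M S"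
  shows "(\<lambda>x. f x + g x) \<in> l2_closure M S"
proof -
  have fg: "f \<in> L2 M" "g \<in> L2 M" using f g by (auto simp: l2_closure_def)
  have "\<exists>h\<in>S. l2_norm M (\<lambda>x. (f x + g x) - h x) < e" if e: "e > 0" for e
  proof -
    obtain u v where u: "u \<in> S" "l2_norm M (\<lambda>x. f x - u x) < e / 2"
      and v: "v \<in> S" "l2_norm M (\<lambda>x. g x - v x) < e / 2"
      using f g half_gt_zero[OF e] unfolding l2_closure_def by blast
    have uv: "u \<in> L2 M" "v \<in> L2 M" using u(1) v(1) S by auto
    have "l2_norm M (\<lambda>x. (f x - u x) + (g x - v x)) < e"
      using l2_norm_triangle[OF L2_diff[OF fg(1) uv(1)] L2_diff[OF fg(2) uv(2)]] u(2) v(2) by simp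
    moreover have "(\<lambda>x. (f x - u x) + (g x - v x)) = (\<lambda>x. (f x + g x) - (u x + v x))"
      by (simp add: fun_eq_iff)
    ultimately show ?thesis using add[OF u(1) v(1)] by (intro bexI[of _ "\<lambda>x. u x + v x"]) auto
  qed
  then show ?thesis using L2_add[OF fg] by (simp add: l2_closure_def)
qed

lemma l2_closure_scale:
  assumes scale: "\<And>u. u \<in> S \<Longrightarrow> (\<lambda>x. c * u x) \<in> S" and f: "f \<in> l2_closure M S"
  shows "(\<lambda>x. c * f x) \<in> l2_closure M S"
proof -
  have "\<exists>h\<in>S. l2_norm M (\<lambda>x. c * f x - h x) < e" if e: "e > 0" for e
  proof -
    \<comment> \<open>The summand 1 keeps the divisor positive when c = 0.\<close>
    have "e / (cmod c + 1) > 0" using e by (simp add: add_nonneg_pos)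
    then obtain u where u: "u \<in> S" "l2_norm M (\<lambda>x. f x - u x) < e / (cmod c + 1)"
      using f unfolding l2_closure_def by blast
    have "l2_norm M (\<lambda>x. c * f x - c * u x) = cmod c * l2_norm M (\<lambda>x. f x - u x)"
      by (simp flip: l2_norm_scale right_diff_distrib)
    also have "\<dots> \<le> (cmod c + 1) * l2_norm M (\<lambda>x. f x - u x)"
      by (intro mult_right_mono) auto
    also have "\<dots> < (cmod c + 1) * (e / (cmod c + 1))"
      using u(2) by (intro mult_strict_left_mono) (auto simp: add_nonneg_pos)
    also have "\<dots> = e"
      using norm_ge_zero[of c] by (simp add: add_nonneg_eq_0_iff)
    finally show ?thesis using scale[OF u(1)] by (intro bexI[of _ "\<lambda>x. c * u x"])
  qed
  then show ?thesis using f L2_scale by (auto simp: l2_closure_def)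
qed

lemma l2_closure_sum:
  assumes S: "S \<subseteq> L2 M" and add: "\<And>u v. u \<in> S \<Longrightarrow> v \<in> S \<Longrightarrow> (\<lambda>x. u x + v x) \<in> S"
    and 0: "(\<lambda>x. 0) \<in> S" and f: "\<And>i. i \<in> I \<Longrightarrow> f i \<in> l2_closure M S"
  shows "(\<lambda>x. \<Sum>i\<in>I. f i x) \<in> l2_closure M S"
proof -
  have "(\<lambda>x. 0) \<in> l2_closure M S" using l2_closure_subset[OF S] 0 by blast
  then show ?thesis using f
    by (induction I rule: infinite_finite_induct) (auto intro!: l2_closure_add[OF S add])
qed

lemma l2_norm_tendsto:
  assumes F: "\<And>n. F n \<in> L2 M" "f \<in> L2 M" "(\<lambda>n. l2_norm M (\<lambda>x. f x - F n x)) \<longlonglongrightarrow> 0"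
  shows "(\<lambda>n. l2_norm M (F n)) \<longlonglongrightarrow> l2_norm M f"
proof (rule LIM_zero_cancel, rule Lim_null_comparison[OF _ F(3)])
  have "\<bar>l2_norm M (F n) - l2_norm M f\<bar> \<le> l2_norm M (\<lambda>x. f x - F n x)" for n
    using l2_norm_triangle[OF L2_diff[OF F(2) F(1)[of n]] F(1)[of n]]
      l2_norm_triangle[OF L2_diff[OF F(1)[of n] F(2)] F(2)]
    by (simp add: l2_norm_minus_commute[of M f])
  then show "\<forall>\<^sub>F n in sequentially. norm (l2_norm M (F n) - l2_norm M f) \<le> l2_norm M (\<lambda>x. f x - F n x)" by simp
qed

lemma l2_inner_sum_left:
  "finite I \<Longrightarrow> (\<And>i. i \<in> I \<Longrightarrow> f i \<in> L2 M) \<Longrightarrow> g \<in> L2 M \<Longrightarrow>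
    l2_inner M (\<lambda>x. \<Sum>i\<in>I. f i x) g = (\<Sum>i\<in>I. l2_inner M (f i) g)"
proof (induction I rule: finite_induct)
  case empty
  then show ?case by (simp add: l2_inner_def)
next
  case (insert i I)
  then show ?case by (simp add: l2_inner_add_left L2_sum)
qed

lemma l2_inner_scale_right: "l2_inner M f (\<lambda>x. c * g x) = cnj c * l2_inner M f g"
  by (subst (1 2) l2_inner_commute) (simp add: l2_inner_scale_left)

section \<open>Spans and operator graphs\<close>

lemma graph_closure_sequence:
  assumes "(f, g) \<in> graph_closure M G"
  obtains U V where "\<forall>n :: nat. (U n, V n) \<in> G"
    "(\<lambda>n. l2_norm M (\<lambda>x. f x - U n x)) \<longlonglongrightarrow> 0" "(\<lambda>n. l2_norm M (\<lambda>x. g x - V n x)) \<longlonglongrightarrow> 0"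
proof -
  have "\<exists>uv. uv \<in> G \<and> l2_norm M (\<lambda>x. f x - fst uv x) < inverse (real (Suc n))
      \<and> l2_norm M (\<lambda>x. g x - snd uv x) < inverse (real (Suc n))" for n
  proof -
    have "0 < inverse (real (Suc n))" by simp
    then have "\<exists>(u, v)\<in>G. l2_norm M (\<lambda>x. f x - u x) < inverse (real (Suc n))
        \<and> l2_norm M (\<lambda>x. g x - v x) < inverse (real (Suc n))"
      using assms unfolding graph_closure_def by blast
    then show ?thesis by (auto simp del: of_nat_Suc)
  qed
  then obtain W where W: "\<And>n. W n \<in> G" "\<And>n. l2_norm M (\<lambda>x. f x - fst (W n) x) < inverse (real (Suc n))"
      "\<And>n. l2_norm M (\<lambda>x. g x - snd (W n) x) < inverse (real (Suc n))" by metis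
  have lim: "a \<longlonglongrightarrow> 0" if "\<And>n. 0 \<le> a n" "\<And>n. a n < inverse (real (Suc n))" for a :: "nat \<Rightarrow> real"
    by (rule tendsto_sandwich[OF _ _ tendsto_const LIMSEQ_inverse_real_of_nat])
      (use that in \<open>auto intro!: always_eventually less_imp_le\<close>)
  show ?thesis
  proof (rule that[of "\<lambda>n. fst (W n)" "\<lambda>n. snd (W n)"])
    show "\<forall>n. (fst (W n), snd (W n)) \<in> G" using W(1) by simp
  qed (rule lim, rule l2_norm_nonneg, rule W)+
qed

text \<open>\<open>fun_span\<close> sums over a finite set of functions. A family may list the same
  function several times, so the coefficients of equal members are first added up.\<close>

lemma fun_spanI:
  assumes "finite I" "\<And>i. i \<in> I \<Longrightarrow> s i \<in> S"
  shows "(\<lambda>x. \<Sum>i\<in>I. d i * s i x) \<in> fun_span S"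
proof -
  define c where "c u = (\<Sum>i\<in>{i \<in> I. s i = u}. d i)" for u
  have "(\<Sum>i\<in>I. d i * s i x) = (\<Sum>u\<in>s ` I. c u * u x)" for x
  proof -
    have "(\<Sum>i\<in>I. d i * s i x) = (\<Sum>u\<in>s ` I. \<Sum>i\<in>{i \<in> I. s i = u}. d i * s i x)"
      by (rule sum.image_gen[OF assms(1)])
    also have "\<dots> = (\<Sum>u\<in>s ` I. c u * u x)"
      unfolding c_def sum_distrib_right by (intro sum.cong refl) auto
    finally show ?thesis .
  qed
  then have "(\<lambda>x. \<Sum>i\<in>I. d i * s i x) = (\<lambda>x. \<Sum>u\<in>s ` I. c u * u x)" by (rule ext)
  moreover have "finite (s ` I)" "s ` I \<subseteq> S" using assms by auto
  ultimately show ?thesis unfolding fun_span_def by blast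
qed

text \<open>A self-adjoint graph is an adjoint and hence closed, so H contains the closure of G.
  Adjoints reverse inclusion, so H, being its own adjoint, is contained in the adjoint of that
  closure, which is the closure itself.\<close>

lemma self_adjoint_extension_unique:
  assumes sa: "self_adjoint M (graph_closure M G)"
    and H: "self_adjoint M H" "G \<subseteq> H"
  shows "H = graph_closure M G"
proof -
  have Hadj: "graph_adjoint M H = H" and Gadj: "graph_adjoint M (graph_closure M G) = graph_closure M G"
    using H sa by (simp_all add: self_adjoint_def)
  have HL: "u \<in> L2 M \<and> v \<in> L2 M" if "(u, v) \<in> H" for u v
    using that Hadj by (auto simp: graph_adjoint_def)
  have sub: "graph_closure M G \<subseteq> H"
  proof (rule subrelI)
    fix f g assume fg: "(f, g) \<in> graph_closure M G"
    then have fgL: "f \<in> L2 M" "g \<in> L2 M" by (auto simp: graph_closure_def)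
    from fg obtain U V where UV: "\<forall>n. (U n, V n) \<in> G"
      and lim: "(\<lambda>n. l2_norm M (\<lambda>x. f x - U n x)) \<longlonglongrightarrow> 0" "(\<lambda>n. l2_norm M (\<lambda>x. g x - V n x)) \<longlonglongrightarrow> 0"
      by (rule graph_closure_sequence)
    have UVH: "(U n, V n) \<in> H" for n using UV H(2) by blast
    note U = HL[OF UVH, THEN conjunct1] and V = HL[OF UVH, THEN conjunct2]
    have "l2_inner M v f = l2_inner M u g" if uv: "(u, v) \<in> H" for u v
    proof -
      have uvL: "u \<in> L2 M" "v \<in> L2 M" using HL[OF uv] by auto
      have "l2_inner M v (U n) = l2_inner M u (V n)" for n
      proof -
        have "(U n, V n) \<in> graph_adjoint M H" using UVH[of n] Hadj by simp
        then show ?thesis using uv by (auto simp: graph_adjoint_def)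
      qed
      then have "l2_inner M (U n) v = l2_inner M (V n) u" for n
        by (metis l2_inner_commute)
      then have "l2_inner M f v = l2_inner M g u"
        using LIMSEQ_unique[OF l2_inner_tendsto[OF U fgL(1) lim(1) uvL(2)]] l2_inner_tendsto[OF V fgL(2) lim(2) uvL(1)]
        by simp
      then show ?thesis by (metis l2_inner_commute)
    qed
    then have "(f, g) \<in> graph_adjoint M H" using fgL by (auto simp: graph_adjoint_def)
    then show "(f, g) \<in> H" by (simp add: Hadj)
  qed
  moreover have "graph_adjoint M H \<subseteq> graph_adjoint M (graph_closure M G)"
    using sub by (auto simp: graph_adjoint_def)
  ultimately show ?thesis unfolding Hadj Gadj by blast
qed

section \<open>Haar measure and averages over balls\<close>

locale haar =
  fixes m :: "'p::prime_card padic measure"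
  assumes normalized_haar: "normalized_haar m"
begin

lemma sets_haar [simp, measurable_cong]: "sets m = sets borel"
  using normalized_haar by (simp add: normalized_haar_def)

lemma space_haar [simp]: "space m = UNIV"
  using sets_eq_imp_space_eq[OF sets_haar] by simp

lemma emeasure_ball_translate: "emeasure m (padic_ball k a) = emeasure m (padic_ball k 0)"
proof -
  have "padic_ball k a = (\<lambda>x. x + a) ` padic_ball k 0"
    by (force simp: mem_padic_ball image_iff intro: bexI[of _ "_ - a"])
  then show ?thesis using normalized_haar by (simp add: normalized_haar_def)
qed

lemma emeasure_ball_step:
  assumes "j \<le> k"
  shows "emeasure m (padic_ball j 0) = of_nat (CARD('p) ^ nat (k - j)) * emeasure m (padic_ball k 0)"
proof -
  have "emeasure m (padic_ball j 0)
      = (\<Sum>n<CARD('p) ^ nat (k - j). emeasure m (padic_ball k (0 + of_nat CARD('p) powi j * of_nat n)))"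
    unfolding padic_ball_decompose[OF assms, of 0]
    by (rule sum_emeasure[symmetric]) (use padic_ball_subball_inj[OF assms, of 0] in auto)
  also have "\<dots> = (\<Sum>n<CARD('p) ^ nat (k - j). emeasure m (padic_ball k 0))"
    by (intro sum.cong refl emeasure_ball_translate)
  finally show ?thesis by simp
qed

text \<open>For k \<ge> 0 the ball Z_p of mass 1 consists of p^k translates of the ball of level k;
  for k < 0 the ball of level k consists of p^(-k) translates of Z_p.\<close>

lemma emeasure_ball: "emeasure m (padic_ball k a) = ennreal (real CARD('p) powi (- k))"
proof -
  have 0: "emeasure m (padic_ball 0 0) = 1"
    using normalized_haar by (simp add: normalized_haar_def padic_ball_eq Zp_def)
  have "emeasure m (padic_ball k 0) = ennreal (real CARD('p) powi (- k))"
  proof (cases "k \<ge> 0")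
    case True
    then have e: "1 = of_nat (CARD('p) ^ nat k) * emeasure m (padic_ball k 0)"
      using emeasure_ball_step[of 0 k] 0 by simp
    \<comment> \<open>Infinite mass is excluded, since a nonzero multiple of it could not be
      1.\<close>
    then obtain c where c: "c \<ge> 0" "emeasure m (padic_ball k 0) = ennreal c"
      by (cases "emeasure m (padic_ball k 0)") (auto simp: ennreal_mult_top)
    have "ennreal 1 = ennreal (real CARD('p) ^ nat k * c)"
      using e c by (simp add: ennreal_mult ennreal_of_nat_eq_real_of_nat flip: ennreal_power)
    then have "real CARD('p) ^ nat k * c = 1" using c by (simp add: ennreal_1[symmetric] del: ennreal_1)
    then have "c = inverse (real CARD('p) ^ nat k)" by (metis inverse_unique)
    then have "c = real CARD('p) powi (- k)"
      using True by (simp add: power_int_minus power_int_def power_inverse)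
    then show ?thesis using c by simp
  next
    case False
    then show ?thesis
      using emeasure_ball_step[of k 0] 0
      by (simp add: power_int_def ennreal_of_nat_eq_real_of_nat flip: ennreal_power)
  qed
  then show ?thesis by (simp only: emeasure_ball_translate[of k a])
qed

lemma measure_ball [simp]: "measure m (padic_ball k a) = real CARD('p) powi (- k)"
  by (simp add: measure_def emeasure_ball less_imp_le)

text \<open>Finitely many cosets would give finite total mass, whereas the balls p^(-n) Z_p have
  mass p^n. The enumeration is the form that countable additivity asks for, and it supplies
  infinitely many points in different cosets for the multiplicity of the eigenvalues.\<close>

lemma coset_sequence:
  obtains a :: "nat \<Rightarrow> 'p padic"
  where "disjoint_family (\<lambda>i. padic_ball k (a i))" "(\<Union>i. padic_ball k (a i)) = UNIV"
proof -
  have inf: "infinite (range (padic_ball k :: 'p padic \<Rightarrow> _))"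
  proof
    assume fin: "finite (range (padic_ball k :: 'p padic \<Rightarrow> _))"
    have "emeasure m (\<Union>B\<in>range (padic_ball k). B) \<le> (\<Sum>B\<in>range (padic_ball k). emeasure m B)"
      by (rule emeasure_subadditive_finite) (use fin in auto)
    also have "(\<Union>B\<in>range (padic_ball k). B) = (UNIV :: 'p padic set)" using padic_ball_self by blast
    also have "(\<Sum>B\<in>range (padic_ball k :: 'p padic \<Rightarrow> _). emeasure m B)
        = ennreal (real (card (range (padic_ball k :: 'p padic \<Rightarrow> _))) * real CARD('p) powi (- k))"
      by (subst sum.cong[OF refl, of _ _ "\<lambda>_. ennreal (real CARD('p) powi (- k))"])
        (auto simp: emeasure_ball ennreal_mult ennreal_of_nat_eq_real_of_nat less_imp_le)
    finally have le: "emeasure m UNIV \<le> ennreal (real (card (range (padic_ball k :: 'p padic \<Rightarrow> _))) * real CARD('p) powi (- k))" .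
    obtain n where "real (card (range (padic_ball k :: 'p padic \<Rightarrow> _))) * real CARD('p) powi (- k) < real CARD('p) powi (int n)"
      by (rule CARD_powi_greater)
    then have "ennreal (real (card (range (padic_ball k :: 'p padic \<Rightarrow> _))) * real CARD('p) powi (- k))
        < ennreal (real CARD('p) powi (int n))"
      by (intro ennreal_lessI) (auto simp del: power_int_of_nat)
    then have "emeasure m UNIV < emeasure m (padic_ball (- int n) 0)"
      using le by (simp add: emeasure_ball del: power_int_of_nat)
    moreover have "emeasure m (padic_ball (- int n) 0) \<le> emeasure m UNIV"
      by (intro emeasure_mono) auto
    ultimately show False by simp
  qed
  have "countable (range (padic_ball k :: 'p padic \<Rightarrow> _))"
    by (rule countable_subset[OF _ countable_padic_balls]) auto
  then obtain B where B: "bij_betw B (UNIV :: nat set) (range (padic_ball k :: 'p padic \<Rightarrow> _))"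
    using inf by (metis bij_betw_from_nat_into)
  have "\<forall>i. \<exists>a. B i = padic_ball k a"
  proof
    fix i
    have "B i \<in> range (padic_ball k)" using B by (auto simp: bij_betw_def)
    then show "\<exists>a. B i = padic_ball k a" by blast
  qed
  then obtain a where a: "\<And>i. B i = padic_ball k (a i)" by metis
  have "disjoint_family (\<lambda>i. padic_ball k (a i))"
    unfolding disjoint_family_on_def
  proof (intro ballI impI)
    fix i j :: nat assume "i \<noteq> j"
    then have "padic_ball k (a i) \<noteq> padic_ball k (a j)"
      using B a by (metis bij_betw_imp_inj_on UNIV_I inj_on_contraD)
    then show "padic_ball k (a i) \<inter> padic_ball k (a j) = {}"
      by (intro padic_ball_disjoint) (simp add: padic_ball_eq_iff)
  qed
  moreover have "x \<in> (\<Union>i. padic_ball k (a i))" for x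
  proof -
    have "padic_ball k x \<in> range B" using B by (auto simp: bij_betw_def)
    then obtain i where "padic_ball k x = padic_ball k (a i)" using a by auto
    then show ?thesis using padic_ball_self[of x k] by auto
  qed
  ultimately show ?thesis using that by blast
qed

text \<open>One level serves for all points, in contrast to the pointwise radius in
  \<open>test_functions\<close>; compactness of the support bridges the two.\<close>

definition locally_const :: "int \<Rightarrow> ('p padic \<Rightarrow> 'a) \<Rightarrow> bool" where
  "locally_const k f \<longleftrightarrow> (\<forall>x y. y \<in> padic_ball k x \<longrightarrow> f y = f x)"

lemma locally_constD: "locally_const k f \<Longrightarrow> y \<in> padic_ball k x \<Longrightarrow> f y = f x"
  by (simp add: locally_const_def)

lemma locally_const_mono: "locally_const j f \<Longrightarrow> j \<le> k \<Longrightarrow> locally_const k f"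
  unfolding locally_const_def using padic_ball_mono by blast

lemma locally_const_comp: "locally_const k f \<Longrightarrow> locally_const k (\<lambda>x. h (f x))"
  unfolding locally_const_def by metis

lemma locally_const_comp2: "locally_const k f \<Longrightarrow> locally_const k g \<Longrightarrow> locally_const k (\<lambda>x. h (f x) (g x))"
  unfolding locally_const_def by metis

lemma locally_const_measurable:
  assumes "locally_const k f" shows "f \<in> borel_measurable m"
proof -
  have "open (f -` S)" for S
  proof -
    have "f -` S = (\<Union>x\<in>f -` S. padic_ball k x)"
      using locally_constD[OF assms] by fastforce
    then show ?thesis by (metis open_UN open_padic_ball)
  qed
  then show ?thesis by (intro measurableI) auto
qed

lemma locally_const_indicator:
  "j \<le> k \<Longrightarrow> locally_const k (\<lambda>x. indicator (padic_ball j a) x)"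
proof -
  assume jk: "j \<le> k"
  have "y \<in> padic_ball j a \<longleftrightarrow> x \<in> padic_ball j a" if "y \<in> padic_ball k x" for x y
  proof -
    have "y \<in> padic_ball j x" using that padic_ball_mono[OF jk] by blast
    then show ?thesis using padic_ball_trans padic_ball_commute by blast
  qed
  then show ?thesis by (simp add: locally_const_def indicator_def)
qed

lemma integrable_indicator_ball [simp]:
  "integrable m (\<lambda>x. indicator (padic_ball k a) x :: 'a::{banach,second_countable_topology,real_normed_algebra_1})"
proof -
  have "integrable m (\<lambda>x. indicator (padic_ball k a) x *\<^sub>R (1 :: 'a))"
    by (intro integrable_scaleR_left integrable_real_indicator) (auto simp: emeasure_ball)
  moreover have "(\<lambda>x. indicator (padic_ball k a) x *\<^sub>R (1 :: 'a)) = (\<lambda>x. indicator (padic_ball k a) x)"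
    by (auto simp: fun_eq_iff indicator_def)
  ultimately show ?thesis by simp
qed

lemma indicator_ball_L2 [simp]: "indicator (padic_ball k a) \<in> L2 m"
proof -
  have "integrable m (\<lambda>x. (cmod (indicator (padic_ball k a) x))\<^sup>2)"
    by (rule Bochner_Integration.integrable_bound[OF integrable_indicator_ball[of k a, where 'a=real]])
      (measurable, auto simp: indicator_def)
  then show ?thesis by (auto simp: L2_def)
qed

text \<open>This is the conditional expectation onto the sigma-algebra of unions of cosets of p^k
  Z_p, in a version defined at every point.\<close>

definition avg :: "int \<Rightarrow> ('p padic \<Rightarrow> complex) \<Rightarrow> 'p padic \<Rightarrow> complex" where
  "avg k f x = ball_average m (padic_ball k x) f"

lemma avg_eq: "avg k f x = of_real (real CARD('p) powi k) * (LINT y:padic_ball k x|m. f y)"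
  by (simp add: avg_def ball_average_def power_int_minus divide_inverse mult.commute)

text \<open>As an inner product with a ball indicator, the average inherits linearity, invariance
  under changes on null sets, and a bound by Cauchy-Schwarz.\<close>

lemma avg_inner: "avg k f x = of_real (real CARD('p) powi k) * l2_inner m f (indicator (padic_ball k x))"
proof -
  have "(LINT y:padic_ball k x|m. f y) = l2_inner m f (indicator (padic_ball k x))"
    unfolding set_lebesgue_integral_def l2_inner_def
    by (intro Bochner_Integration.integral_cong) (auto simp: indicator_def)
  then show ?thesis by (simp add: avg_eq)
qed

lemma locally_const_avg: "locally_const k (avg k f)"
  unfolding locally_const_def avg_def using padic_ball_eqI by metis

lemma avg_measurable [measurable]: "avg k f \<in> borel_measurable m"
  using locally_const_avg locally_const_measurable by blast

lemma set_integral_const_ball: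
  assumes "\<And>y. y \<in> padic_ball k x \<Longrightarrow> f y = (c :: complex)"
  shows "(LINT y:padic_ball k x|m. f y) = of_real (real CARD('p) powi (- k)) * c"
proof -
  have "(LINT y:padic_ball k x|m. f y) = (LINT y:padic_ball k x|m. c)"
    by (rule set_lebesgue_integral_cong) (use assms in auto)
  also have "\<dots> = of_real (real CARD('p) powi (- k)) * c"
    by (simp add: set_lebesgue_integral_def scaleR_conv_of_real)
  finally show ?thesis .
qed

lemma powi_cancel [simp]: "of_nat CARD('p) powi k * of_nat CARD('p) powi (- k) = (1 :: 'a :: field_char_0)"
  "of_nat CARD('p) powi (- k) * of_nat CARD('p) powi k = (1 :: 'a)"
  "of_nat CARD('p) powi k * (of_nat CARD('p) powi (- k) * c) = (c :: 'a)"
  "of_nat CARD('p) powi (- k) * (of_nat CARD('p) powi k * c) = c"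
  by (simp_all add: power_int_minus flip: mult.assoc)

lemma cmod_powi [simp]: "cmod (of_nat CARD('p) powi k) = real CARD('p) powi k"
  by (simp add: norm_power_int)

lemma set_integral_avg: "(LINT y:padic_ball k x|m. avg k f y) = (LINT y:padic_ball k x|m. f y)"
proof -
  have "(LINT y:padic_ball k x|m. avg k f y) = of_real (real CARD('p) powi (- k)) * avg k f x"
    by (rule set_integral_const_ball) (rule locally_constD[OF locally_const_avg])
  then show ?thesis by (simp add: avg_eq)
qed

lemma avg_mult_locally_const:
  assumes "locally_const k g" shows "avg k (\<lambda>x. f x * g x) y = avg k f y * g y"
proof -
  have "(LINT x:padic_ball k y|m. f x * g x) = (LINT x:padic_ball k y|m. f x * g y)"
    by (rule set_lebesgue_integral_cong) (use locally_constD[OF assms] in auto)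
  also have "\<dots> = (LINT x:padic_ball k y|m. f x) * g y"
    by (rule set_integral_mult_left)
  finally show ?thesis by (simp add: avg_eq)
qed

lemma avg_locally_const:
  assumes "locally_const k f" shows "avg k f = f"
proof
  fix x
  have "(LINT y:padic_ball k x|m. f y) = of_real (real CARD('p) powi (- k)) * f x"
    by (rule set_integral_const_ball) (rule locally_constD[OF assms])
  then show "avg k f x = f x" by (simp add: avg_eq)
qed

lemma avg_cnj: "avg k (\<lambda>x. cnj (f x)) y = cnj (avg k f y)"
proof -
  have "(LINT x:padic_ball k y|m. cnj (f x)) = cnj (LINT x:padic_ball k y|m. f x)"
    unfolding set_lebesgue_integral_def Bochner_Integration.integral_cnj[symmetric] by simp
  then show ?thesis by (simp add: avg_eq)
qed

text \<open>On each coset the modulus of the mean is at most the mean of the modulus. Summing over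
  the countably many cosets gives integrability, after which the integral can be computed coset by
  coset.\<close>

lemma avg_integrable:
  assumes h: "integrable m h"
  shows "integrable m (avg k h)" and "(LINT x|m. avg k h x) = (LINT x|m. h x)"
proof -
  obtain a :: "nat \<Rightarrow> 'p padic" where disj: "disjoint_family (\<lambda>i. padic_ball k (a i))"
    and un: "(\<Union>i. padic_ball k (a i)) = (UNIV :: 'p padic set)"
    by (rule coset_sequence[of k])
  have dec: "(\<integral>\<^sup>+x. ennreal (cmod (f x)) \<partial>m) = (\<Sum>i. \<integral>\<^sup>+x. ennreal (cmod (f x)) * indicator (padic_ball k (a i)) x \<partial>m)"
    if [measurable]: "f \<in> borel_measurable m" for f
  proof -
    have "ennreal (cmod (f x)) = (\<Sum>i. ennreal (cmod (f x)) * indicator (padic_ball k (a i)) x)" for x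
    proof -
      obtain i where "x \<in> padic_ball k (a i)" using un by blast
      from suminf_cmult_indicator[OF disj this, of "\<lambda>_. ennreal (cmod (f x))"] show ?thesis by simp
    qed
    then have "(\<integral>\<^sup>+x. ennreal (cmod (f x)) \<partial>m) = (\<integral>\<^sup>+x. (\<Sum>i. ennreal (cmod (f x)) * indicator (padic_ball k (a i)) x) \<partial>m)"
      by (intro nn_integral_cong)
    also have "\<dots> = (\<Sum>i. \<integral>\<^sup>+x. ennreal (cmod (f x)) * indicator (padic_ball k (a i)) x \<partial>m)"
      by (rule nn_integral_suminf) measurable
    finally show ?thesis .
  qed
  have [measurable]: "h \<in> borel_measurable m" using h by (rule borel_measurable_integrable)
  have le: "(\<integral>\<^sup>+x. ennreal (cmod (avg k h x)) * indicator (padic_ball k b) x \<partial>m)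
      \<le> (\<integral>\<^sup>+x. ennreal (cmod (h x)) * indicator (padic_ball k b) x \<partial>m)" for b
  proof -
    have i: "integrable m (\<lambda>x. indicator (padic_ball k b) x *\<^sub>R h x)"
      by (rule integrable_mult_indicator) (use h in auto)
    have "(\<integral>\<^sup>+x. ennreal (cmod (avg k h x)) * indicator (padic_ball k b) x \<partial>m)
        = (\<integral>\<^sup>+x. ennreal (cmod (avg k h b)) * indicator (padic_ball k b) x \<partial>m)"
      using locally_constD[OF locally_const_avg] by (intro nn_integral_cong) (auto simp: indicator_def)
    also have "\<dots> = ennreal (cmod (avg k h b) * real CARD('p) powi (- k))"
      by (simp add: nn_integral_cmult_indicator emeasure_ball ennreal_mult less_imp_le)
    also have "cmod (avg k h b) * real CARD('p) powi (- k) = cmod (LINT y:padic_ball k b|m. h y)"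
      by (simp add: avg_eq norm_mult power_int_minus)
    also have "ennreal (cmod (LINT y:padic_ball k b|m. h y)) \<le> (\<integral>\<^sup>+x. ennreal (cmod (indicator (padic_ball k b) x *\<^sub>R h x)) \<partial>m)"
      unfolding set_lebesgue_integral_def using i by (rule integral_norm_bound_ennreal)
    also have "\<dots> = (\<integral>\<^sup>+x. ennreal (cmod (h x)) * indicator (padic_ball k b) x \<partial>m)"
      by (intro nn_integral_cong) (auto simp: indicator_def)
    finally show ?thesis .
  qed
  have "(\<integral>\<^sup>+x. ennreal (cmod (avg k h x)) \<partial>m) \<le> (\<integral>\<^sup>+x. ennreal (cmod (h x)) \<partial>m)"
    by (simp add: dec) (intro suminf_le le; simp)
  also have "\<dots> < \<infinity>" using h by (simp add: integrable_iff_bounded)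
  finally show int: "integrable m (avg k h)" by (simp add: integrable_iff_bounded)
  have un_int: "(LINT x|m. f x) = (\<Sum>i. LINT x:padic_ball k (a i)|m. f x)" if "integrable m f" for f :: "'p padic \<Rightarrow> complex"
  proof -
    have "(LINT x:(\<Union>i. padic_ball k (a i))|m. f x) = (\<Sum>i. LINT x:padic_ball k (a i)|m. f x)"
      by (rule lebesgue_integral_countable_add)
        (use disj that in \<open>auto simp: disjoint_family_on_def un set_integrable_def\<close>)
    then show ?thesis by (simp add: un set_lebesgue_integral_def)
  qed
  show "(LINT x|m. avg k h x) = (LINT x|m. h x)"
    by (simp add: un_int[OF h] un_int[OF int] set_integral_avg)
qed

text \<open>Cauchy-Schwarz on one ball gives the Jensen inequality |P_k f|^2 \<le> P_k(|f|^2); as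
  P_k preserves integrals, it is a contraction.\<close>

lemma avg_L2:
  assumes f: "f \<in> L2 m"
  shows "avg k f \<in> L2 m" and "l2_norm m (avg k f) \<le> l2_norm m f"
proof -
  have [measurable]: "f \<in> borel_measurable m" using f by (rule L2_measurable)
  \<comment> \<open>The squared modulus is made complex because \<open>avg\<close> acts on complex
    functions.\<close>
  define h where "h x = complex_of_real ((cmod (f x))\<^sup>2)" for x
  have h: "integrable m h" unfolding h_def using L2_integrable[OF f] by (rule integrable_of_real)
  have le: "(cmod (avg k f x))\<^sup>2 \<le> Re (avg k h x)" for x
  proof -
    let ?B = "padic_ball k x"
    define fB where "fB y = indicator ?B y * f y" for y
    have nfB: "(cmod (fB y))\<^sup>2 = indicator ?B y *\<^sub>R (cmod (f y))\<^sup>2" for y by (simp add: fB_def indicator_def)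
    have fB: "fB \<in> L2 m"
    proof -
      have "integrable m (\<lambda>y. (cmod (fB y))\<^sup>2)"
        unfolding nfB by (rule integrable_mult_indicator) (use L2_integrable[OF f] in auto)
      then show ?thesis unfolding L2_def by (auto simp: fB_def[abs_def])
    qed
    have "l2_inner m f (indicator ?B) = l2_inner m fB (indicator ?B)"
      unfolding l2_inner_def fB_def by (intro Bochner_Integration.integral_cong) (auto simp: indicator_def)
    then have "cmod (avg k f x) \<le> real CARD('p) powi k * (l2_norm m fB * l2_norm m (indicator ?B))"
      using l2_Cauchy_Schwarz[OF fB, of "indicator ?B"]
      by (simp add: avg_inner norm_mult)
    then have "(cmod (avg k f x))\<^sup>2 \<le> (real CARD('p) powi k * (l2_norm m fB * l2_norm m (indicator ?B)))\<^sup>2"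
      by (rule power_mono) simp
    also have "\<dots> = real CARD('p) powi k * real CARD('p) powi k * ((l2_norm m fB)\<^sup>2 * (l2_norm m (indicator ?B))\<^sup>2)"
      by (simp add: power_mult_distrib power2_eq_square)
    also have "(l2_norm m (indicator ?B))\<^sup>2 = real CARD('p) powi (- k)"
    proof -
      have "(cmod (indicator ?B y))\<^sup>2 = indicator ?B y" for y :: "'p padic" by (simp add: indicator_def)
      then show ?thesis by (simp add: l2_norm_square)
    qed
    also have "(l2_norm m fB)\<^sup>2 = Re (LINT y:?B|m. h y)"
    proof -
      have "(LINT y:?B|m. h y) = of_real (LINT y|m. (cmod (fB y))\<^sup>2)"
        unfolding set_lebesgue_integral_def h_def nfB integral_complex_of_real[symmetric]
        by (intro Bochner_Integration.integral_cong) (auto simp: scaleR_conv_of_real)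
      then show ?thesis by (simp add: l2_norm_square)
    qed
    also have "real CARD('p) powi k * real CARD('p) powi k * (Re (LINT y:?B|m. h y) * real CARD('p) powi (- k)) = Re (avg k h x)"
      by (simp only: avg_eq times_complex.sel Re_complex_of_real Im_complex_of_real)
        (simp add: power_int_minus)
    finally show ?thesis .
  qed
  have i: "integrable m (\<lambda>x. Re (avg k h x))" using avg_integrable(1)[OF h] by simp
  have i2: "integrable m (\<lambda>x. (cmod (avg k f x))\<^sup>2)"
    by (rule Bochner_Integration.integrable_bound[OF i]) (measurable, use le in \<open>auto intro: order_trans[OF _ abs_ge_self]\<close>)
  then show "avg k f \<in> L2 m" by (auto simp: L2_def)
  have "(l2_norm m (avg k f))\<^sup>2 \<le> (LINT x|m. Re (avg k h x))"
    unfolding l2_norm_square by (rule integral_mono[OF i2 i le])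
  also have "\<dots> = Re (LINT x|m. avg k h x)"
    using avg_integrable(1)[OF h] by simp
  also have "\<dots> = (l2_norm m f)\<^sup>2"
    unfolding avg_integrable(2)[OF h] unfolding h_def[abs_def] l2_norm_square integral_complex_of_real by simp
  finally show "l2_norm m (avg k f) \<le> l2_norm m f" by (rule power2_le_imp_le) simp
qed

text \<open>Both sides equal the inner product of the two averages: the averaged factor is constant
  on cosets and passes through \<open>avg\<close>, which preserves integrals.\<close>

lemma avg_symmetric:
  assumes f: "f \<in> L2 m" and g: "g \<in> L2 m"
  shows "l2_inner m (avg k f) g = l2_inner m f (avg k g)"
proof -
  have "l2_inner m (avg k f) g = (LINT x|m. avg k (\<lambda>x. avg k f x * cnj (g x)) x)"
    unfolding l2_inner_def by (rule avg_integrable(2)[symmetric, OF L2_integrable_inner[OF avg_L2(1)[OF f] g]])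
  also have "\<dots> = (LINT x|m. cnj (avg k g x) * avg k f x)"
    using avg_mult_locally_const[OF locally_const_avg[of k f], of "\<lambda>x. cnj (g x)"]
    by (simp add: avg_cnj mult.commute)
  also have "\<dots> = (LINT x|m. avg k (\<lambda>x. f x * cnj (avg k g x)) x)"
    using avg_mult_locally_const[OF locally_const_comp[OF locally_const_avg[of k g], of cnj], of f]
    by (simp add: mult.commute)
  also have "\<dots> = l2_inner m f (avg k g)"
    unfolding l2_inner_def by (rule avg_integrable(2)[OF L2_integrable_inner[OF f avg_L2(1)[OF g]]])
  finally show ?thesis .
qed

lemma avg_add: "f \<in> L2 m \<Longrightarrow> g \<in> L2 m \<Longrightarrow> avg k (\<lambda>x. f x + g x) y = avg k f y + avg k g y"
  by (simp add: avg_inner l2_inner_add_left distrib_left)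

lemma avg_diff: "f \<in> L2 m \<Longrightarrow> g \<in> L2 m \<Longrightarrow> avg k (\<lambda>x. f x - g x) y = avg k f y - avg k g y"
  by (simp add: avg_inner l2_inner_diff_left right_diff_distrib)

lemma avg_scale: "avg k (\<lambda>x. c * f x) y = c * avg k f y"
  by (simp add: avg_inner l2_inner_scale_left)

lemma avg_AE_cong:
  "f \<in> L2 m \<Longrightarrow> g \<in> L2 m \<Longrightarrow> AE x in m. f x = g x \<Longrightarrow> avg k f = avg k g"
  by (rule ext, simp add: avg_inner l2_inner_AE_cong[of f m g])

text \<open>The indicator of a ball of level k has L^2 norm p^(-k/2). The remaining factor p^(k/2)
  tends to 0 at coarse levels, and at a fixed level the bound turns convergence in L^2 into
  pointwise convergence.\<close>

lemma avg_bound: "f \<in> L2 m \<Longrightarrow> cmod (avg k f x) \<le> sqrt (real CARD('p) powi k) * l2_norm m f"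
proof -
  assume f: "f \<in> L2 m"
  have "(cmod (indicator (padic_ball k x) y))\<^sup>2 = indicator (padic_ball k x) y" for y :: "'p padic"
    by (simp add: indicator_def)
  then have "l2_norm m (indicator (padic_ball k x)) = sqrt (real CARD('p) powi (- k))"
    by (simp add: l2_norm_def)
  then have "cmod (avg k f x) \<le> real CARD('p) powi k * (l2_norm m f * sqrt (real CARD('p) powi (- k)))"
    using l2_Cauchy_Schwarz[OF f, of "indicator (padic_ball k x)"]
    by (simp add: avg_inner norm_mult)
  also have "\<dots> = (real CARD('p) powi k / sqrt (real CARD('p) powi k)) * l2_norm m f"
    by (simp add: power_int_minus real_sqrt_inverse divide_inverse)
  also have "real CARD('p) powi k / sqrt (real CARD('p) powi k) = sqrt (real CARD('p) powi k)"
    by (rule real_div_sqrt) (simp add: less_imp_le)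
  finally show ?thesis .
qed

text \<open>A ball of level j \<le> k is a union of balls of level k, so its indicator is fixed by
  P_k, and symmetry of P_k does the rest. In the other case P_k f is already constant at level
  j.\<close>

lemma avg_avg:
  assumes f: "f \<in> L2 m" shows "avg j (avg k f) = avg (min j k) f"
proof (cases "j \<le> k")
  case True
  show ?thesis
  proof
    fix x
    have "avg k (indicator (padic_ball j x)) = indicator (padic_ball j x)"
      using locally_const_indicator[OF True] by (rule avg_locally_const)
    then show "avg j (avg k f) x = avg (min j k) f x"
      using avg_symmetric[OF f indicator_ball_L2, of k j x] True by (simp add: avg_inner)
  qed
next
  case False
  then have "locally_const j (avg k f)" using locally_const_mono[OF locally_const_avg] by simp
  then show ?thesis using avg_locally_const False by simp
qed

lemma avg_restrict:
  assumes "j \<le> k"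
  shows "avg k (\<lambda>x. indicator (padic_ball j a) x * f x) y = indicator (padic_ball j a) y * avg k f y"
  using avg_mult_locally_const[OF locally_const_indicator[OF assms], of f a y] by (simp add: mult.commute)

end

section \<open>Test functions and the multiscale decomposition of $L^2$\<close>

context haar begin

lemma restrict_L2:
  assumes "f \<in> L2 m" "A \<in> sets borel" shows "(\<lambda>x. indicator A x * f x) \<in> L2 m"
proof -
  have [measurable]: "f \<in> borel_measurable m" using assms(1) by (rule L2_measurable)
  have "integrable m (\<lambda>x. (cmod (indicator A x * f x))\<^sup>2)"
    by (rule Bochner_Integration.integrable_bound[OF L2_integrable[OF assms(1)]])
      (use assms(2) in \<open>measurable, auto simp: indicator_def\<close>)
  then show ?thesis using assms(2) by (auto simp: L2_def)
qed

lemma ball_exhaust: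
  obtains N where "\<forall>n\<ge>N. (x :: 'p padic) \<in> padic_ball (- int n) 0"
proof -
  obtain N where N: "pnorm x < real CARD('p) powi (int N)" by (rule CARD_powi_greater)
  have "x \<in> padic_ball (- int n) 0" if "n \<ge> N" for n
  proof -
    have "real CARD('p) powi (int N) \<le> real CARD('p) powi (int n)" using that by (simp only: CARD_powi_le_iff)
    with N have "pnorm x < real CARD('p) powi (int n)" by (rule less_le_trans)
    then show ?thesis unfolding mem_padic_ball by (simp del: power_int_of_nat)
  qed
  then show ?thesis using that by blast
qed

lemma restrict_tendsto:
  assumes f: "f \<in> L2 m"
  shows "(\<lambda>n. l2_norm m (\<lambda>x. f x - indicator (padic_ball (- int n) 0) x * f x)) \<longlonglongrightarrow> 0"
proof (rule l2_norm_dominated_tendsto_0)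
  show "integrable m (\<lambda>x. (cmod (f x))\<^sup>2)" using f by (rule L2_integrable)
  show "(\<lambda>x. f x - indicator (padic_ball (- int n) 0) x * f x) \<in> borel_measurable m" for n
    using L2_measurable[OF f] by measurable
  show "(\<lambda>n. f x - indicator (padic_ball (- int n) 0) x * f x) \<longlonglongrightarrow> 0" for x
  proof -
    obtain N where "\<forall>n\<ge>N. x \<in> padic_ball (- int n) 0" by (rule ball_exhaust)
    then have "eventually (\<lambda>n. f x - indicator (padic_ball (- int n) 0) x * f x = 0) sequentially"
      unfolding eventually_sequentially by (intro exI[of _ N]) simp
    then show ?thesis by (rule tendsto_eventually)
  qed
  show "(cmod (f x - indicator (padic_ball (- int n) 0) x * f x))\<^sup>2 \<le> (cmod (f x))\<^sup>2" for n x
    by (simp add: indicator_def)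
qed

section \<open>Test functions as finite sums of ball indicators\<close>

lemma test_functionsI:
  assumes lc: "locally_const k u" and supp: "\<And>x. x \<notin> padic_ball j 0 \<Longrightarrow> u x = 0"
  shows "u \<in> test_functions"
proof -
  have "closure {x. u x \<noteq> 0} \<subseteq> padic_ball j 0"
    using supp by (intro closure_minimal) auto
  then have "compact (closure {x. u x \<noteq> 0})"
    by (metis closed_closure compact_Int_closed compact_padic_ball inf.absorb_iff2)
  moreover have "\<exists>e>0. \<forall>y. dist y x < e \<longrightarrow> u y = u x" for x
    using locally_constD[OF lc]
    by (intro exI[of _ "real CARD('p) powi (- k)"]) (auto simp: mem_padic_ball dist_padic_def)
  ultimately show ?thesis by (simp add: test_functions_def)
qed

text \<open>Compactness makes the local radius uniform. The same N controls the level of constancy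
  and the support, and every larger n works too, so that two functions can be given a common
  n.\<close>

lemma test_functionsE:
  fixes u :: "'p padic \<Rightarrow> complex"
  assumes u: "u \<in> test_functions"
  obtains N where
    "\<forall>n\<ge>N. locally_const (int n) u \<and> (\<forall>x. x \<notin> padic_ball (- int n) 0 \<longrightarrow> u x = 0)"
proof -
  define S where "S = closure {x. u x \<noteq> 0}"
  have S: "compact S" using u by (simp add: S_def test_functions_def)
  have S0: "u x = 0" if "x \<notin> S" for x using that closure_subset[of "{x. u x \<noteq> 0}"] unfolding S_def by auto
  have "\<exists>k. \<forall>y\<in>padic_ball (int k) x. u y = u x" for x
  proof -
    obtain e where e: "e > 0" "\<And>y. dist y x < e \<Longrightarrow> u y = u x" using u unfolding test_functions_def by blast
    obtain k where "\<And>a :: 'p padic. padic_ball (int k) a \<subseteq> ball a e"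
      using e(1) by (rule padic_ball_small) blast
    then have "padic_ball (int k) x \<subseteq> ball x e" by blast
    then show ?thesis using e(2) by (intro exI[of _ k]) (auto simp: dist_commute)
  qed
  then obtain K where K: "\<And>x y. y \<in> padic_ball (int (K x)) x \<Longrightarrow> u y = u x" by metis
  obtain T where T: "T \<subseteq> S" "finite T" "S \<subseteq> (\<Union>x\<in>T. padic_ball (int (K x)) x)"
    by (rule compactE_image[OF S, of S "\<lambda>x. padic_ball (int (K x)) x"]) auto
  define N1 where "N1 = Max (insert 0 (K ` T))"
  have N1: "K x \<le> N1" if "x \<in> T" for x using \<open>x \<in> T\<close> T(2) by (simp add: N1_def)
  \<comment> \<open>In an ultrametric the small ball around x lies inside the covering ball that
    contains x.\<close>
  have lcS: "u y = u x" if "y \<in> padic_ball (int N1) x" "x \<in> S" for x y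
  proof -
    obtain t where t: "t \<in> T" "x \<in> padic_ball (int (K t)) t" using T(3) \<open>x \<in> S\<close> by blast
    then have "y \<in> padic_ball (int (K t)) x"
      using \<open>y \<in> padic_ball (int N1) x\<close> N1[OF t(1)] padic_ball_mono[of "int (K t)" "int N1" x] by auto
    then have "y \<in> padic_ball (int (K t)) t" using t(2) padic_ball_trans by blast
    then show ?thesis using K[of y t] K[of x t] t(2) by simp
  qed
  have lc: "locally_const (int N1) u"
    unfolding locally_const_def
  proof (intro allI impI)
    fix x y :: "'p padic" assume xy: "y \<in> padic_ball (int N1) x"
    then have "x \<in> padic_ball (int N1) y" by (simp add: padic_ball_commute)
    \<comment> \<open>If one of the points lies in S, the previous fact applies, the relation
      between x and y being symmetric; if neither does, both values are 0.\<close>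
    then show "u y = u x" using xy lcS[of x y] lcS[of y x] S0[of x] S0[of y] by metis
  qed
  obtain c where c: "\<And>y. y \<in> S \<Longrightarrow> dist 0 y \<le> c"
    using compact_imp_bounded[OF S] unfolding bounded_any_center[of S 0] by blast
  obtain N2 where N2: "c < real CARD('p) powi (int N2)" by (rule CARD_powi_greater)
  show ?thesis
  proof (rule that[of "max N1 N2"], intro allI impI conjI)
    fix n assume n: "max N1 N2 \<le> n"
    then show "locally_const (int n) u" using locally_const_mono[OF lc] by simp
    fix x :: "'p padic" assume x: "x \<notin> padic_ball (- int n) 0"
    have "real CARD('p) powi (int N2) \<le> real CARD('p) powi (int n)" using n by (simp only: CARD_powi_le_iff)
    then have "x \<notin> S" using x N2 c[of x] by (auto simp: mem_padic_ball dist_padic_def simp del: power_int_of_nat CARD_powi_le_iff)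
    then show "u x = 0" by (rule S0)
  qed
qed

lemma locally_const_decompose:
  fixes u :: "'p padic \<Rightarrow> complex"
  assumes lc: "locally_const k u" and supp: "\<And>x. x \<notin> padic_ball j 0 \<Longrightarrow> u x = 0" and jk: "j \<le> k"
  obtains I :: "nat set" and c d where "finite I"
    "u = (\<lambda>x. \<Sum>i\<in>I. d i * indicator (padic_ball k (c i)) x)"
proof -
  define I where "I = {..<CARD('p) ^ nat (k - j)}"
  define c where "c i = (0 + of_nat CARD('p) powi j * of_nat i :: 'p padic)" for i
  have fin: "finite I" by (simp add: I_def)
  have dis: "disjoint_family_on (\<lambda>i. padic_ball k (c i)) I"
    unfolding c_def I_def by (rule padic_ball_subball_inj[OF jk])
  have un: "padic_ball j 0 = (\<Union>i\<in>I. padic_ball k (c i))"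
    unfolding c_def I_def by (rule padic_ball_decompose[OF jk])
  have "u x = (\<Sum>i\<in>I. u (c i) * indicator (padic_ball k (c i)) x)" for x
  proof (cases "x \<in> padic_ball j 0")
    case True
    then obtain i where i: "i \<in> I" "x \<in> padic_ball k (c i)" using un by blast
    have "(\<Sum>l\<in>I. u (c l) * indicator (padic_ball k (c l)) x) = (\<Sum>l\<in>I. if l = i then u (c i) else 0)"
      using dis i by (intro sum.cong) (auto simp: disjoint_family_on_def indicator_def)
    also have "\<dots> = u x" using i fin locally_constD[OF lc i(2)] by simp
    finally show ?thesis by simp
  next
    case False
    then have "(\<Sum>i\<in>I. u (c i) * indicator (padic_ball k (c i)) x) = 0"
      using un by (intro sum.neutral) (auto simp: indicator_def)
    then show ?thesis using supp[OF False] by simp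
  qed
  then have "u = (\<lambda>x. \<Sum>i\<in>I. u (c i) * indicator (padic_ball k (c i)) x)" by (rule ext)
  then show ?thesis by (rule that[OF fin])
qed

lemma test_functions_decompose:
  assumes "u \<in> test_functions"
  obtains n and I :: "nat set" and c d where "locally_const (int n) u" "finite I"
    "u = (\<lambda>x. \<Sum>i\<in>I. d i * indicator (padic_ball (int n) (c i)) x)"
proof -
  obtain N where "\<forall>n\<ge>N. locally_const (int n) u \<and> (\<forall>x. x \<notin> padic_ball (- int n) 0 \<longrightarrow> u x = 0)"
    by (rule test_functionsE[OF assms])
  then have N: "\<And>n. n \<ge> N \<Longrightarrow> locally_const (int n) u"
    "\<And>n x. n \<ge> N \<Longrightarrow> x \<notin> padic_ball (- int n) 0 \<Longrightarrow> u x = 0" by blast+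
  obtain I :: "nat set" and c d where "finite I"
    "u = (\<lambda>x. \<Sum>i\<in>I. d i * indicator (padic_ball (int N) (c i)) x)"
    by (rule locally_const_decompose[OF N(1)[OF order_refl] N(2)[OF order_refl]]) auto
  then show ?thesis by (rule that[OF N(1)[OF order_refl]])
qed

lemma test_functions_L2: "test_functions \<subseteq> L2 m"
proof
  fix u :: "'p padic \<Rightarrow> complex" assume "u \<in> test_functions"
  then obtain n and I :: "nat set" and c d where "locally_const (int n) u" "finite I"
    and u: "u = (\<lambda>x. \<Sum>i\<in>I. d i * indicator (padic_ball (int n) (c i)) x)"
    by (rule test_functions_decompose)
  show "u \<in> L2 m" unfolding u by (intro L2_sum L2_scale indicator_ball_L2)
qed

lemma test_functions_integrable:
  assumes "u \<in> test_functions" shows "integrable m u"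
proof -
  obtain n and I :: "nat set" and c d where "locally_const (int n) u" "finite I"
    and u: "u = (\<lambda>x. \<Sum>i\<in>I. d i * indicator (padic_ball (int n) (c i)) x)"
    by (rule test_functions_decompose[OF assms])
  show ?thesis unfolding u by simp
qed

lemma indicator_ball_test:
  fixes a :: "'p padic"
  shows "(\<lambda>x. indicator (padic_ball k a) x) \<in> test_functions"
proof -
  obtain N where N: "\<forall>n\<ge>N. a \<in> padic_ball (- int n) 0" by (rule ball_exhaust)
  \<comment> \<open>j is coarse enough for the ball around 0 to contain a, and at most k, so that it
    then contains the whole ball around a.\<close>
  define j where "j = min k (- int N)"
  have "N \<le> nat (- j)" "- int (nat (- j)) = j" by (simp_all add: j_def)
  then have "a \<in> padic_ball j 0" using N[rule_format, of "nat (- j)"] by simp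
  then have "padic_ball k a \<subseteq> padic_ball j 0" by (subst padic_ball_subset_iff) (auto simp: j_def)
  then show ?thesis
    by (intro test_functionsI[of k _ j] locally_const_indicator) (auto simp: indicator_def)
qed

lemma test_functions_add:
  fixes u :: "'p padic \<Rightarrow> complex"
  assumes u: "u \<in> test_functions" and v: "v \<in> test_functions"
  shows "(\<lambda>x. u x + v x) \<in> test_functions"
proof -
  obtain N where "\<forall>n\<ge>N. locally_const (int n) u \<and> (\<forall>x. x \<notin> padic_ball (- int n) 0 \<longrightarrow> u x = 0)"
    by (rule test_functionsE[OF u])
  then have N: "\<And>n. n \<ge> N \<Longrightarrow> locally_const (int n) u"
    "\<And>n x. n \<ge> N \<Longrightarrow> x \<notin> padic_ball (- int n) 0 \<Longrightarrow> u x = 0" by blast+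
  obtain M where "\<forall>n\<ge>M. locally_const (int n) v \<and> (\<forall>x. x \<notin> padic_ball (- int n) 0 \<longrightarrow> v x = 0)"
    by (rule test_functionsE[OF v])
  then have M: "\<And>n. n \<ge> M \<Longrightarrow> locally_const (int n) v"
    "\<And>n x. n \<ge> M \<Longrightarrow> x \<notin> padic_ball (- int n) 0 \<Longrightarrow> v x = 0" by blast+
  let ?n = "max N M"
  show ?thesis
    by (rule test_functionsI[OF locally_const_comp2[OF N(1)[of ?n] M(1)[of ?n]], of "- int ?n"])
      (use N(2)[of ?n] M(2)[of ?n] in auto)
qed

lemma test_functions_scale:
  fixes u :: "'p padic \<Rightarrow> complex"
  assumes u: "u \<in> test_functions" shows "(\<lambda>x. c * u x) \<in> test_functions"
proof -
  obtain N where "\<forall>n\<ge>N. locally_const (int n) u \<and> (\<forall>x. x \<notin> padic_ball (- int n) 0 \<longrightarrow> u x = 0)"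
    by (rule test_functionsE[OF u])
  then have N: "\<And>n. n \<ge> N \<Longrightarrow> locally_const (int n) u"
    "\<And>n x. n \<ge> N \<Longrightarrow> x \<notin> padic_ball (- int n) 0 \<Longrightarrow> u x = 0" by blast+
  show ?thesis
    by (rule test_functionsI[OF locally_const_comp[OF N(1)[OF order_refl], of "\<lambda>y. c * y"], of "- int N"])
      (use N(2)[of N] in auto)
qed

lemma test_functions_0: "(\<lambda>x :: 'p padic. 0) \<in> test_functions"
  using test_functions_scale[OF indicator_ball_test[of 0 0], of 0] by simp

lemma fun_span_test_functions: "fun_span test_functions \<subseteq> (test_functions :: ('p padic \<Rightarrow> complex) set)"
proof -
  have "(\<lambda>x. \<Sum>u\<in>F. c u * u x) \<in> test_functions" if "finite F" "F \<subseteq> test_functions"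
    for F and c :: "('p padic \<Rightarrow> complex) \<Rightarrow> complex"
    using that by (induction F) (auto intro: test_functions_0 test_functions_add test_functions_scale)
  then show ?thesis by (auto simp: fun_span_def)
qed

section \<open>Density of the test functions and convergence of averages\<close>

text \<open>Dynkin's argument: balls together with the empty set are closed under intersection,
  since two balls are nested or disjoint, and they generate the Borel sets. Cutting with a fixed
  ball keeps all measures finite, so complements and countable disjoint unions stay inside the
  closure.\<close>

lemma indicator_in_closure:
  assumes A: "A \<in> sets borel"
  shows "(\<lambda>x. indicator (A \<inter> padic_ball j 0) x) \<in> l2_closure m test_functions"
proof -
  let ?K = "padic_ball j (0 :: 'p padic)"
  let ?C = "l2_closure m test_functions"
  have sub: "test_functions \<subseteq> ?C" by (rule l2_closure_subset[OF test_functions_L2])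
  have ind_L2: "(\<lambda>x. indicator (B \<inter> ?K) x) \<in> L2 m" if "B \<in> sets borel" for B
    using restrict_L2[OF indicator_ball_L2[of j 0] that] by (simp add: indicator_inter_arith)
  let ?G = "insert {} padic_balls :: 'p padic set set"
  have "sigma_sets UNIV ?G = sigma_sets UNIV padic_balls"
    by (rule sigma_sets_eqI) (auto intro: sigma_sets.Empty)
  then have A': "A \<in> sigma_sets UNIV ?G" using A by (simp add: borel_padic)
  have G_borel: "B \<in> sets borel" if "B \<in> sigma_sets UNIV ?G" for B
    using that \<open>sigma_sets UNIV ?G = _\<close> by (simp add: borel_padic)
  have ball_Int_le: "padic_ball k a \<inter> padic_ball l b \<in> {{}, padic_ball l b}" if "k \<le> l" for k l and a b :: "'p padic"
  proof (cases "b \<in> padic_ball k a")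
    case True
    then have "padic_ball l b \<subseteq> padic_ball k a" by (simp add: padic_ball_subset_iff[OF that])
    then show ?thesis by (simp add: Int_absorb1)
  next
    case False
    then have "padic_ball k b \<inter> padic_ball k a = {}" by (rule padic_ball_disjoint)
    then have "padic_ball k a \<inter> padic_ball l b = {}" using padic_ball_mono[OF that, of b] by auto
    then show ?thesis by simp
  qed
  have ball_Int: "padic_ball k a \<inter> padic_ball l b \<in> {{}, padic_ball k a, padic_ball l b}" for k l and a b :: "'p padic"
    using ball_Int_le[of k l a b] ball_Int_le[of l k b a] by (cases "k \<le> l") (auto simp: Int_commute)
  have stable: "Int_stable ?G"
    unfolding Int_stable_def
  proof (intro ballI)
    fix A B assume AB: "A \<in> ?G" "B \<in> ?G"
    show "A \<inter> B \<in> ?G"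
    proof (cases "A = {} \<or> B = {}")
      case False
      then obtain k a l b where "A = padic_ball k a" "B = padic_ball l b"
        using AB by (auto simp: padic_balls_def)
      then show ?thesis using ball_Int[of k a l b] by (auto simp del: Int_iff)
    qed auto
  qed
  have "?G \<subseteq> Pow UNIV" by simp
  with stable show ?thesis
    using A'
  proof (induction rule: sigma_sets_induct_disjoint)
    case (basic B)
    show ?case
    proof (cases "B \<inter> ?K = {}")
      case True
      then show ?thesis using sub test_functions_0 by auto
    next
      case False
      then obtain k b where "B = padic_ball k b" using basic by (auto simp: padic_balls_def)
      then obtain k' b' where "B \<inter> ?K = padic_ball k' b'" using ball_Int[of k b j 0] False by auto
      then show ?thesis using sub indicator_ball_test by auto
    qed
  next
    case empty
    then show ?case using sub test_functions_0 by auto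
  next
    case (compl B)
    have "(\<lambda>x. indicator ?K x + (- 1) * indicator (B \<inter> ?K) x) \<in> ?C"
      using compl.IH sub indicator_ball_test
      by (intro l2_closure_add[OF test_functions_L2] l2_closure_scale test_functions_add test_functions_scale) auto
    also have "(\<lambda>x. indicator ?K x + (- 1) * indicator (B \<inter> ?K) x) = (\<lambda>x. indicator ((UNIV - B) \<inter> ?K) x :: complex)"
      by (auto simp: fun_eq_iff indicator_def)
    finally show ?case .
  next
    case (union A)
    have Ab: "A i \<in> sets borel" for i using union.hyps by (intro G_borel) auto
    let ?f = "\<lambda>x. indicator ((\<Union>i. A i) \<inter> ?K) x :: complex"
    let ?s = "\<lambda>n x. \<Sum>i<n. indicator (A i \<inter> ?K) x :: complex"
    have s_eq: "?s n x = indicator ((\<Union>i<n. A i) \<inter> ?K) x" for n x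
    proof -
      have "indicator (\<Union>i<n. A i \<inter> ?K) x = ?s n x"
        using union.hyps(1) by (intro indicator_UN_disjoint) (auto simp: disjoint_family_on_def)
      then show ?thesis by simp
    qed
    have s: "?s n \<in> ?C" for n
      using union.IH by (intro l2_closure_sum test_functions_L2 test_functions_add test_functions_0) auto
    have f: "?f \<in> L2 m" using Ab by (intro ind_L2) auto
    \<comment> \<open>The tails of the disjoint union are dominated by the indicator of the fixed
      ball.\<close>
    have "(\<lambda>n. l2_norm m (\<lambda>x. ?f x - ?s n x)) \<longlonglongrightarrow> 0"
    proof (rule l2_norm_dominated_tendsto_0)
      show "integrable m (indicator ?K :: _ \<Rightarrow> real)" by (rule integrable_indicator_ball)
      show "(\<lambda>x. ?f x - ?s n x) \<in> borel_measurable m" for n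
        unfolding s_eq using Ab by measurable
      show "(cmod (?f x - ?s n x))\<^sup>2 \<le> indicator ?K x" for n x
        unfolding s_eq by (auto simp: indicator_def)
      show "(\<lambda>n. ?f x - ?s n x) \<longlonglongrightarrow> 0" for x
      proof (cases "x \<in> (\<Union>i. A i)")
        case True
        then obtain i where i: "x \<in> A i" by blast
        have "eventually (\<lambda>n. ?f x - ?s n x = 0) sequentially"
          unfolding s_eq eventually_sequentially using i
          by (intro exI[of _ "Suc i"]) (auto simp: indicator_def)
        then show ?thesis by (rule tendsto_eventually)
      next
        case False
        then show ?thesis by (intro tendsto_eventually) (auto simp: indicator_def)
      qed
    qed
    note lim = this
    show ?case
    proof (rule l2_closure_idem[OF test_functions_L2 f])
      fix e :: real assume "e > 0"
      from order_tendstoD(2)[OF lim this] obtain n where "l2_norm m (\<lambda>x. ?f x - ?s n x) < e"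
        unfolding eventually_sequentially by blast
      then show "\<exists>g\<in>?C. l2_norm m (\<lambda>x. ?f x - g x) < e" by (intro bexI[OF _ s[of n]])
    qed
  qed
qed

lemma test_functions_dense: "l2_closure m test_functions = L2 m"
proof
  show "l2_closure m test_functions \<subseteq> L2 m" by (auto simp: l2_closure_def)
  show "L2 m \<subseteq> l2_closure m test_functions"
  proof
    fix f assume f: "f \<in> L2 m"
    let ?C = "l2_closure m test_functions"
    have [measurable]: "f \<in> borel_measurable m" using f by (rule L2_measurable)
    \<comment> \<open>The simple functions satisfy |s| \<le> 2|f|. Cut off to balls they stay within
      3|f| of f, which is the origin of the dominating function 9|f|^2 below.\<close>
    obtain s where s: "\<And>i. simple_function m (s i)" "\<And>x. (\<lambda>i. s i x) \<longlonglongrightarrow> f x"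
      "\<And>i x. cmod (s i x) \<le> 2 * cmod (f x)"
      using borel_measurable_implies_sequence_metric[of f m 0] by (auto simp: dist_norm)
    define K where "K i = padic_ball (- int i) (0 :: 'p padic)" for i
    define g where "g i x = indicator (K i) x * s i x" for i x
    have g: "g i \<in> ?C" for i
    proof -
      have fin: "finite (range (s i))" using simple_functionD(1)[OF s(1), of i] by simp
      have "g i x = (\<Sum>y\<in>range (s i). y * indicator (s i -` {y} \<inter> K i) x)" for x
      proof -
        have "(\<Sum>y\<in>range (s i). y * indicator (s i -` {y} \<inter> K i) x)
            = (\<Sum>y\<in>range (s i). if y = s i x then g i x else 0)"
          by (intro sum.cong) (auto simp: g_def indicator_def)
        then show ?thesis using fin by simp
      qed
      moreover have "(\<lambda>x. \<Sum>y\<in>range (s i). y * indicator (s i -` {y} \<inter> K i) x) \<in> ?C"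
      proof (intro l2_closure_sum test_functions_L2 test_functions_add test_functions_0
          l2_closure_scale test_functions_scale)
        fix y
        have "s i -` {y} \<inter> space m \<in> sets m" by (rule simple_functionD(2)[OF s(1)])
        then show "(\<lambda>x. indicator (s i -` {y} \<inter> K i) x) \<in> ?C"
          unfolding K_def by (intro indicator_in_closure) simp
      qed
      ultimately show ?thesis by presburger
    qed
    have [measurable]: "s i \<in> borel_measurable m" for i
      using s(1) by (rule borel_measurable_simple_function)
    have lim: "(\<lambda>i. l2_norm m (\<lambda>x. f x - g i x)) \<longlonglongrightarrow> 0"
    proof (rule l2_norm_dominated_tendsto_0)
      show "integrable m (\<lambda>x. 9 * (cmod (f x))\<^sup>2)" using L2_integrable[OF f] by simp
      show "(\<lambda>x. f x - g i x) \<in> borel_measurable m" for i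
        unfolding g_def K_def by measurable
      show "(\<lambda>i. f x - g i x) \<longlonglongrightarrow> 0" for x
      proof -
        obtain N where N: "\<forall>n\<ge>N. x \<in> padic_ball (- int n) 0" by (rule ball_exhaust)
        have "(\<lambda>i. f x - s i x) \<longlonglongrightarrow> f x - f x" using s(2) by (intro tendsto_diff tendsto_const)
        then have "(\<lambda>i. f x - s i x) \<longlonglongrightarrow> 0" by simp
        moreover have "eventually (\<lambda>i. f x - s i x = f x - g i x) sequentially"
          unfolding eventually_sequentially using N by (intro exI[of _ N]) (simp add: g_def K_def)
        ultimately show ?thesis by (rule Lim_transform_eventually)
      qed
      show "(cmod (f x - g i x))\<^sup>2 \<le> 9 * (cmod (f x))\<^sup>2" for i x
      proof -
        have "cmod (g i x) \<le> 2 * cmod (f x)" using s(3)[of i x] by (simp add: g_def indicator_def)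
        then have "cmod (f x - g i x) \<le> 3 * cmod (f x)" using norm_triangle_ineq4[of "f x" "g i x"] by simp
        then have "(cmod (f x - g i x))\<^sup>2 \<le> (3 * cmod (f x))\<^sup>2" by (rule power_mono) simp
        then show ?thesis by (simp add: power_mult_distrib)
      qed
    qed
    show "f \<in> ?C"
    proof (rule l2_closure_idem[OF test_functions_L2 f])
      fix e :: real assume "e > 0"
      from order_tendstoD(2)[OF lim this] obtain n where "l2_norm m (\<lambda>x. f x - g n x) < e"
        unfolding eventually_sequentially by blast
      then show "\<exists>g\<in>?C. l2_norm m (\<lambda>x. f x - g x) < e" using g[of n] by blast
    qed
  qed
qed

lemma test_functions_approx:
  assumes "f \<in> L2 m" "e > 0"
  obtains u where "u \<in> test_functions" "l2_norm m (\<lambda>x. f x - u x) < e"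
  using assms test_functions_dense unfolding l2_closure_def by blast

text \<open>For a test function the averages at fine levels equal the function. Since
  \<open>avg\<close> is a contraction, the error for f is at most twice its distance to a test
  function.\<close>

lemma avg_tendsto:
  assumes f: "f \<in> L2 m"
  shows "(\<lambda>n. l2_norm m (\<lambda>x. f x - avg (int n) f x)) \<longlonglongrightarrow> 0"
proof (rule LIMSEQ_I)
  fix e :: real assume e: "e > 0"
  obtain u where u: "u \<in> test_functions" "l2_norm m (\<lambda>x. f x - u x) < e / 2"
    by (rule test_functions_approx[OF f half_gt_zero[OF e]])
  have uL: "u \<in> L2 m" using u(1) test_functions_L2 by blast
  obtain N where "\<forall>n\<ge>N. locally_const (int n) u \<and> (\<forall>x. x \<notin> padic_ball (- int n) 0 \<longrightarrow> u x = 0)"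
    by (rule test_functionsE[OF u(1)])
  then have N: "\<And>n. n \<ge> N \<Longrightarrow> locally_const (int n) u"
    "\<And>n x. n \<ge> N \<Longrightarrow> x \<notin> padic_ball (- int n) 0 \<Longrightarrow> u x = 0" by blast+
  have "l2_norm m (\<lambda>x. f x - avg (int n) f x) < e" if "n \<ge> N" for n
  proof -
    have "l2_norm m (\<lambda>x. u x - avg (int n) f x) = l2_norm m (avg (int n) (\<lambda>x. u x - f x))"
      using avg_locally_const[OF N(1)[OF that]] by (simp add: avg_diff[OF uL f, abs_def] fun_eq_iff)
    also have "\<dots> \<le> l2_norm m (\<lambda>x. u x - f x)" by (rule avg_L2[OF L2_diff[OF uL f]])
    finally show ?thesis
      using l2_norm_triangle_diff[OF f uL avg_L2(1)[OF f], of "int n"] u(2)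
      by (simp add: l2_norm_minus_commute[of m u f])
  qed
  then show "\<exists>N. \<forall>n\<ge>N. norm (l2_norm m (\<lambda>x. f x - avg (int n) f x) - 0) < e" by auto
qed

text \<open>For an orthogonal projection, ||P_k u||^2 is the inner product of P_k u with u, hence at
  most sup|P_k u| times the L^1 norm of u. The supremum is at most p^(k/2) ||u||, which vanishes as
  k goes to minus infinity.\<close>

lemma avg_neg_tendsto_test:
  assumes u: "u \<in> test_functions"
  shows "(\<lambda>n. l2_norm m (avg (- int n) u)) \<longlonglongrightarrow> 0"
proof -
  have uL: "u \<in> L2 m" using u test_functions_L2 by blast
  have ui: "integrable m u" using u by (rule test_functions_integrable)
  have le: "(l2_norm m (avg k u))\<^sup>2 \<le> sqrt (real CARD('p) powi k) * (l2_norm m u * (LINT x|m. cmod (u x)))" for k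
  proof -
    have "of_real ((l2_norm m (avg k u))\<^sup>2) = l2_inner m (avg k u) u"
      using avg_symmetric[OF avg_L2(1)[OF uL] uL, of k k] by (simp add: l2_inner_self avg_avg[OF uL])
    then have "(l2_norm m (avg k u))\<^sup>2 = cmod (l2_inner m (avg k u) u)"
      by (metis norm_of_real abs_power2)
    also have "\<dots> \<le> (LINT x|m. cmod (avg k u x * cnj (u x)))"
      unfolding l2_inner_def by (rule integral_norm_bound)
    also have "\<dots> \<le> (LINT x|m. sqrt (real CARD('p) powi k) * l2_norm m u * cmod (u x))"
    proof (rule integral_mono)
      show "integrable m (\<lambda>x. cmod (avg k u x * cnj (u x)))"
        using L2_integrable_inner[OF avg_L2(1)[OF uL] uL] by simp
      show "integrable m (\<lambda>x. sqrt (real CARD('p) powi k) * l2_norm m u * cmod (u x))" using ui by simp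
      show "cmod (avg k u x * cnj (u x)) \<le> sqrt (real CARD('p) powi k) * l2_norm m u * cmod (u x)" for x
        using avg_bound[OF uL, of k x] by (simp add: norm_mult mult_right_mono)
    qed
    finally show ?thesis by (simp add: mult.assoc)
  qed
  have "(\<lambda>n. sqrt (real CARD('p) powi (- int n)) * (l2_norm m u * (LINT x|m. cmod (u x)))) \<longlonglongrightarrow> 0"
    using tendsto_mult_left_zero[OF tendsto_real_sqrt[OF CARD_powi_tendsto_0[where 'p='p], unfolded real_sqrt_zero]]
    by blast
  then have "(\<lambda>n. (l2_norm m (avg (- int n) u))\<^sup>2) \<longlonglongrightarrow> 0"
    by (rule Lim_null_comparison[rotated]) (use le in simp)
  from tendsto_real_sqrt[OF this] show ?thesis by simp
qed

text \<open>This is why the Q_k leave no remainder at coarse scales: on a space of infinite measure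
  a nonzero constant is not square integrable.\<close>

lemma avg_neg_tendsto:
  assumes f: "f \<in> L2 m"
  shows "(\<lambda>n. l2_norm m (avg (- int n) f)) \<longlonglongrightarrow> 0"
proof (rule LIMSEQ_I)
  fix e :: real assume e: "e > 0"
  obtain u where u: "u \<in> test_functions" "l2_norm m (\<lambda>x. f x - u x) < e / 2"
    by (rule test_functions_approx[OF f half_gt_zero[OF e]])
  have uL: "u \<in> L2 m" using u(1) test_functions_L2 by blast
  obtain N where N: "\<And>n. n \<ge> N \<Longrightarrow> l2_norm m (avg (- int n) u) < e / 2"
    using order_tendstoD(2)[OF avg_neg_tendsto_test[OF u(1)] half_gt_zero[OF e]]
    unfolding eventually_sequentially by blast
  have "l2_norm m (avg (- int n) f) < e" if "n \<ge> N" for n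
  proof -
    have "avg (- int n) f = (\<lambda>x. avg (- int n) (\<lambda>x. f x - u x) x + avg (- int n) u x)"
      by (simp add: avg_diff[OF f uL] fun_eq_iff)
    then have "l2_norm m (avg (- int n) f) \<le> l2_norm m (avg (- int n) (\<lambda>x. f x - u x)) + l2_norm m (avg (- int n) u)"
      using l2_norm_triangle[OF avg_L2(1)[OF L2_diff[OF f uL]] avg_L2(1)[OF uL]] by metis
    also have "\<dots> < e"
      using avg_L2(2)[OF L2_diff[OF f uL], of "- int n"] u(2) N[OF that] by simp
    finally show ?thesis .
  qed
  then show "\<exists>N. \<forall>n\<ge>N. norm (l2_norm m (avg (- int n) f) - 0) < e" by auto
qed

section \<open>The projections Q_k and their partial sums\<close>

text \<open>On L^2 this is Q_k, the orthogonal projection onto the functions that are constant on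
  balls of level k and have mean zero on balls of level k - 1: a martingale difference.\<close>

definition detail :: "int \<Rightarrow> ('p padic \<Rightarrow> complex) \<Rightarrow> 'p padic \<Rightarrow> complex" where
  "detail k f x = avg k f x - avg (k - 1) f x"

lemma detail_L2: "f \<in> L2 m \<Longrightarrow> detail k f \<in> L2 m"
  unfolding detail_def[abs_def] by (intro L2_diff avg_L2)

lemma locally_const_detail: "locally_const k (detail k f)"
  unfolding detail_def[abs_def]
  by (intro locally_const_comp2[of k _ _ "(-)"] locally_const_avg locally_const_mono[OF locally_const_avg, of "k - 1" k f]) simp

lemma detail_add: "f \<in> L2 m \<Longrightarrow> g \<in> L2 m \<Longrightarrow> detail k (\<lambda>x. f x + g x) y = detail k f y + detail k g y"
  by (simp add: detail_def avg_add)

lemma detail_diff: "f \<in> L2 m \<Longrightarrow> g \<in> L2 m \<Longrightarrow> detail k (\<lambda>x. f x - g x) y = detail k f y - detail k g y"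
  by (simp add: detail_def avg_diff)

lemma detail_scale: "detail k (\<lambda>x. c * f x) y = c * detail k f y"
  by (simp add: detail_def avg_scale right_diff_distrib)

lemma detail_sum:
  "finite I \<Longrightarrow> (\<And>i. i \<in> I \<Longrightarrow> f i \<in> L2 m) \<Longrightarrow> detail k (\<lambda>x. \<Sum>i\<in>I. f i x) y = (\<Sum>i\<in>I. detail k (f i) y)"
proof (induction I rule: finite_induct)
  case empty
  then show ?case using detail_scale[of k 0 "\<lambda>x. 0"] by simp
next
  case (insert i I)
  then show ?case by (simp add: detail_add L2_sum)
qed

lemma detail_AE_cong:
  "f \<in> L2 m \<Longrightarrow> g \<in> L2 m \<Longrightarrow> AE x in m. f x = g x \<Longrightarrow> detail k f = detail k g"
  by (simp add: detail_def[abs_def] avg_AE_cong[of f g])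

lemma detail_symmetric: "f \<in> L2 m \<Longrightarrow> g \<in> L2 m \<Longrightarrow> l2_inner m (detail k f) g = l2_inner m f (detail k g)"
  by (simp add: detail_def[abs_def] l2_inner_diff_left l2_inner_diff_right avg_L2 avg_symmetric)

lemma detail_avg:
  assumes f: "f \<in> L2 m" shows "detail j (avg k f) x = (if j \<le> k then detail j f x else 0)"
proof (cases "j \<le> k")
  case False
  then have "min (j - 1) k = k" "min j k = k" by auto
  then show ?thesis using False by (simp add: detail_def avg_avg[OF f])
qed (simp add: detail_def avg_avg[OF f] min_def)

lemma detail_detail:
  assumes f: "f \<in> L2 m" shows "detail j (detail k f) x = (if j = k then detail k f x else 0)"
proof -
  have "detail j (detail k f) x = detail j (avg k f) x - detail j (avg (k - 1) f) x"
    unfolding detail_def[of k f, abs_def] by (intro detail_diff avg_L2 f)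
  then show ?thesis by (auto simp: detail_avg[OF f])
qed

text \<open>The strict inequality matters: the ball must be a union of balls of level k - 1 as well,
  for both averages to commute with the cutoff. The approximation by test functions and the
  description of the eigenspaces rely on this.\<close>

lemma detail_restrict:
  assumes "j < k"
  shows "detail k (\<lambda>x. indicator (padic_ball j a) x * f x) y = indicator (padic_ball j a) y * detail k f y"
  using assms by (simp add: detail_def avg_restrict right_diff_distrib)

lemma detail_bound:
  assumes f: "f \<in> L2 m"
  shows "cmod (detail k f x) \<le> 2 * sqrt (real CARD('p) powi k) * l2_norm m f"
proof -
  have "sqrt (real CARD('p) powi (k - 1)) * l2_norm m f \<le> sqrt (real CARD('p) powi k) * l2_norm m f"
    by (intro mult_right_mono) (auto simp only: real_sqrt_le_iff CARD_powi_le_iff l2_norm_nonneg)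
  then show ?thesis
    using avg_bound[OF f, of k x] avg_bound[OF f, of "k - 1" x] norm_triangle_ineq4[of "avg k f x" "avg (k - 1) f x"]
    by (simp add: detail_def)
qed

text \<open>Q_k takes a difference down to level k - 1, so this telescopes to the sum of Q_k over
  the half-open range -n < k \<le> n.\<close>

definition band :: "nat \<Rightarrow> ('p padic \<Rightarrow> complex) \<Rightarrow> 'p padic \<Rightarrow> complex" where
  "band n f x = avg (int n) f x - avg (- int n) f x"

lemma band_L2: "f \<in> L2 m \<Longrightarrow> band n f \<in> L2 m"
  unfolding band_def[abs_def] by (intro L2_diff avg_L2)

lemma band_eq_sum: "band n f x = (\<Sum>k\<in>{- int n<..int n}. detail k f x)"
proof -
  have "avg (a + int l) f x - avg a f x = (\<Sum>k\<in>{a<..a + int l}. detail k f x)" for a l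
  proof (induction l)
    case (Suc l)
    have "{a<..a + int (Suc l)} = insert (a + int (Suc l)) {a<..a + int l}" by auto
    then have "(\<Sum>k\<in>{a<..a + int (Suc l)}. detail k f x)
        = detail (a + int (Suc l)) f x + (\<Sum>k\<in>{a<..a + int l}. detail k f x)" by simp
    moreover have "a + int (Suc l) - 1 = a + int l" by simp
    ultimately show ?case unfolding Suc[symmetric] detail_def[of "a + int (Suc l)"] by simp
  qed simp
  from this[of "- int n" "2 * n"] show ?thesis by (simp add: band_def)
qed

lemma detail_band:
  assumes f: "f \<in> L2 m"
  shows "detail k (band n f) x = (if - int n < k \<and> k \<le> int n then detail k f x else 0)"
proof -
  have "detail k (band n f) x = detail k (avg (int n) f) x - detail k (avg (- int n) f) x"
    unfolding band_def[abs_def] by (intro detail_diff avg_L2 f)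
  then show ?thesis by (auto simp: detail_avg[OF f])
qed

lemma band_tendsto:
  assumes f: "f \<in> L2 m"
  shows "(\<lambda>n. l2_norm m (\<lambda>x. f x - band n f x)) \<longlonglongrightarrow> 0"
proof (rule Lim_null_comparison)
  show "(\<lambda>n. l2_norm m (\<lambda>x. f x - avg (int n) f x) + l2_norm m (avg (- int n) f)) \<longlonglongrightarrow> 0"
    using tendsto_add[OF avg_tendsto[OF f] avg_neg_tendsto[OF f]] by simp
  have "l2_norm m (\<lambda>x. f x - band n f x) \<le> l2_norm m (\<lambda>x. f x - avg (int n) f x) + l2_norm m (avg (- int n) f)" for n
    using l2_norm_triangle[OF L2_diff[OF f avg_L2(1)[OF f]] avg_L2(1)[OF f], of "int n" "- int n"]
    by (simp add: band_def algebra_simps)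
  then show "\<forall>\<^sub>F n in sequentially. norm (l2_norm m (\<lambda>x. f x - band n f x))
      \<le> l2_norm m (\<lambda>x. f x - avg (int n) f x) + l2_norm m (avg (- int n) f)" by simp
qed

text \<open>Q_k is symmetric and idempotent, so it may be placed on both arguments. This is
  Parseval's identity on finitely many scales; its limit evaluates inner products in the proofs of
  self-adjointness and positivity.\<close>

lemma band_inner:
  assumes f: "f \<in> L2 m" and g: "g \<in> L2 m"
  shows "l2_inner m (band n f) g = (\<Sum>k\<in>{- int n<..int n}. l2_inner m (detail k f) (detail k g))"
proof -
  have "l2_inner m (band n f) g = (\<Sum>k\<in>{- int n<..int n}. l2_inner m (detail k f) g)"
    unfolding band_eq_sum[abs_def] using detail_L2[OF f] g by (intro l2_inner_sum_left) auto
  also have "\<dots> = (\<Sum>k\<in>{- int n<..int n}. l2_inner m (detail k f) (detail k g))"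
  proof (rule sum.cong[OF refl])
    fix k
    have "detail k (detail k f) = detail k f" by (simp add: fun_eq_iff detail_detail[OF f])
    then show "l2_inner m (detail k f) g = l2_inner m (detail k f) (detail k g)"
      using detail_symmetric[OF detail_L2[OF f] g, of k k] by simp
  qed
  finally show ?thesis .
qed

lemma l2_norm_band:
  assumes f: "f \<in> L2 m"
  shows "(l2_norm m (band n f))\<^sup>2 = (\<Sum>k\<in>{- int n<..int n}. (l2_norm m (detail k f))\<^sup>2)"
proof -
  have "complex_of_real ((l2_norm m (band n f))\<^sup>2) = l2_inner m (band n f) (band n f)"
    by (simp add: l2_inner_self)
  also have "\<dots> = (\<Sum>k\<in>{- int n<..int n}. l2_inner m (detail k f) (detail k (band n f)))"
    by (rule band_inner[OF f band_L2[OF f]])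
  also have "\<dots> = (\<Sum>k\<in>{- int n<..int n}. of_real ((l2_norm m (detail k f))\<^sup>2))"
  proof (rule sum.cong[OF refl])
    fix k assume "k \<in> {- int n<..int n}"
    then have "detail k (band n f) = detail k f" by (simp add: fun_eq_iff detail_band[OF f])
    then show "l2_inner m (detail k f) (detail k (band n f)) = of_real ((l2_norm m (detail k f))\<^sup>2)"
      by (simp add: l2_inner_self)
  qed
  finally show ?thesis by (simp only: of_real_sum[symmetric] of_real_eq_iff)
qed

end

section \<open>The Fourier transform\<close>

lemma of_nat_CARD_power_nonzero [simp]: "of_nat CARD('p) ^ k \<noteq> (0 :: 'p::prime_card padic)"
  by simp

lemma pnorm_CARD_power: "pnorm (of_nat CARD('p) ^ k :: 'p::prime_card padic) = real CARD('p) powi (- int k)"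
  using pnorm_prime_power_int[where 'p='p, of "int k"] by simp

lemma pnorm_divide: "pnorm (x / y) = pnorm x / pnorm (y :: 'p::prime_card padic)"
  by (simp add: divide_inverse pnorm_mult pnorm_inverse)

section \<open>Fractional part and additive character\<close>

text \<open>A large power p^k makes x integral; the residue modulo p^k, divided by p^k again, is the
  fractional part.\<close>

lemma frac_part_exists:
  fixes x :: "'p::prime_card padic"
  obtains n k where "n < CARD('p) ^ k" "x - of_nat n / of_nat CARD('p) ^ k \<in> Zp"
proof -
  obtain k where k: "pnorm x < real CARD('p) powi (int k)" by (rule CARD_powi_greater)
  have "pnorm (x * of_nat CARD('p) ^ k) \<le> real CARD('p) powi (int k) * real CARD('p) powi (- int k)"
    unfolding pnorm_mult pnorm_CARD_power using k by (intro mult_right_mono) (auto simp: less_imp_le)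
  then have "pnorm (x * of_nat CARD('p) ^ k) \<le> 1" by (simp add: power_int_minus)
  then obtain n where n: "n < CARD('p) ^ k"
    "pnorm (x * of_nat CARD('p) ^ k - of_nat n) \<le> real CARD('p) powi (- int k)"
    by (rule padic_residue)
  have "x - of_nat n / of_nat CARD('p) ^ k = (x * of_nat CARD('p) ^ k - of_nat n) / of_nat CARD('p) ^ k"
    by (simp add: diff_divide_distrib)
  then have "pnorm (x - of_nat n / of_nat CARD('p) ^ k) \<le> 1"
    using n(2) by (simp add: pnorm_divide pnorm_CARD_power divide_le_eq)
  then show ?thesis using n(1) that by (auto simp: Zp_def)
qed

text \<open>Z[1/p] meets Z_p exactly in the integers, and the difference of two fractions that
  represent x modulo Z_p lies in both.\<close>

lemma frac_diff_int:
  fixes x :: "'p::prime_card padic"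
  assumes "x - of_int a / of_nat CARD('p) ^ k \<in> Zp" "x - of_int b / of_nat CARD('p) ^ l \<in> Zp"
  obtains z :: int where "real_of_int a / real CARD('p) ^ k = real_of_int b / real CARD('p) ^ l + real_of_int z"
proof -
  let ?P = "of_nat CARD('p) :: 'p padic"
  have "pnorm (of_int b / ?P ^ l - of_int a / ?P ^ k) \<le> 1"
    using assms pnorm_diff_max[of "x - of_int a / ?P ^ k" "x - of_int b / ?P ^ l"]
    by (simp add: Zp_def)
  also have "of_int b / ?P ^ l - of_int a / ?P ^ k = of_int (b * int CARD('p) ^ k - a * int CARD('p) ^ l) / ?P ^ (k + l)"
    by (simp add: diff_divide_distrib power_add)
  finally have "pnorm (of_int (b * int CARD('p) ^ k - a * int CARD('p) ^ l) :: 'p padic) \<le> real CARD('p) powi (- int (k + l))"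
    unfolding pnorm_divide pnorm_CARD_power by (simp add: divide_le_eq)
  then have "int CARD('p) ^ (k + l) dvd b * int CARD('p) ^ k - a * int CARD('p) ^ l"
    unfolding pnorm_of_int pabs_of_int_le_iff[OF prime_card] .
  then obtain z where z: "b * int CARD('p) ^ k - a * int CARD('p) ^ l = int CARD('p) ^ (k + l) * z" by blast
  then have "real_of_int (b * int CARD('p) ^ k - a * int CARD('p) ^ l) = real_of_int (int CARD('p) ^ (k + l) * z)"
    by simp
  then have "real_of_int b * real CARD('p) ^ k - real_of_int a * real CARD('p) ^ l
      = real CARD('p) ^ k * real CARD('p) ^ l * real_of_int z"
    by (simp add: power_add)
  then have "real_of_int a / real CARD('p) ^ k = real_of_int b / real CARD('p) ^ l + real_of_int (- z)"
    by (simp add: field_simps)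
  then show ?thesis by (rule that)
qed

text \<open>The definition picks the fraction in [0,1) by \<open>THE\<close>. This form admits every
  fraction a/p^k congruent to x, since the integer by which two of them differ is invisible to the
  exponential. Additivity needs this freedom, as a sum of two fractional parts may leave
  [0,1).\<close>

lemma padic_char_eq:
  fixes x :: "'p::prime_card padic"
  assumes a: "x - of_int a / of_nat CARD('p) ^ k \<in> Zp"
  shows "padic_char x = cis (2 * pi * (real_of_int a / real CARD('p) ^ k))"
proof -
  define P where "P r \<longleftrightarrow> (\<exists>n k. n < CARD('p) ^ k \<and> x - of_nat n / of_nat CARD('p) ^ k \<in> Zp
    \<and> r = real n / real CARD('p) ^ k)" for r
  have ex: "\<exists>r. P r"
    using frac_part_exists[of x] unfolding P_def by metis
  have un: "r = s" if "P r" "P s" for r s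
  proof -
    obtain n k where n: "n < CARD('p) ^ k" "x - of_int (int n) / of_nat CARD('p) ^ k \<in> Zp" "r = real n / real CARD('p) ^ k"
      using \<open>P r\<close> unfolding P_def by auto
    obtain n' k' where n': "n' < CARD('p) ^ k'" "x - of_int (int n') / of_nat CARD('p) ^ k' \<in> Zp" "s = real n' / real CARD('p) ^ k'"
      using \<open>P s\<close> unfolding P_def by auto
    obtain z where "real_of_int (int n) / real CARD('p) ^ k = real_of_int (int n') / real CARD('p) ^ k' + real_of_int z"
      by (rule frac_diff_int[OF n(2) n'(2)])
    then have z: "r = s + real_of_int z" using n(3) n'(3) by simp
    have "real n < real CARD('p) ^ k" "real n' < real CARD('p) ^ k'"
      using n(1) n'(1) by (simp_all flip: of_nat_power)
    then have "0 \<le> r" "r < 1" "0 \<le> s" "s < 1" using n(3) n'(3) by (simp_all add: divide_less_eq)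
    then have "real_of_int z < 1" "- 1 < real_of_int z" using z by linarith+
    then have "z = 0" by linarith
    then show ?thesis using z by simp
  qed
  have "P (frac_part x)"
    unfolding frac_part_def P_def[symmetric] using ex un by (metis theI)
  then obtain n l where n: "x - of_int (int n) / of_nat CARD('p) ^ l \<in> Zp" "frac_part x = real n / real CARD('p) ^ l"
    unfolding P_def by auto
  obtain z where "real_of_int a / real CARD('p) ^ k = real_of_int (int n) / real CARD('p) ^ l + real_of_int z"
    by (rule frac_diff_int[OF a n(1)])
  then have "2 * pi * (real_of_int a / real CARD('p) ^ k) = 2 * pi * frac_part x + 2 * pi * real_of_int z"
    using n(2) by (simp add: distrib_left)
  then show ?thesis by (simp add: padic_char_def cis_mult[symmetric] cis_multiple_2pi)
qed

lemma frac_part_exists_int: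
  fixes x :: "'p::prime_card padic"
  obtains a k where "x - of_int a / of_nat CARD('p) ^ k \<in> Zp"
  using frac_part_exists[of x] by (metis of_int_of_nat_eq)

lemma padic_char_add: "padic_char (x + y) = padic_char x * padic_char (y :: 'p::prime_card padic)"
proof -
  let ?P = "of_nat CARD('p) :: 'p padic"
  obtain a k where a: "x - of_int a / ?P ^ k \<in> Zp" by (rule frac_part_exists_int)
  obtain b l where b: "y - of_int b / ?P ^ l \<in> Zp" by (rule frac_part_exists_int)
  have "x + y - of_int (a * int CARD('p) ^ l + b * int CARD('p) ^ k) / ?P ^ (k + l)
      = (x - of_int a / ?P ^ k) + (y - of_int b / ?P ^ l)"
    by (simp add: add_divide_distrib power_add)
  moreover have "\<dots> \<in> Zp"
    using a b pnorm_add_max[of "x - of_int a / ?P ^ k" "y - of_int b / ?P ^ l"] by (simp add: Zp_def)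
  ultimately have "x + y - of_int (a * int CARD('p) ^ l + b * int CARD('p) ^ k) / ?P ^ (k + l) \<in> Zp"
    by (simp only:)
  from padic_char_eq[OF this]
  have "padic_char (x + y) = cis (2 * pi * (real_of_int (a * int CARD('p) ^ l + b * int CARD('p) ^ k) / real CARD('p) ^ (k + l)))" .
  also have "real_of_int (a * int CARD('p) ^ l + b * int CARD('p) ^ k) / real CARD('p) ^ (k + l)
      = real_of_int a / real CARD('p) ^ k + real_of_int b / real CARD('p) ^ l"
    by (simp add: add_divide_distrib power_add)
  finally show ?thesis
    by (simp add: padic_char_eq[OF a] padic_char_eq[OF b] distrib_left cis_mult)
qed

lemma padic_char_Zp: "x \<in> Zp \<Longrightarrow> padic_char x = 1"
  using padic_char_eq[of x 0 0] by simp

lemma padic_char_0 [simp]: "padic_char 0 = 1"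
  by (rule padic_char_Zp) (simp add: Zp_def)

lemma cmod_padic_char [simp]: "cmod (padic_char x) = 1"
  by (simp add: padic_char_def)

lemma padic_char_uminus: "padic_char (- x) = cnj (padic_char x)"
proof -
  have "padic_char (- x) * padic_char x = 1" by (simp flip: padic_char_add)
  moreover have "cnj (padic_char x) * padic_char x = 1"
    using complex_norm_square[of "padic_char x"] by (simp add: mult.commute)
  ultimately show ?thesis by (metis mult_right_cancel zero_neq_one mult_zero_right)
qed

lemma padic_char_diff: "padic_char (x - y) = padic_char x * cnj (padic_char (y :: 'p::prime_card padic))"
  using padic_char_add[of x "- y"] by (simp add: padic_char_uminus)

text \<open>The cosine decreases strictly on [0, pi], and 2 pi / p lies there because p \<ge> 2.
  This nontrivial value is what makes integrals of characters vanish.\<close>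

lemma padic_char_inverse_prime: "padic_char (1 / of_nat CARD('p) :: 'p::prime_card padic) \<noteq> 1"
proof
  assume 1: "padic_char (1 / of_nat CARD('p) :: 'p padic) = 1"
  have "padic_char (1 / of_nat CARD('p) :: 'p padic) = cis (2 * pi * (real_of_int 1 / real CARD('p) ^ 1))"
    by (rule padic_char_eq) (simp add: Zp_def)
  then have "cos (2 * pi / real CARD('p)) = 1" using 1 by (simp add: complex_eq_iff)
  moreover have "cos (2 * pi / real CARD('p)) < cos 0"
  proof (rule cos_monotone_0_pi)
    have "2 \<le> CARD('p)" using CARD_prime_gt_Suc_0[where 'p='p] by linarith
    then have "2 \<le> real CARD('p)" by (metis of_nat_le_iff of_nat_numeral)
    then show "2 * pi / real CARD('p) \<le> pi" by (simp add: divide_le_eq)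
    show "0 < 2 * pi / real CARD('p)" by (rule divide_pos_pos[OF _ CARD_prime_gt_0(1)]) simp
  qed simp
  ultimately show False by simp
qed

section \<open>Integrals of characters over balls\<close>

context haar begin

lemma translate_measurable [measurable]: "(\<lambda>x. x + t) \<in> borel_measurable (borel :: 'p padic measure)"
proof (rule borel_measurable_continuous_onI)
  show "continuous_on UNIV (\<lambda>x :: 'p padic. x + t)"
    unfolding continuous_on_iff by (auto simp: dist_padic_def)
qed

text \<open>\<open>normalized_haar\<close> speaks of images under translations; the preimage of a
  set under translation by t is its image under translation by -t.\<close>

lemma distr_translate: "distr m borel (\<lambda>x. x + t) = m"
proof (rule measure_eqI)
  fix A assume "A \<in> sets (distr m borel (\<lambda>x. x + t))"
  then have A: "A \<in> sets borel" by simp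
  have eq: "(\<lambda>x. x + t) -` A = (\<lambda>x. x + - t) ` A"
    by (force simp: image_iff intro: bexI[of _ "_ + t"])
  have "emeasure (distr m borel (\<lambda>x. x + t)) A = emeasure m ((\<lambda>x. x + t) -` A)"
    using A by (subst emeasure_distr) auto
  also have "\<dots> = emeasure m A"
    unfolding eq using normalized_haar A unfolding normalized_haar_def by blast
  finally show "emeasure (distr m borel (\<lambda>x. x + t)) A = emeasure m A" .
qed simp

lemma integral_translate:
  fixes f :: "'p padic \<Rightarrow> complex"
  assumes [measurable]: "f \<in> borel_measurable borel"
  shows "(LINT x|m. f (x + t)) = (LINT x|m. f x)"
proof -
  have "(LINT x|distr m borel (\<lambda>x. x + t). f x) = (LINT x|m. f (x + t))"
    by (rule integral_distr) measurable
  then show ?thesis by (simp add: distr_translate)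
qed

text \<open>For |x| < p^k a change of \<xi> by an element of p^k Z_p changes x \<xi> by an element
  of Z_p, on which the character is 1.\<close>

lemma char_locally_const:
  obtains k where "locally_const k (\<lambda>\<xi>. padic_char (x * \<xi> :: 'p padic))"
proof -
  obtain k where k: "pnorm x < real CARD('p) powi (int k)" by (rule CARD_powi_greater)
  have "padic_char (x * \<eta>) = padic_char (x * \<xi>)" if "\<eta> \<in> padic_ball (int k) \<xi>" for \<xi> \<eta>
  proof -
    have "pnorm (x * (\<eta> - \<xi>)) \<le> real CARD('p) powi (int k) * real CARD('p) powi (- int k)"
      unfolding pnorm_mult using k that by (intro mult_mono) (auto simp: mem_padic_ball less_imp_le)
    then have "x * (\<eta> - \<xi>) \<in> Zp" by (simp add: Zp_def power_int_minus)
    then have "padic_char (x * \<xi> + x * (\<eta> - \<xi>)) = padic_char (x * \<xi>)"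
      by (simp only: padic_char_add padic_char_Zp mult_1_right)
    then show ?thesis by (simp add: algebra_simps)
  qed
  then show ?thesis using that unfolding locally_const_def by blast
qed

lemma char_measurable [measurable]: "(\<lambda>\<xi>. padic_char (x * \<xi> :: 'p padic)) \<in> borel_measurable borel"
proof -
  obtain k where "locally_const k (\<lambda>\<xi>. padic_char (x * \<xi> :: 'p padic))" by (rule char_locally_const)
  from locally_const_measurable[OF this] show ?thesis by simp
qed

lemma integrable_ball_bounded:
  fixes f :: "'p padic \<Rightarrow> complex"
  assumes [measurable]: "f \<in> borel_measurable borel"
    and le: "\<And>x. x \<in> padic_ball k a \<Longrightarrow> cmod (f x) \<le> c"
  shows "integrable m (\<lambda>x. indicator (padic_ball k a) x * f x)"
proof (rule Bochner_Integration.integrable_bound)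
  show "integrable m (\<lambda>x. c * indicator (padic_ball k a) x)" by simp
  show "AE x in m. norm (indicator (padic_ball k a) x * f x) \<le> norm (c * indicator (padic_ball k a) x)"
    using le by (auto simp: indicator_def intro: order_trans[OF _ abs_ge_self])
qed measurable

text \<open>If x annihilates the ball, the character is 1 on it. Otherwise a translation inside the
  ball multiplies the integral by a number other than 1, so the integral is 0.\<close>

lemma integral_char_ball:
  "(LINT \<xi>|m. indicator (padic_ball k 0) \<xi> * padic_char (x * \<xi>))
    = (if x \<in> padic_ball (- k) 0 then of_real (real CARD('p) powi (- k)) else 0)"
proof (cases "x \<in> padic_ball (- k) 0")
  case True
  have "padic_char (x * \<xi>) = 1" if "\<xi> \<in> padic_ball k 0" for \<xi>
  proof (rule padic_char_Zp)
    have "pnorm (x * \<xi>) \<le> real CARD('p) powi k * real CARD('p) powi (- k)"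
      unfolding pnorm_mult using True that by (intro mult_mono) (auto simp: mem_padic_ball less_imp_le)
    then show "x * \<xi> \<in> Zp" by (simp add: Zp_def power_int_minus)
  qed
  then have "(LINT \<xi>|m. indicator (padic_ball k 0) \<xi> * padic_char (x * \<xi>)) = (LINT \<xi>|m. complex_of_real (indicator (padic_ball k 0) \<xi>))"
    by (intro Bochner_Integration.integral_cong) (auto simp: indicator_def)
  then show ?thesis using True by (simp only: integral_complex_of_real) simp
next
  case False
  then have x: "x \<noteq> 0" using padic_ball_self by metis
  then obtain j where j: "pnorm x = real CARD('p) powi j" by (rule pnorm_value)
  then have jk: "k < j" using False by (simp add: mem_padic_ball)
  \<comment> \<open>t solves x t = 1/p, and it lies in p^k Z_p because |x| > p^k.\<close>
  define t where "t = 1 / (of_nat CARD('p) * x)"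
  have "pnorm t = real CARD('p) powi (1 - j)"
    by (simp add: t_def pnorm_divide pnorm_mult pnorm_prime j power_int_diff)
  then have t: "- t \<in> padic_ball k 0" "t \<in> padic_ball k 0" using jk by (simp_all add: mem_padic_ball)
  let ?I = "LINT \<xi>|m. indicator (padic_ball k 0) \<xi> * padic_char (x * \<xi>)"
  have "?I = (LINT \<xi>|m. indicator (padic_ball k 0) (\<xi> + t) * padic_char (x * (\<xi> + t)))"
    by (rule integral_translate[symmetric]) measurable
  also have "\<dots> = (LINT \<xi>|m. padic_char (x * t) * (indicator (padic_ball k 0) \<xi> * padic_char (x * \<xi>)))"
  proof (rule Bochner_Integration.integral_cong[OF refl])
    fix \<xi>
    have "\<xi> + t \<in> padic_ball k 0 \<longleftrightarrow> \<xi> \<in> padic_ball k (- t)" by (simp add: mem_padic_ball)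
    also have "padic_ball k (- t) = padic_ball k 0" by (rule padic_ball_eqI[OF t(1)])
    finally show "indicator (padic_ball k 0) (\<xi> + t) * padic_char (x * (\<xi> + t))
        = padic_char (x * t) * (indicator (padic_ball k 0) \<xi> * padic_char (x * \<xi>))"
      by (simp add: indicator_def distrib_left padic_char_add)
  qed
  also have "\<dots> = padic_char (x * t) * ?I" by simp
  finally have "(1 - padic_char (x * t)) * ?I = 0" by (simp add: left_diff_distrib)
  moreover have "x * t = 1 / of_nat CARD('p)" using x by (simp add: t_def)
  ultimately have "?I = 0" using padic_char_inverse_prime[where 'p='p] by simp
  then show ?thesis using False by simp
qed

lemma fourier_ball:
  "fourier m (\<lambda>x. indicator (padic_ball k a) x) \<xi>
    = of_real (real CARD('p) powi (- k)) * cnj (padic_char (a * \<xi>)) * indicator (padic_ball (- k) 0) \<xi>"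
proof -
  have char: "cnj (padic_char (x * \<xi>)) = padic_char (- \<xi> * x)" for x
    by (simp add: mult.commute flip: padic_char_uminus)
  have "fourier m (\<lambda>x. indicator (padic_ball k a) x) \<xi> = (LINT x|m. indicator (padic_ball k a) x * padic_char (- \<xi> * x))"
    by (simp add: fourier_def char)
  also have "\<dots> = (LINT x|m. indicator (padic_ball k a) (x + a) * padic_char (- \<xi> * (x + a)))"
    by (rule integral_translate[symmetric]) measurable
  also have "\<dots> = (LINT x|m. padic_char (- \<xi> * a) * (indicator (padic_ball k 0) x * padic_char (- \<xi> * x)))"
    by (intro Bochner_Integration.integral_cong refl)
      (simp add: indicator_def distrib_left right_diff_distrib padic_char_diff mem_padic_ball padic_char_uminus)
  also have "\<dots> = padic_char (- \<xi> * a) * (LINT x|m. indicator (padic_ball k 0) x * padic_char (- \<xi> * x))"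
    by simp
  finally show ?thesis
    unfolding integral_char_ball char by (simp add: indicator_def mem_padic_ball)
qed

section \<open>Eigenvalues, and the fractional derivative as a series\<close>

definition ev :: "real \<Rightarrow> int \<Rightarrow> real" where
  "ev \<alpha> k = real CARD('p) powr (real_of_int k * \<alpha>)"

lemma ev_pos [simp]: "0 < ev \<alpha> k"
  by (simp add: ev_def)

lemma ev_nonneg [simp]: "0 \<le> ev \<alpha> k"
  by (simp add: ev_def)

text \<open>Towards coarse levels the eigenvalues form a geometric progression, of ratio below 1
  when \<alpha> > 0; the series below converge by comparison with it.\<close>

lemma ev_diff_nat: "ev \<alpha> (k - int n) = ev \<alpha> k * (real CARD('p) powr (- \<alpha>)) ^ n"
proof -
  have "real CARD('p) powr (real_of_int (k - int n) * \<alpha>) = real CARD('p) powr (real_of_int k * \<alpha> + real n * (- \<alpha>))"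
    by (simp add: algebra_simps)
  also have "\<dots> = ev \<alpha> k * real CARD('p) powr ((- \<alpha>) * real n)"
    by (simp only: powr_add ev_def mult.commute)
  also have "real CARD('p) powr ((- \<alpha>) * real n) = (real CARD('p) powr (- \<alpha>)) ^ n"
    by (subst powr_powr[symmetric]) (simp add: powr_realpow)
  finally show ?thesis unfolding ev_def .
qed

lemma ev_ratio:
  assumes "0 < \<alpha>" shows "0 < real CARD('p) powr (- \<alpha>)" "real CARD('p) powr (- \<alpha>) < 1"
  using assms by (simp_all add: powr_less_one)

lemma summable_ev: "0 < \<alpha> \<Longrightarrow> summable (\<lambda>n. ev \<alpha> (k - int n))"
  unfolding ev_diff_nat using ev_ratio[of \<alpha>] by (intro summable_mult summable_geometric) simp

lemma ev_less_iff: "0 < \<alpha> \<Longrightarrow> ev \<alpha> j < ev \<alpha> k \<longleftrightarrow> j < k"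
  by (simp add: ev_def)

lemma ev_le_iff: "0 < \<alpha> \<Longrightarrow> ev \<alpha> j \<le> ev \<alpha> k \<longleftrightarrow> j \<le> k"
  by (simp add: ev_def)

lemma ev_powi: "ev \<alpha> k = (real CARD('p) powi k) powr \<alpha>"
  by (simp add: ev_def powr_real_of_int' flip: powr_powr)

lemma pnorm_measurable [measurable]: "pnorm \<in> borel_measurable (borel :: 'p padic measure)"
proof -
  have "pnorm = (\<lambda>x :: 'p padic. dist x 0)" by (simp add: fun_eq_iff dist_padic_def)
  moreover have "(\<lambda>x :: 'p padic. dist x 0) \<in> borel_measurable borel"
    by (intro borel_measurable_continuous_onI continuous_intros)
  ultimately show ?thesis by simp
qed

text \<open>The symbol |\<xi>|^\<alpha> is constant on the spheres |\<xi>| = p^(k-n), n \<ge> 0,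
  which together with 0 fill the ball of radius p^k. Each sphere is a difference of two balls, whose
  transforms g are multiples of ball indicators, and the differences of these are the kernels of the
  Q_k.\<close>

lemma kernel_sums:
  assumes \<alpha>: "0 < \<alpha>"
  defines "g \<equiv> \<lambda>j t. if t \<in> padic_ball j 0 then complex_of_real (real CARD('p) powi j) else 0"
  shows "(\<lambda>n. of_real (ev \<alpha> (k - int n)) * (g (k - int n) t - g (k - int n - 1) t)) sums
    (LINT \<xi>|m. of_real (pnorm \<xi> powr \<alpha>) * indicator (padic_ball (- k) 0) \<xi> * padic_char (t * \<xi>))"
proof -
  define d where "d j \<xi> = (indicator (padic_ball (- j) 0) \<xi> - indicator (padic_ball (- (j - 1)) 0) \<xi> :: complex)" for j :: int and \<xi> :: "'p padic"
  define f where "f n \<xi> = of_real (ev \<alpha> (k - int n)) * (d (k - int n) \<xi> * padic_char (t * \<xi>))" for n \<xi>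
  have i: "integrable m (\<lambda>\<xi>. indicator (padic_ball j 0) \<xi> * padic_char (t * \<xi>))" for j
    by (rule integrable_ball_bounded[where c = 1]) auto
  have fi: "integrable m (f n)" for n
    unfolding f_def[abs_def] d_def left_diff_distrib using i by simp
  have fint: "(LINT \<xi>|m. f n \<xi>) = of_real (ev \<alpha> (k - int n)) * (g (k - int n) t - g (k - int n - 1) t)" for n
    unfolding f_def[abs_def] d_def left_diff_distrib g_def using i by (simp add: integral_char_ball)
  have sub: "padic_ball (- (j - 1)) 0 \<subseteq> padic_ball (- j) (0 :: 'p padic)" for j by (rule padic_ball_mono) simp
  have dn: "cmod (d j \<xi>) = indicator (padic_ball (- j) 0) \<xi> - indicator (padic_ball (- (j - 1)) 0) \<xi>" for j \<xi>
    using sub[of j] by (auto simp: d_def indicator_def)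
  have ptw: "(\<lambda>n. of_real (ev \<alpha> (k - int n)) * d (k - int n) \<xi>) sums (of_real (pnorm \<xi> powr \<alpha>) * indicator (padic_ball (- k) 0) \<xi>)" for \<xi>
  proof (cases "\<xi> = 0")
    \<comment> \<open>At \<xi> = 0 every d vanishes, in agreement with 0 powr \<alpha> = 0.\<close>
    case True
    then show ?thesis by (simp add: d_def)
  next
    case False
    then obtain j where j: "pnorm \<xi> = real CARD('p) powi j" by (rule pnorm_value)
    \<comment> \<open>d i is the indicator of the sphere |\<xi>| = p^i, so at most one index
      contributes.\<close>
    have dj: "d i \<xi> = (if i = j then 1 else 0)" for i
      by (auto simp: d_def indicator_def mem_padic_ball j)
    show ?thesis
    proof (cases "j \<le> k")
      case True
      have "(\<lambda>n. of_real (ev \<alpha> (k - int n)) * d (k - int n) \<xi>) = (\<lambda>n. if n = nat (k - j) then complex_of_real (ev \<alpha> j) else 0)"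
        using True by (auto simp: dj fun_eq_iff)
      moreover have "\<dots> sums complex_of_real (ev \<alpha> j)"
        using sums_single[of "nat (k - j)" "\<lambda>_. complex_of_real (ev \<alpha> j)"] by simp
      ultimately show ?thesis using True by (simp add: indicator_def mem_padic_ball j ev_powi)
    next
      case False
      then have "(\<lambda>n. of_real (ev \<alpha> (k - int n)) * d (k - int n) \<xi>) = (\<lambda>n. 0 :: complex)"
        by (auto simp: dj fun_eq_iff)
      then show ?thesis using False by (simp add: indicator_def mem_padic_ball j)
    qed
  qed
  have fptw: "(\<lambda>n. f n \<xi>) sums (of_real (pnorm \<xi> powr \<alpha>) * indicator (padic_ball (- k) 0) \<xi> * padic_char (t * \<xi>))" for \<xi>
    using sums_mult2[OF ptw[of \<xi>], of "padic_char (t * \<xi>)"] by (simp add: f_def mult.assoc)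
  \<comment> \<open>Exchanging sum and integral takes absolute summability at each \<xi> and
    summability of the integrated norms. Both follow from the geometric series, the latter with the
    mass p^k of the ball as a factor.\<close>
  have nsum: "summable (\<lambda>n. norm (f n \<xi>))" for \<xi>
  proof (rule summable_comparison_test'[OF summable_ev[OF \<alpha>, of k], of 0])
    show "norm (norm (f n \<xi>)) \<le> ev \<alpha> (k - int n)" for n
      by (simp add: f_def norm_mult dn mult_left_le indicator_def)
  qed
  have isum: "summable (\<lambda>n. LINT \<xi>|m. norm (f n \<xi>))"
  proof (rule summable_comparison_test'[OF summable_mult2[OF summable_ev[OF \<alpha>, of k], of "real CARD('p) powi k"], of 0])
    fix n :: nat
    have "(LINT \<xi>|m. norm (f n \<xi>)) \<le> (LINT \<xi>|m. ev \<alpha> (k - int n) * indicator (padic_ball (- k) 0) \<xi>)"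
    proof (rule integral_mono)
      show "integrable m (\<lambda>\<xi>. norm (f n \<xi>))" using fi[of n] by simp
      show "norm (f n \<xi>) \<le> ev \<alpha> (k - int n) * indicator (padic_ball (- k) 0) \<xi>" for \<xi>
        using padic_ball_mono[of "- k" "- (k - int n)" "0 :: 'p padic"]
        by (auto simp: f_def norm_mult dn indicator_def)
    qed simp
    then show "norm (LINT \<xi>|m. norm (f n \<xi>)) \<le> ev \<alpha> (k - int n) * real CARD('p) powi k"
      by (simp add: integral_nonneg_AE)
  qed
  have "(\<lambda>n. LINT \<xi>|m. f n \<xi>) sums (LINT \<xi>|m. (\<Sum>n. f n \<xi>))"
    by (rule sums_integral) (use fi nsum isum in auto)
  then show ?thesis by (simp add: fint sums_unique[OF fptw, symmetric])
qed

text \<open>Up to the factor p^(-k) these are the kernel differences of the Fourier side, evaluated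
  at x - a; this match identifies the fractional derivative with a series in the Q_k.\<close>

lemma detail_ball:
  assumes "j \<le> k"
  shows "detail j (\<lambda>x. indicator (padic_ball k a) x) x = of_real (real CARD('p) powi (- k)) *
    ((if x - a \<in> padic_ball j 0 then of_real (real CARD('p) powi j) else 0)
      - (if x - a \<in> padic_ball (j - 1) 0 then of_real (real CARD('p) powi (j - 1)) else 0))"
proof -
  have avg: "avg i (\<lambda>x. indicator (padic_ball k a) x) x
      = of_real (real CARD('p) powi (- k)) * (if x - a \<in> padic_ball i 0 then of_real (real CARD('p) powi i) else 0)"
    if ik: "i \<le> k" for i
  proof -
    have "l2_inner m (\<lambda>y. indicator (padic_ball k a) y) (indicator (padic_ball i x))
        = (LINT y|m. complex_of_real (indicator (padic_ball k a \<inter> padic_ball i x) y))"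
      unfolding l2_inner_def by (intro Bochner_Integration.integral_cong) (auto simp: indicator_def)
    also have "\<dots> = of_real (measure m (padic_ball k a \<inter> padic_ball i x))"
      unfolding integral_complex_of_real by simp
    also have "measure m (padic_ball k a \<inter> padic_ball i x) = (if x - a \<in> padic_ball i 0 then real CARD('p) powi (- k) else 0)"
    proof -
      have iff: "x - a \<in> padic_ball i 0 \<longleftrightarrow> a \<in> padic_ball i x"
        by (simp add: mem_padic_ball pnorm_minus_commute)
      show ?thesis
      proof (cases "a \<in> padic_ball i x")
        case True
        then have "padic_ball k a \<subseteq> padic_ball i x" by (simp add: padic_ball_subset_iff[OF ik])
        then show ?thesis using True iff by (simp add: Int_absorb2)
      next
        case False
        then have "padic_ball i a \<inter> padic_ball i x = {}" by (rule padic_ball_disjoint)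
        then have "padic_ball k a \<inter> padic_ball i x = {}" using padic_ball_mono[OF ik, of a] by auto
        then show ?thesis using False iff by simp
      qed
    qed
    finally show ?thesis by (simp add: avg_inner mult.commute)
  qed
  show ?thesis using assms by (simp add: detail_def avg right_diff_distrib)
qed

text \<open>A test function is a finite combination of indicators of balls of one level K. Their
  transforms are multiples of phases on the ball of radius p^K, so each inverse transform is the
  kernel computed above, shifted by the centre. The series starts at K because finer details of u
  vanish.\<close>

lemma frac_deriv_sums:
  assumes \<alpha>: "0 < \<alpha>" and u: "u \<in> test_functions"
  obtains K where "locally_const K u"
    "\<And>x. (\<lambda>n. of_real (ev \<alpha> (K - int n)) * detail (K - int n) u x) sums frac_deriv m \<alpha> u x"
proof -
  obtain N and I :: "nat set" and c d where lc: "locally_const (int N) u" and I: "finite I"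
    and dec: "u = (\<lambda>x. \<Sum>i\<in>I. d i * indicator (padic_ball (int N) (c i)) x)"
    by (rule test_functions_decompose[OF u])
  define K where "K = int N"
  define b where "b i x = (indicator (padic_ball K (c i)) x :: complex)" for i x
  have dec': "u = (\<lambda>x. \<Sum>i\<in>I. d i * b i x)" unfolding b_def K_def by (rule dec)
  have bL: "b i \<in> L2 m" for i unfolding b_def[abs_def] by (rule indicator_ball_L2)
  define B where "B i \<xi> = of_real (real CARD('p) powi (- K)) * cnj (padic_char (c i * \<xi>)) * indicator (padic_ball (- K) 0) \<xi>" for i \<xi>
  have [measurable]: "B i \<in> borel_measurable borel" for i unfolding B_def[abs_def] by measurable
  have fb: "fourier m (b i) \<xi> = B i \<xi>" for i \<xi>
    unfolding b_def[abs_def] B_def by (rule fourier_ball)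
  have fu: "fourier m u \<xi> = (\<Sum>i\<in>I. d i * B i \<xi>)" for \<xi>
  proof -
    have i: "integrable m (\<lambda>x. d i * (b i x * cnj (padic_char (x * \<xi>))))" for i
      unfolding b_def by (intro integrable_mult_right integrable_ball_bounded[where c = 1])
        (auto simp: mult.commute[of _ \<xi>])
    have "fourier m u \<xi> = (LINT x|m. (\<Sum>i\<in>I. d i * (b i x * cnj (padic_char (x * \<xi>)))))"
      unfolding fourier_def dec' by (simp add: sum_distrib_right mult.assoc)
    also have "\<dots> = (\<Sum>i\<in>I. LINT x|m. d i * (b i x * cnj (padic_char (x * \<xi>))))"
      using i by (rule Bochner_Integration.integral_sum)
    also have "\<dots> = (\<Sum>i\<in>I. d i * fourier m (b i) \<xi>)" by (simp add: fourier_def)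
    finally show ?thesis by (simp add: fb)
  qed
  let ?k = "\<lambda>t \<xi>. of_real (pnorm \<xi> powr \<alpha>) * indicator (padic_ball (- K) 0) \<xi> * padic_char (t * \<xi>) :: complex"
  have ki: "integrable m (?k t)" for t
  proof -
    have "integrable m (\<lambda>\<xi>. indicator (padic_ball (- K) 0) \<xi> * (of_real (pnorm \<xi> powr \<alpha>) * padic_char (t * \<xi>)))"
    proof (rule integrable_ball_bounded[where c = "(real CARD('p) powi K) powr \<alpha>"])
      show "cmod (of_real (pnorm \<xi> powr \<alpha>) * padic_char (t * \<xi>)) \<le> (real CARD('p) powi K) powr \<alpha>"
        if "\<xi> \<in> padic_ball (- K) 0" for \<xi>
        using that \<alpha> by (simp add: norm_mult mem_padic_ball powr_mono2)
    qed measurable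
    then show ?thesis by (simp add: mult_ac)
  qed
  \<comment> \<open>The phase from the centre \<open>c i\<close> merges with the character at x into
    the character at \<open>x - c i\<close>.\<close>
  have Bk: "of_real (pnorm \<xi> powr \<alpha>) * B i \<xi> * padic_char (x * \<xi>) = of_real (real CARD('p) powi (- K)) * ?k (x - c i) \<xi>" for i \<xi> x
  proof -
    have "padic_char ((x - c i) * \<xi>) = padic_char (x * \<xi>) * cnj (padic_char (c i * \<xi>))"
      by (simp flip: padic_char_add padic_char_uminus add: left_diff_distrib)
    then show ?thesis by (simp add: B_def mult_ac)
  qed
  have main: "(\<lambda>n. of_real (ev \<alpha> (K - int n)) * detail (K - int n) u x) sums frac_deriv m \<alpha> u x" for x
  proof -
    have "frac_deriv m \<alpha> u x = (LINT \<xi>|m. (\<Sum>i\<in>I. d i * (of_real (pnorm \<xi> powr \<alpha>) * B i \<xi> * padic_char (x * \<xi>))))"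
      unfolding frac_deriv_def inv_fourier_def fu by (simp add: sum_distrib_left sum_distrib_right mult_ac)
    also have "\<dots> = (LINT \<xi>|m. (\<Sum>i\<in>I. d i * (of_real (real CARD('p) powi (- K)) * ?k (x - c i) \<xi>)))"
      unfolding Bk ..
    also have "\<dots> = (\<Sum>i\<in>I. LINT \<xi>|m. d i * (of_real (real CARD('p) powi (- K)) * ?k (x - c i) \<xi>))"
      using ki by (intro Bochner_Integration.integral_sum integrable_mult_right)
    also have "\<dots> = (\<Sum>i\<in>I. d i * (of_real (real CARD('p) powi (- K)) * (LINT \<xi>|m. ?k (x - c i) \<xi>)))"
      by simp
    finally have fd: "frac_deriv m \<alpha> u x = (\<Sum>i\<in>I. d i * (of_real (real CARD('p) powi (- K)) * (LINT \<xi>|m. ?k (x - c i) \<xi>)))" .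
    let ?g = "\<lambda>j t. if t \<in> padic_ball j 0 then complex_of_real (real CARD('p) powi j) else 0"
    have "(\<lambda>n. \<Sum>i\<in>I. d i * (of_real (real CARD('p) powi (- K)) *
        (of_real (ev \<alpha> (K - int n)) * (?g (K - int n) (x - c i) - ?g (K - int n - 1) (x - c i))))) sums frac_deriv m \<alpha> u x"
      unfolding fd by (intro sums_sum sums_mult kernel_sums[OF \<alpha>])
    moreover have "(\<Sum>i\<in>I. d i * (of_real (real CARD('p) powi (- K)) *
        (of_real (ev \<alpha> (K - int n)) * (?g (K - int n) (x - c i) - ?g (K - int n - 1) (x - c i)))))
        = of_real (ev \<alpha> (K - int n)) * detail (K - int n) u x" for n
    proof -
      have "detail (K - int n) u x = (\<Sum>i\<in>I. detail (K - int n) (\<lambda>x. d i * b i x) x)"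
        unfolding dec' using bL by (intro detail_sum I L2_scale)
      also have "\<dots> = (\<Sum>i\<in>I. d i * (of_real (real CARD('p) powi (- K)) *
          (?g (K - int n) (x - c i) - ?g (K - int n - 1) (x - c i))))"
        unfolding detail_scale b_def[abs_def] by (subst detail_ball) auto
      finally show ?thesis by (simp only: sum_distrib_left mult.left_commute)
    qed
    ultimately show ?thesis by simp
  qed
  show ?thesis by (rule that[of K]) (use lc main in \<open>auto simp: K_def\<close>)
qed

section \<open>The hierarchical Laplacian\<close>

text \<open>Dividing the diameter by p passes to the subballs of level k + 1, hence the index
  shift.\<close>

lemma diameter_ball_powr:
  "(diameter (padic_ball k (a :: 'p padic)) / real CARD('p)) powr (- \<alpha>) = ev \<alpha> (k + 1)"
proof -
  have "diameter (padic_ball k a) / real CARD('p) = inverse (real CARD('p) powi (k + 1))"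
    by (simp add: diameter_padic_ball power_int_minus power_int_add divide_inverse)
  then show ?thesis
    by (simp add: ev_powi powr_minus inverse_powr less_imp_le)
qed

text \<open>The weight of a ball is the increment of the eigenvalues across its level, so the sum
  over all larger balls telescopes.\<close>

lemma ball_weight:
  "(1 - real CARD('p) powr (- \<alpha>)) * (diameter (padic_ball k (a :: 'p padic)) / real CARD('p)) powr (- \<alpha>)
    = ev \<alpha> (k + 1) - ev \<alpha> k"
  using ev_diff_nat[of \<alpha> "k + 1" 1] by (simp add: diameter_ball_powr left_diff_distrib)

lemma ev_tendsto_0: "0 < \<alpha> \<Longrightarrow> (\<lambda>n. ev \<alpha> (k - int n)) \<longlonglongrightarrow> 0"
  by (rule summable_LIMSEQ_zero[OF summable_ev])

lemma ev_diff_has_sum: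
  assumes \<alpha>: "0 < \<alpha>"
  shows "((\<lambda>j. ev \<alpha> (j + 1) - ev \<alpha> j) has_sum ev \<alpha> (k + 1)) {..k}"
proof -
  have im: "{..k} = (\<lambda>n. k - int n) ` UNIV"
  proof (intro set_eqI iffI)
    fix j assume "j \<in> {..k}"
    then have "j = k - int (nat (k - j))" by simp
    then show "j \<in> (\<lambda>n. k - int n) ` UNIV" by blast
  qed auto
  have tele: "(\<lambda>n. ev \<alpha> (k + 1 - int n) - ev \<alpha> (k + 1 - int (Suc n))) sums ev \<alpha> (k + 1)"
    using telescope_sums'[OF ev_tendsto_0[OF \<alpha>, of "k + 1"]] by simp
  \<comment> \<open>\<open>has_sum\<close> is unconditional summation; nonnegative terms make the
    telescoping series absolutely summable.\<close>
  have nn: "0 \<le> ev \<alpha> (k + 1 - int n) - ev \<alpha> (k + 1 - int (Suc n))" for n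
    using ev_le_iff[OF \<alpha>] by simp
  have "((\<lambda>n. ev \<alpha> (k + 1 - int n) - ev \<alpha> (k + 1 - int (Suc n))) has_sum ev \<alpha> (k + 1)) UNIV"
    by (rule norm_summable_imp_has_sum) (use tele nn in \<open>auto simp: sums_iff\<close>)
  moreover have "(\<lambda>n. ev \<alpha> (k + 1 - int n) - ev \<alpha> (k + 1 - int (Suc n)))
      = (\<lambda>j. ev \<alpha> (j + 1) - ev \<alpha> j) \<circ> (\<lambda>n. k - int n)"
    by (auto simp: fun_eq_iff algebra_simps)
  ultimately show ?thesis
    unfolding im by (subst has_sum_reindex) (auto simp: inj_on_def)
qed

lemma inj_ball_level: "inj_on (\<lambda>j. padic_ball j (a :: 'p padic)) A"
  by (rule inj_onI) (rule padic_ball_level_inj)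

lemma ball_weight_has_sum:
  assumes \<alpha>: "0 < \<alpha>" and C: "C = (\<lambda>B. (1 - real CARD('p) powr (- \<alpha>)) * (diameter B / real CARD('p)) powr (- \<alpha>))"
  shows "(C has_sum ev \<alpha> (k + 1)) {T \<in> padic_balls. padic_ball k (a :: 'p padic) \<subseteq> T}"
proof -
  have "C \<circ> (\<lambda>j. padic_ball j a) = (\<lambda>j. ev \<alpha> (j + 1) - ev \<alpha> j)"
    by (simp add: fun_eq_iff C ball_weight)
  then show ?thesis
    unfolding padic_balls_above using ev_diff_has_sum[OF \<alpha>, of k]
    by (subst has_sum_reindex[OF inj_ball_level]) simp
qed

lemma ball_eigenvalue_ball_weight:
  assumes \<alpha>: "0 < \<alpha>" and C: "C = (\<lambda>B. (1 - real CARD('p) powr (- \<alpha>)) * (diameter B / real CARD('p)) powr (- \<alpha>))"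
  shows "ball_eigenvalue C (padic_ball k (a :: 'p padic)) = ev \<alpha> (k + 1)"
  unfolding ball_eigenvalue_def by (rule infsumI[OF ball_weight_has_sum[OF assms]])

lemma choice_function_ball_weight:
  assumes \<alpha>: "0 < \<alpha>" and C: "C = (\<lambda>B. (1 - real CARD('p) powr (- \<alpha>)) * (diameter B / real CARD('p)) powr (- \<alpha>))"
  shows "choice_function (C :: 'p padic set \<Rightarrow> real)"
  unfolding choice_function_def
proof (intro conjI ballI allI)
  fix B :: "'p padic set" assume "B \<in> padic_balls"
  then obtain k a where B: "B = padic_ball k a" by (auto simp: padic_balls_def)
  show "0 < C B" using ev_less_iff[OF \<alpha>, of k "k + 1"] by (simp add: B C ball_weight)
  show "C summable_on {T \<in> padic_balls. B \<subseteq> T}"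
    unfolding B using ball_weight_has_sum[OF assms] by (rule has_sum_imp_summable)
next
  fix x :: "'p padic" and c :: real
  have "0 < 1 / max c 1" by simp
  from order_tendstoD(2)[OF ev_tendsto_0[OF \<alpha>, of 0] this]
  obtain n where n: "ev \<alpha> (0 - int n) < 1 / max c 1"
    unfolding eventually_sequentially by blast
  \<comment> \<open>Growth at fine levels is read off from decay at coarse ones, since opposite
    levels have reciprocal eigenvalues.\<close>
  have "ev \<alpha> (- int n) * ev \<alpha> (int n) = 1" by (simp add: ev_def flip: powr_add)
  then have "ev \<alpha> (int n) = 1 / ev \<alpha> (- int n)" by (simp add: nonzero_eq_divide_eq less_imp_neq[OF ev_pos, symmetric] mult.commute)
  also have "\<dots> > max c 1" using n ev_pos[of \<alpha> "- int n"] by (simp add: field_simps max_def split: if_splits)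
  finally have cn: "c < ev \<alpha> (int n)" by simp
  show "\<exists>\<delta>>0. \<forall>B\<in>padic_balls. x \<in> B \<and> diameter B < \<delta> \<longrightarrow> c < ball_eigenvalue C B"
  proof (intro exI[of _ "real CARD('p) powi (- int n)"] conjI ballI impI)
    fix B :: "'p padic set" assume "B \<in> padic_balls" and d: "x \<in> B \<and> diameter B < real CARD('p) powi (- int n)"
    then obtain k a where B: "B = padic_ball k a" by (auto simp: padic_balls_def)
    have "int n < k" using d by (simp add: B diameter_padic_ball)
    then have "ev \<alpha> (int n) < ev \<alpha> (k + 1)" by (simp add: ev_less_iff[OF \<alpha>])
    then show "c < ball_eigenvalue C B" using cn by (simp add: B ball_eigenvalue_ball_weight[OF assms])
  qed simp
qed

text \<open>The balls above B and those above its parent differ only in B itself, so the eigenvalues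
  determine the weights. This gives the converse half of the equivalence.\<close>

lemma ball_eigenvalue_parent:
  assumes "choice_function C'"
  shows "ball_eigenvalue C' (padic_ball k a) = C' (padic_ball k a) + ball_eigenvalue C' (padic_ball (k - 1) (a :: 'p padic))"
proof -
  have eq: "{T \<in> padic_balls. padic_ball k a \<subseteq> T} = insert (padic_ball k a) {T \<in> padic_balls. padic_ball (k - 1) a \<subseteq> T}"
  proof -
    have "{..k} = insert k {..k - 1}" by auto
    then show ?thesis unfolding padic_balls_above by simp
  qed
  have "C' summable_on {T \<in> padic_balls. padic_ball (k - 1) a \<subseteq> T}"
    using assms unfolding choice_function_def by simp
  moreover have "padic_ball k a \<notin> {T \<in> padic_balls. padic_ball (k - 1) a \<subseteq> T}"
    unfolding padic_balls_above by (auto dest: padic_ball_level_inj)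
  ultimately show ?thesis unfolding ball_eigenvalue_def eq by (rule infsum_insert)
qed

lemma choice_function_unique:
  assumes \<alpha>: "0 < \<alpha>" and C: "C = (\<lambda>B. (1 - real CARD('p) powr (- \<alpha>)) * (diameter B / real CARD('p)) powr (- \<alpha>))"
    and C': "choice_function (C' :: 'p padic set \<Rightarrow> real)"
  shows "(\<forall>B\<in>padic_balls. C' B = C B)
    \<longleftrightarrow> (\<forall>B\<in>padic_balls. ball_eigenvalue C' B = (diameter B / real CARD('p)) powr (- \<alpha>))"
proof
  assume eq: "\<forall>B\<in>padic_balls. C' B = C B"
  show "\<forall>B\<in>padic_balls. ball_eigenvalue C' B = (diameter B / real CARD('p)) powr (- \<alpha>)"
  proof
    fix B :: "'p padic set" assume "B \<in> padic_balls"
    then obtain k a where B: "B = padic_ball k a" by (auto simp: padic_balls_def)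
    have "ball_eigenvalue C' B = ball_eigenvalue C B"
      unfolding ball_eigenvalue_def using eq by (intro infsum_cong) auto
    then show "ball_eigenvalue C' B = (diameter B / real CARD('p)) powr (- \<alpha>)"
      unfolding B ball_eigenvalue_ball_weight[OF \<alpha> C] diameter_ball_powr .
  qed
next
  assume eq: "\<forall>B\<in>padic_balls. ball_eigenvalue C' B = (diameter B / real CARD('p)) powr (- \<alpha>)"
  show "\<forall>B\<in>padic_balls. C' B = C B"
  proof
    fix B :: "'p padic set" assume "B \<in> padic_balls"
    then obtain k a where B: "B = padic_ball k a" by (auto simp: padic_balls_def)
    have e: "ball_eigenvalue C' (padic_ball j a) = ev \<alpha> (j + 1)" for j
      using eq padic_ballsI[of j a] by (simp add: diameter_ball_powr)
    show "C' B = C B"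
      using ball_eigenvalue_parent[OF C', of k a] unfolding e B by (simp add: C ball_weight)
  qed
qed

text \<open>Let l be the eigenvalues and h the deviations of the averages from u(x), indexed from
  level K downwards. The derivative is the sum of \<open>l n * (h n - h (n + 1))\<close>, the
  Laplacian that of \<open>(l (n + 1) - l n) * h (n + 1)\<close>; the two differ by a telescoping
  series.\<close>

lemma hier_laplacian_eq_frac_deriv:
  assumes \<alpha>: "0 < \<alpha>" and C: "C = (\<lambda>B. (1 - real CARD('p) powr (- \<alpha>)) * (diameter B / real CARD('p)) powr (- \<alpha>))"
    and u: "u \<in> test_functions"
  shows "hier_laplacian m C u x = frac_deriv m \<alpha> u x"
proof -
  have uL: "u \<in> L2 m" using u test_functions_L2 by blast
  obtain K where lc: "locally_const K u"
    and D: "(\<lambda>n. of_real (ev \<alpha> (K - int n)) * detail (K - int n) u x) sums frac_deriv m \<alpha> u x"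
    by (rule frac_deriv_sums[OF \<alpha> u]) blast
  define h where "h n = avg (K - int n) u x - u x" for n
  define l where "l n = complex_of_real (ev \<alpha> (K - int n))" for n
  \<comment> \<open>u is constant at level K, which removes one boundary term; the other tends to 0
    because the eigenvalues do while h stays bounded.\<close>
  have h0: "h 0 = 0" by (simp add: h_def avg_locally_const[OF lc])
  have hb: "cmod (h n) \<le> sqrt (real CARD('p) powi K) * l2_norm m u + cmod (u x)" for n
  proof -
    have "sqrt (real CARD('p) powi (K - int n)) * l2_norm m u \<le> sqrt (real CARD('p) powi K) * l2_norm m u"
      by (intro mult_right_mono) (auto simp only: real_sqrt_le_iff CARD_powi_le_iff l2_norm_nonneg)
    then show ?thesis
      using avg_bound[OF uL, of "K - int n" x] norm_triangle_ineq4[of "avg (K - int n) u x" "u x"]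
      by (simp add: h_def)
  qed
  define b where "b = sqrt (real CARD('p) powi K) * l2_norm m u + cmod (u x)"
  have b: "cmod (h n) \<le> b" for n unfolding b_def by (rule hb)
  have "(\<lambda>n. ev \<alpha> (K - int n) * b) \<longlonglongrightarrow> 0"
    using tendsto_mult_left_zero[OF ev_tendsto_0[OF \<alpha>, of K]] by blast
  then have lh: "(\<lambda>n. l n * h n) \<longlonglongrightarrow> 0"
    by (rule Lim_null_comparison[rotated]) (simp add: l_def norm_mult b mult_left_mono)
  have "(\<lambda>n. l n * h n - l (Suc n) * h (Suc n)) sums (l 0 * h 0 - 0)"
    by (rule telescope_sums'[OF lh])
  then have t: "(\<lambda>n. l n * h n - l (Suc n) * h (Suc n)) sums 0" using h0 by simp
  have "(\<lambda>n. l n * (h n - h (Suc n))) sums frac_deriv m \<alpha> u x"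
    using D by (simp add: h_def l_def detail_def algebra_simps)
  from sums_diff[OF t this]
  have f: "(\<lambda>n. (l n - l (Suc n)) * h (Suc n)) sums (- frac_deriv m \<alpha> u x)"
    by (simp add: algebra_simps)
  \<comment> \<open>The Laplacian is defined by an unconditional sum, hence absolute convergence is
    required.\<close>
  have "summable (\<lambda>n. norm ((l n - l (Suc n)) * h (Suc n)))"
  proof (rule summable_comparison_test'[OF summable_mult2[OF summable_ev[OF \<alpha>, of K], of b], of 0])
    fix n :: nat
    have "l n - l (Suc n) = of_real (ev \<alpha> (K - int n) - ev \<alpha> (K - int (Suc n)))" by (simp add: l_def)
    moreover have "0 \<le> ev \<alpha> (K - int n) - ev \<alpha> (K - int (Suc n))" "ev \<alpha> (K - int n) - ev \<alpha> (K - int (Suc n)) \<le> ev \<alpha> (K - int n)"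
      using ev_le_iff[OF \<alpha>] by simp_all
    ultimately have "cmod (l n - l (Suc n)) \<le> ev \<alpha> (K - int n)" by (simp only: norm_of_real abs_of_nonneg)
    then show "norm (norm ((l n - l (Suc n)) * h (Suc n))) \<le> ev \<alpha> (K - int n) * b"
      using b[of "Suc n"] by (auto simp: norm_mult intro!: mult_mono)
  qed
  from norm_summable_imp_has_sum[OF this f]
  have hs: "((\<lambda>n. (l n - l (Suc n)) * h (Suc n)) has_sum (- frac_deriv m \<alpha> u x)) UNIV" .
  let ?F = "\<lambda>B. of_real (C B) * (ball_average m B u - u x)"
  let ?G = "\<lambda>j. of_real (ev \<alpha> (j + 1) - ev \<alpha> j) * (avg j u x - u x)"
  have FG: "?F \<circ> (\<lambda>j. padic_ball j x) = ?G"
    by (rule ext) (simp only: o_apply C ball_weight avg_def)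
  \<comment> \<open>Balls of level K or finer contribute nothing, which leaves the levels K - 1 -
    n.\<close>
  have G0: "?G j = 0" if "K \<le> j" for j
    using avg_locally_const[OF locally_const_mono[OF lc that]] by simp
  have "?G \<circ> (\<lambda>n. K - 1 - int n) = (\<lambda>n. (l n - l (Suc n)) * h (Suc n))"
    by (auto simp: fun_eq_iff l_def h_def algebra_simps)
  then have "(?G has_sum (- frac_deriv m \<alpha> u x)) ((\<lambda>n. K - 1 - int n) ` UNIV)"
    using hs by (subst has_sum_reindex) (auto simp: inj_on_def)
  also have "?this \<longleftrightarrow> (?G has_sum (- frac_deriv m \<alpha> u x)) UNIV"
  proof (rule has_sum_cong_neutral)
    fix j assume "j \<in> UNIV - (\<lambda>n. K - 1 - int n) ` UNIV"
    then have "j \<noteq> K - 1 - int (nat (K - 1 - j))" by blast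
    then show "?G j = 0" by (intro G0) linarith
  qed auto
  finally have "(?F has_sum (- frac_deriv m \<alpha> u x)) {B \<in> padic_balls. x \<in> B}"
    unfolding padic_balls_containing by (subst has_sum_reindex[OF inj_ball_level]) (simp only: FG)
  then show ?thesis unfolding hier_laplacian_def by (simp add: infsumI)
qed

section \<open>The spectral decomposition\<close>

text \<open>Q_k maps L^2 continuously into bounded functions, so convergence in the mean becomes
  convergence at every point. Pointwise identities between details therefore survive
  closure.\<close>

lemma detail_tendsto:
  assumes F: "\<And>n. F n \<in> L2 m" "f \<in> L2 m" "(\<lambda>n. l2_norm m (\<lambda>x. f x - F n x)) \<longlonglongrightarrow> 0"
  shows "(\<lambda>n. detail k (F n) x) \<longlonglongrightarrow> detail k f x"
proof (rule LIM_zero_cancel, rule Lim_null_comparison)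
  show "(\<lambda>n. 2 * sqrt (real CARD('p) powi k) * l2_norm m (\<lambda>x. f x - F n x)) \<longlonglongrightarrow> 0"
    using F(3) by (rule tendsto_mult_right_zero)
  have "cmod (detail k (F n) x - detail k f x) \<le> 2 * sqrt (real CARD('p) powi k) * l2_norm m (\<lambda>x. f x - F n x)" for n
    using detail_bound[OF L2_diff[OF F(2) F(1)[of n]], of k x] F
    by (simp add: detail_diff norm_minus_commute)
  then show "\<forall>\<^sub>F n in sequentially. norm (detail k (F n) x - detail k f x)
      \<le> 2 * sqrt (real CARD('p) powi k) * l2_norm m (\<lambda>x. f x - F n x)" by simp
qed

lemma l2_norm_detail_le:
  assumes f: "f \<in> L2 m" shows "l2_norm m (detail k f) \<le> 2 * l2_norm m f"
proof -
  have "l2_norm m (detail k f) \<le> l2_norm m (avg k f) + l2_norm m (\<lambda>x. (- 1) * avg (k - 1) f x)"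
    using l2_norm_triangle[OF avg_L2(1)[OF f] L2_scale[OF avg_L2(1)[OF f]], of k "- 1" "k - 1"]
    by (simp add: detail_def[abs_def])
  also have "l2_norm m (\<lambda>x. (- 1) * avg (k - 1) f x) = l2_norm m (avg (k - 1) f)"
    by (subst l2_norm_scale) simp
  finally show ?thesis using avg_L2(2)[OF f, of k] avg_L2(2)[OF f, of "k - 1"] by simp
qed

text \<open>The bands of f - g are all 0 and converge to f - g.\<close>

lemma AE_eq_if_detail_eq:
  assumes f: "f \<in> L2 m" and g: "g \<in> L2 m" and eq: "\<And>k x. detail k f x = detail k g x"
  shows "AE x in m. f x = g x"
proof -
  let ?h = "\<lambda>x. f x - g x"
  have h: "?h \<in> L2 m" by (rule L2_diff[OF f g])
  have "band n ?h = (\<lambda>x. 0)" for n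
    by (simp add: fun_eq_iff band_eq_sum detail_diff[OF f g] eq)
  then have "(\<lambda>n. l2_norm m ?h) \<longlonglongrightarrow> 0" using band_tendsto[OF h] by simp
  then have "l2_norm m ?h = 0" by (simp add: tendsto_const_iff)
  then show ?thesis using l2_norm_eq_0[OF h] by simp
qed

lemma detail_locally_const: "locally_const j f \<Longrightarrow> j < k \<Longrightarrow> detail k f x = 0"
  using avg_locally_const[OF locally_const_mono[of j f k]] avg_locally_const[OF locally_const_mono[of j f "k - 1"]]
  by (simp add: detail_def)

text \<open>This is the sum of p^(k \<alpha>) Q_k on its maximal domain, encoded by asking that g is
  square integrable. The condition can be pointwise since details do not see null sets.\<close>

definition multiplier_graph :: "real \<Rightarrow> 'p padic l2_graph" where
  "multiplier_graph \<alpha> = {(f, g). f \<in> L2 m \<and> g \<in> L2 m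
     \<and> (\<forall>k x. detail k g x = of_real (ev \<alpha> k) * detail k f x)}"

lemma multiplier_graphD:
  assumes "(f, g) \<in> multiplier_graph \<alpha>"
  shows "f \<in> L2 m" "g \<in> L2 m" "detail k g x = of_real (ev \<alpha> k) * detail k f x"
  using assms by (auto simp: multiplier_graph_def)

text \<open>The n-th term of the series for the derivative has norm at most 2 ev(K - n) ||u||, so
  the series converges absolutely in L^2 and Q_k can be applied termwise; orthogonality keeps only
  the term of level k.\<close>

lemma frac_deriv_multiplier:
  assumes \<alpha>: "0 < \<alpha>" and u: "u \<in> test_functions"
  shows "(u, frac_deriv m \<alpha> u) \<in> multiplier_graph \<alpha>"
proof -
  have uL: "u \<in> L2 m" using u test_functions_L2 by blast
  obtain K where lc: "locally_const K u"
    and D: "\<And>x. (\<lambda>n. of_real (ev \<alpha> (K - int n)) * detail (K - int n) u x) sums frac_deriv m \<alpha> u x"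
    by (rule frac_deriv_sums[OF \<alpha> u]) blast
  define f where "f n x = of_real (ev \<alpha> (K - int n)) * detail (K - int n) u x" for n x
  have fL: "f n \<in> L2 m" for n unfolding f_def[abs_def] by (intro L2_scale detail_L2 uL)
  have sm: "summable (\<lambda>n. l2_norm m (f n))"
  proof (rule summable_comparison_test'[OF summable_mult2[OF summable_ev[OF \<alpha>, of K], of "2 * l2_norm m u"], of 0])
    show "norm (l2_norm m (f n)) \<le> ev \<alpha> (K - int n) * (2 * l2_norm m u)" for n
      unfolding f_def[abs_def] l2_norm_scale using l2_norm_detail_le[OF uL] by (simp add: mult_left_mono)
  qed
  have F: "(\<lambda>x. \<Sum>n. f n x) = frac_deriv m \<alpha> u"
    using D by (auto simp: f_def sums_iff)
  have FL: "frac_deriv m \<alpha> u \<in> L2 m" using L2_suminf(1)[OF fL sm] unfolding F .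
  have lim: "(\<lambda>n. l2_norm m (\<lambda>x. frac_deriv m \<alpha> u x - (\<Sum>i<n. f i x))) \<longlonglongrightarrow> 0"
    using L2_suminf(2)[OF fL sm] unfolding F[THEN fun_cong] .
  have "detail k (frac_deriv m \<alpha> u) x = of_real (ev \<alpha> k) * detail k u x" for k x
  proof -
    have 1: "(\<lambda>n. detail k (\<lambda>x. \<Sum>i<n. f i x) x) \<longlonglongrightarrow> detail k (frac_deriv m \<alpha> u) x"
      by (rule detail_tendsto[OF L2_sum[OF fL] FL lim])
    have d: "detail k (f i) x = (if k = K - int i then of_real (ev \<alpha> k) * detail k u x else 0)" for i
      unfolding f_def[abs_def] detail_scale detail_detail[OF uL] by simp
    have "detail k (\<lambda>x. \<Sum>i<n. f i x) x = (\<Sum>i<n. if k = K - int i then of_real (ev \<alpha> k) * detail k u x else 0)" for n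
      unfolding d[symmetric] by (rule detail_sum) (use fL in auto)
    also have "\<dots> n = of_real (ev \<alpha> k) * detail k u x" if n: "n > nat (K - k)" for n
    proof (cases "k \<le> K")
      case True
      have "(\<Sum>i<n. if k = K - int i then of_real (ev \<alpha> k) * detail k u x else 0)
          = (\<Sum>i<n. if i = nat (K - k) then of_real (ev \<alpha> k) * detail k u x else 0)"
        using True by (intro sum.cong) auto
      then show ?thesis using n by simp
    next
      \<comment> \<open>Levels finer than K do not occur in the series, and there the detail of u is
        0 by local constancy.\<close>
      case False
      then show ?thesis using detail_locally_const[OF lc, of k x] by (simp add: sum.neutral)
    qed
    finally have "eventually (\<lambda>n. detail k (\<lambda>x. \<Sum>i<n. f i x) x = of_real (ev \<alpha> k) * detail k u x) sequentially"
      unfolding eventually_sequentially by (intro exI[of _ "Suc (nat (K - k))"]) simp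
    from LIMSEQ_unique[OF 1 tendsto_eventually[OF this]] show ?thesis .
  qed
  then show ?thesis using uL FL by (simp add: multiplier_graph_def)
qed

lemma operator_graph_subset:
  assumes \<alpha>: "0 < \<alpha>" shows "operator_graph m (frac_deriv m \<alpha>) test_functions \<subseteq> multiplier_graph \<alpha>"
proof clarify
  fix f g assume "(f, g) \<in> operator_graph m (frac_deriv m \<alpha>) test_functions"
  then obtain u where f: "f \<in> L2 m" and g: "g \<in> L2 m" and u: "u \<in> test_functions"
    and ae: "AE x in m. f x = u x" "AE x in m. g x = frac_deriv m \<alpha> u x"
    unfolding operator_graph_def by blast
  note d = multiplier_graphD[OF frac_deriv_multiplier[OF \<alpha> u]]
  show "(f, g) \<in> multiplier_graph \<alpha>"
    using f g d(3) detail_AE_cong[OF f d(1) ae(1)] detail_AE_cong[OF g d(2) ae(2)]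
    by (simp add: multiplier_graph_def)
qed

text \<open>One inclusion is closedness. For the other, a pair in the multiplier graph is truncated
  in scale by \<open>band\<close> and then in space by a ball; both truncations respect the
  multiplier relation and lead into the test functions.\<close>

lemma graph_closure_frac_deriv:
  assumes \<alpha>: "0 < \<alpha>"
  shows "graph_closure m (operator_graph m (frac_deriv m \<alpha>) test_functions) = multiplier_graph \<alpha>"
proof (intro subset_antisym subrelI)
  fix f g assume "(f, g) \<in> graph_closure m (operator_graph m (frac_deriv m \<alpha>) test_functions)"
  then have fgL: "f \<in> L2 m" "g \<in> L2 m" by (auto simp: graph_closure_def)
  from \<open>(f, g) \<in> graph_closure m _\<close>
  obtain U V where G: "\<forall>n. (U n, V n) \<in> operator_graph m (frac_deriv m \<alpha>) test_functions"
    and lim: "(\<lambda>n. l2_norm m (\<lambda>x. f x - U n x)) \<longlonglongrightarrow> 0" "(\<lambda>n. l2_norm m (\<lambda>x. g x - V n x)) \<longlonglongrightarrow> 0"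
    by (rule graph_closure_sequence)
  have UVm: "(U n, V n) \<in> multiplier_graph \<alpha>" for n using G operator_graph_subset[OF \<alpha>] by blast
  note U = multiplier_graphD(1)[OF UVm] and V = multiplier_graphD(2)[OF UVm]
  have "detail k g x = of_real (ev \<alpha> k) * detail k f x" for k x
  proof -
    have "(\<lambda>n. detail k (V n) x) \<longlonglongrightarrow> detail k g x"
      by (rule detail_tendsto[OF V fgL(2) lim(2)])
    moreover have "(\<lambda>n. of_real (ev \<alpha> k) * detail k (U n) x) \<longlonglongrightarrow> of_real (ev \<alpha> k) * detail k f x"
      by (intro tendsto_mult tendsto_const detail_tendsto[OF U fgL(1) lim(1)])
    moreover have "detail k (V n) x = of_real (ev \<alpha> k) * detail k (U n) x" for n
      by (rule multiplier_graphD(3)[OF UVm])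
    ultimately show ?thesis using LIMSEQ_unique by simp
  qed
  then show "(f, g) \<in> multiplier_graph \<alpha>" using fgL by (simp add: multiplier_graph_def)
next
  fix f g assume fg: "(f, g) \<in> multiplier_graph \<alpha>"
  note f = multiplier_graphD(1)[OF fg] and g = multiplier_graphD(2)[OF fg] and d = multiplier_graphD(3)[OF fg]
  define B where "B n = padic_ball (- int n) (0 :: 'p padic)" for n
  define T where "T h n x = indicator (B n) x * band n h x" for h n x
  have TL: "T h n \<in> L2 m" if "h \<in> L2 m" for h n
    unfolding T_def[abs_def] B_def by (intro restrict_L2 band_L2 that) simp
  have Ttest: "T h n \<in> test_functions" for h n
  proof (rule test_functionsI[of "int n" _ "- int n"])
    have lb: "locally_const (int n) (band n h)"
      unfolding band_def[abs_def]
      by (intro locally_const_comp2[of _ _ _ "(-)"] locally_const_avg locally_const_mono[OF locally_const_avg, of "- int n" "int n"]) simp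
    show "locally_const (int n) (T h n)"
      unfolding T_def[abs_def] B_def
      by (intro locally_const_comp2[of _ _ _ "(*)"] locally_const_indicator lb) simp
    show "T h n x = 0" if "x \<notin> padic_ball (- int n) 0" for x using that by (simp add: T_def B_def)
  qed
  have Tdetail: "detail k (T h n) x = (if - int n < k \<and> k \<le> int n then indicator (B n) x * detail k h x else 0)"
    if h: "h \<in> L2 m" for h n k x
  proof (cases "- int n < k")
    case True
    then show ?thesis
      unfolding T_def[abs_def] B_def detail_restrict[OF True] detail_band[OF h] by simp
  next
    case False
    \<comment> \<open>The band has mean zero on every ball of level -n, and \<open>B n\<close> is
      one such ball, so cutting off creates no average at this level or any coarser one.\<close>
    have "avg (- int n) (T h n) y = 0" for y
    proof -
      have "avg (- int n) (band n h) y = avg (- int n) (avg (int n) h) y - avg (- int n) (avg (- int n) h) y"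
        unfolding band_def[abs_def] by (intro avg_diff avg_L2 h)
      also have "\<dots> = 0" by (simp add: avg_avg[OF h])
      finally show ?thesis unfolding T_def[abs_def] B_def by (simp add: avg_restrict)
    qed
    then have a0: "avg (- int n) (T h n) = (\<lambda>y. 0)" by (rule ext)
    have aj: "avg j (T h n) = avg j (avg (- int n) (T h n))" if "j \<le> - int n" for j
      using that by (simp add: avg_avg[OF TL[OF h]] min_def)
    have z: "avg j (T h n) x = avg j (\<lambda>y. 0) x" if "j \<le> - int n" for j
      by (rule fun_cong[OF aj[OF that, unfolded a0]])
    have "avg j (\<lambda>y. 0) x = 0" for j using avg_scale[of j 0 "\<lambda>y. 0" x] by simp
    then show ?thesis using False z[of k] z[of "k - 1"] by (simp add: detail_def)
  qed
  have Tlim: "(\<lambda>n. l2_norm m (\<lambda>x. h x - T h n x)) \<longlonglongrightarrow> 0" if h: "h \<in> L2 m" for h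
  proof (rule Lim_null_comparison)
    show "(\<lambda>n. l2_norm m (\<lambda>x. h x - indicator (B n) x * h x) + l2_norm m (\<lambda>x. h x - band n h x)) \<longlonglongrightarrow> 0"
      using tendsto_add[OF restrict_tendsto[OF h] band_tendsto[OF h]] by (simp add: B_def)
    \<comment> \<open>The error splits into the spatial truncation of h and the cutoff of the scale
      truncation error; multiplying by an indicator does not increase norms.\<close>
    have "l2_norm m (\<lambda>x. h x - T h n x) \<le> l2_norm m (\<lambda>x. h x - indicator (B n) x * h x) + l2_norm m (\<lambda>x. h x - band n h x)" for n
    proof -
      have hb: "(\<lambda>x. h x - band n h x) \<in> L2 m" by (intro L2_diff band_L2 h)
      have rL: "(\<lambda>x. indicator (B n) x * k x) \<in> L2 m" if "k \<in> L2 m" for k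
        unfolding B_def by (intro restrict_L2 that) simp
      have "l2_norm m (\<lambda>x. (h x - indicator (B n) x * h x) + indicator (B n) x * (h x - band n h x))
          \<le> l2_norm m (\<lambda>x. h x - indicator (B n) x * h x) + l2_norm m (\<lambda>x. indicator (B n) x * (h x - band n h x))"
        by (intro l2_norm_triangle L2_diff h rL hb)
      moreover have "l2_norm m (\<lambda>x. indicator (B n) x * (h x - band n h x)) \<le> l2_norm m (\<lambda>x. h x - band n h x)"
      proof (rule power2_le_imp_le)
        show "(l2_norm m (\<lambda>x. indicator (B n) x * (h x - band n h x)))\<^sup>2 \<le> (l2_norm m (\<lambda>x. h x - band n h x))\<^sup>2"
          unfolding l2_norm_square
          by (intro integral_mono L2_integrable hb rL[OF hb]) (simp add: indicator_def)
      qed simp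
      moreover have "(\<lambda>x. (h x - indicator (B n) x * h x) + indicator (B n) x * (h x - band n h x)) = (\<lambda>x. h x - T h n x)"
        by (simp add: fun_eq_iff T_def right_diff_distrib)
      ultimately show ?thesis by simp
    qed
    then show "\<forall>\<^sub>F n in sequentially. norm (l2_norm m (\<lambda>x. h x - T h n x))
        \<le> l2_norm m (\<lambda>x. h x - indicator (B n) x * h x) + l2_norm m (\<lambda>x. h x - band n h x)" by simp
  qed
  have TG: "(T f n, T g n) \<in> operator_graph m (frac_deriv m \<alpha>) test_functions" for n
  proof -
    note t = multiplier_graphD[OF frac_deriv_multiplier[OF \<alpha> Ttest[of f n]]]
    have "AE x in m. T g n x = frac_deriv m \<alpha> (T f n) x"
      by (rule AE_eq_if_detail_eq[OF TL[OF g] t(2)]) (auto simp: t(3) Tdetail f g d)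
    then have "\<exists>u\<in>test_functions. (AE x in m. T f n x = u x) \<and> (AE x in m. T g n x = frac_deriv m \<alpha> u x)"
      by (intro bexI[OF _ Ttest[of f n]]) simp
    then show ?thesis using TL[OF f] TL[OF g] by (simp add: operator_graph_def)
  qed
  have "\<exists>(u, v)\<in>operator_graph m (frac_deriv m \<alpha>) test_functions.
      l2_norm m (\<lambda>x. f x - u x) < e \<and> l2_norm m (\<lambda>x. g x - v x) < e" if "e > 0" for e
  proof -
    have "eventually (\<lambda>n. l2_norm m (\<lambda>x. f x - T f n x) < e \<and> l2_norm m (\<lambda>x. g x - T g n x) < e) sequentially"
      using order_tendstoD(2)[OF Tlim[OF f] that] order_tendstoD(2)[OF Tlim[OF g] that] by (rule eventually_conj)
    then obtain n where "l2_norm m (\<lambda>x. f x - T f n x) < e \<and> l2_norm m (\<lambda>x. g x - T g n x) < e"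
      unfolding eventually_sequentially by blast
    then show ?thesis by (intro bexI[OF _ TG[of n]]) simp
  qed
  then show "(f, g) \<in> graph_closure m (operator_graph m (frac_deriv m \<alpha>) test_functions)"
    using f g by (simp add: graph_closure_def)
qed

section \<open>Adjoint, essential self-adjointness, positivity\<close>

text \<open>At the centre the finer average is 1 and the coarser one 1/p. Since the difference is
  not 0, every Q_k has a nonzero function in its range.\<close>

lemma detail_indicator_self:
  "detail k (indicator (padic_ball k a)) a = of_real (1 - inverse (real CARD('p)))"
proof -
  have "real CARD('p) powi (- k) * real CARD('p) powi (k - 1) = inverse (real CARD('p))"
    by (simp add: power_int_minus power_int_diff divide_inverse)
  then have "of_real (real CARD('p) powi (- k)) * complex_of_real (real CARD('p) powi (k - 1)) = of_real (inverse (real CARD('p)))"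
    by (simp only: of_real_mult [symmetric])
  then show ?thesis using detail_ball[of k k a a] by (simp add: right_diff_distrib)
qed

lemma detail_indicator_self_nonzero: "detail k (indicator (padic_ball k a)) a \<noteq> 0"
proof -
  have "inverse (real CARD('p)) < 1" by (simp add: inverse_less_1_iff)
  then show ?thesis unfolding detail_indicator_self of_real_eq_0_iff by linarith
qed

lemma detail_multiplier:
  "f \<in> L2 m \<Longrightarrow> (detail k f, \<lambda>x. of_real (ev \<alpha> k) * detail k f x) \<in> multiplier_graph \<alpha>"
  by (auto simp: multiplier_graph_def detail_L2 L2_scale detail_scale detail_detail)

lemma band_inner_tendsto:
  assumes f: "f \<in> L2 m" and g: "g \<in> L2 m"
  shows "(\<lambda>n. \<Sum>k\<in>{- int n<..int n}. l2_inner m (detail k f) (detail k g)) \<longlonglongrightarrow> l2_inner m f g"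
  using l2_inner_tendsto[OF band_L2[OF f] f band_tendsto[OF f] g] unfolding band_inner[OF f g] .

text \<open>Q_k of a ball indicator is an eigenvector with real eigenvalue, and pairing with it
  evaluates Q_k at the centre of the ball, up to a factor; this forces the multiplier relation.
  Conversely, Parseval's identity and the reality of the eigenvalues give symmetry.\<close>

lemma graph_adjoint_multiplier: "graph_adjoint m (multiplier_graph \<alpha>) = multiplier_graph \<alpha>"
proof (intro subset_antisym subrelI)
  fix f g assume "(f, g) \<in> graph_adjoint m (multiplier_graph \<alpha>)"
  then have f: "f \<in> L2 m" and g: "g \<in> L2 m"
    and adj: "\<And>u v. (u, v) \<in> multiplier_graph \<alpha> \<Longrightarrow> l2_inner m v f = l2_inner m u g"
    by (auto simp: graph_adjoint_def)
  have "detail k g a = of_real (ev \<alpha> k) * detail k f a" for k a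
  proof -
    let ?b = "indicator (padic_ball k a)"
    \<comment> \<open>Q_k h is constant on the ball around a, so its pairing with the indicator is
      p^(-k) times its value at a.\<close>
    have w: "l2_inner m (detail k ?b) h = cnj (of_real (real CARD('p) powi (- k)) * detail k h a)" if h: "h \<in> L2 m" for h
    proof -
      have "detail k h a = avg k (detail k h) a" using avg_locally_const[OF locally_const_detail] by simp
      also have "\<dots> = of_real (real CARD('p) powi k) * l2_inner m (detail k h) ?b" by (rule avg_inner)
      finally have "l2_inner m (detail k h) ?b = of_real (real CARD('p) powi (- k)) * detail k h a" by simp
      then show ?thesis
        using detail_symmetric[OF indicator_ball_L2 h, of k k a] l2_inner_commute[of m ?b "detail k h"] by simp
    qed
    have "of_real (ev \<alpha> k) * l2_inner m (detail k ?b) f = l2_inner m (detail k ?b) g"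
      using adj[OF detail_multiplier[OF indicator_ball_L2[of k a], of k]] by (simp add: l2_inner_scale_left)
    then have "cnj (of_real (real CARD('p) powi (- k)) * (of_real (ev \<alpha> k) * detail k f a))
        = cnj (of_real (real CARD('p) powi (- k)) * detail k g a)"
      unfolding w[OF f] w[OF g] by (simp add: mult_ac)
    then have eq: "of_real (real CARD('p) powi (- k)) * (of_real (ev \<alpha> k) * detail k f a)
        = of_real (real CARD('p) powi (- k)) * detail k g a"
      by (simp only: complex_cnj_cancel_iff)
    have "complex_of_real (real CARD('p) powi (- k)) \<noteq> 0"
      unfolding of_real_eq_0_iff using CARD_powi_pos[where 'p='p, of "- k"] by linarith
    from mult_left_cancel[OF this, THEN iffD1, OF eq] show ?thesis by (rule sym)
  qed
  then show "(f, g) \<in> multiplier_graph \<alpha>" using f g by (simp add: multiplier_graph_def)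
next
  fix f g assume fg: "(f, g) \<in> multiplier_graph \<alpha>"
  note f = multiplier_graphD(1)[OF fg] and g = multiplier_graphD(2)[OF fg] and d = multiplier_graphD(3)[OF fg]
  have "l2_inner m v f = l2_inner m u g" if uv: "(u, v) \<in> multiplier_graph \<alpha>" for u v
  proof -
    note u = multiplier_graphD(1)[OF uv] and v = multiplier_graphD(2)[OF uv] and e = multiplier_graphD(3)[OF uv]
    have "l2_inner m (detail k v) (detail k f) = l2_inner m (detail k u) (detail k g)" for k
    proof -
      have "detail k v = (\<lambda>x. of_real (ev \<alpha> k) * detail k u x)" "detail k g = (\<lambda>x. of_real (ev \<alpha> k) * detail k f x)"
        by (simp_all add: fun_eq_iff d e)
      then show ?thesis by (simp add: l2_inner_scale_left l2_inner_scale_right)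
    qed
    then show ?thesis
      using LIMSEQ_unique[OF band_inner_tendsto[OF v f]] band_inner_tendsto[OF u g] by simp
  qed
  then show "(f, g) \<in> graph_adjoint m (multiplier_graph \<alpha>)" using f g by (auto simp: graph_adjoint_def)
qed

lemma self_adjoint_multiplier:
  assumes \<alpha>: "0 < \<alpha>" shows "self_adjoint m (multiplier_graph \<alpha>)"
proof -
  have "test_functions \<subseteq> Domain (multiplier_graph \<alpha>)" using frac_deriv_multiplier[OF \<alpha>] by blast
  then have "l2_closure m test_functions \<subseteq> l2_closure m (Domain (multiplier_graph \<alpha>))"
    unfolding l2_closure_def by blast
  moreover have "l2_closure m (Domain (multiplier_graph \<alpha>)) \<subseteq> L2 m" by (auto simp: l2_closure_def)
  ultimately show ?thesis
    using test_functions_dense graph_adjoint_multiplier by (auto simp: self_adjoint_def)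
qed

text \<open>Each algebraic condition on the operator reduces to an identity between details, which
  holds level by level.\<close>

lemma essentially_self_adjoint_frac_deriv:
  assumes \<alpha>: "0 < \<alpha>" shows "essentially_self_adjoint m (frac_deriv m \<alpha>) test_functions"
proof -
  note D = multiplier_graphD[OF frac_deriv_multiplier[OF \<alpha>]]
  have "l2_operator m (frac_deriv m \<alpha>) test_functions"
    unfolding l2_operator_def
  proof (intro conjI ballI allI impI)
    show "frac_deriv m \<alpha> ` test_functions \<subseteq> L2 m" using D(2) by blast
    fix u :: "'p padic \<Rightarrow> complex" assume u: "u \<in> test_functions"
    show "AE x in m. frac_deriv m \<alpha> (\<lambda>y. c * u y) x = c * frac_deriv m \<alpha> u x" for c
      using u test_functions_scale[OF u, of c]
      by (intro AE_eq_if_detail_eq L2_scale D(2)) (simp_all add: D(3) detail_scale)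
    fix v :: "'p padic \<Rightarrow> complex" assume v: "v \<in> test_functions"
    show "AE x in m. frac_deriv m \<alpha> (\<lambda>y. u y + v y) x = frac_deriv m \<alpha> u x + frac_deriv m \<alpha> v x"
      using u v test_functions_add[OF u v]
      by (intro AE_eq_if_detail_eq L2_add D(2)) (simp_all add: D detail_add distrib_left)
    assume "AE x in m. u x = v x"
    then show "AE x in m. frac_deriv m \<alpha> u x = frac_deriv m \<alpha> v x"
      using u v detail_AE_cong[OF D(1)[OF u] D(1)[OF v]]
      by (intro AE_eq_if_detail_eq D(2)) (simp_all add: D(3))
  qed (use test_functions_L2 fun_span_test_functions in auto)
  then show ?thesis
    unfolding essentially_self_adjoint_def graph_closure_frac_deriv[OF \<alpha>]
    using test_functions_dense self_adjoint_multiplier[OF \<alpha>] by blast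
qed

text \<open>The quadratic form is the limit of finite sums of p^(k \<alpha>) ||Q_k u||^2, which are
  real and nonnegative.\<close>

lemma nonneg_definite_frac_deriv:
  assumes \<alpha>: "0 < \<alpha>" shows "nonneg_definite m (frac_deriv m \<alpha>) test_functions"
  unfolding nonneg_definite_def
proof
  fix u :: "'p padic \<Rightarrow> complex" assume u: "u \<in> test_functions"
  note D = multiplier_graphD[OF frac_deriv_multiplier[OF \<alpha> u]]
  define s where "s n = (\<Sum>k\<in>{- int n<..int n}. ev \<alpha> k * (l2_norm m (detail k u))\<^sup>2)" for n
  have "l2_inner m (detail k (frac_deriv m \<alpha> u)) (detail k u) = of_real (ev \<alpha> k * (l2_norm m (detail k u))\<^sup>2)" for k
  proof -
    have "detail k (frac_deriv m \<alpha> u) = (\<lambda>x. of_real (ev \<alpha> k) * detail k u x)" by (simp add: fun_eq_iff D(3))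
    then show ?thesis by (simp add: l2_inner_scale_left l2_inner_self)
  qed
  then have lim: "(\<lambda>n. complex_of_real (s n)) \<longlonglongrightarrow> l2_inner m (frac_deriv m \<alpha> u) u"
    using band_inner_tendsto[OF D(2,1)] by (simp add: s_def)
  have "(\<lambda>n. 0) \<longlonglongrightarrow> Im (l2_inner m (frac_deriv m \<alpha> u) u)" using tendsto_Im[OF lim] by simp
  then have "Im (l2_inner m (frac_deriv m \<alpha> u) u) = 0" by (simp add: LIMSEQ_const_iff)
  moreover have "0 \<le> Re (l2_inner m (frac_deriv m \<alpha> u) u)"
  proof (rule LIMSEQ_le_const)
    show "s \<longlonglongrightarrow> Re (l2_inner m (frac_deriv m \<alpha> u) u)" using tendsto_Re[OF lim] by simp
    show "\<exists>N. \<forall>n\<ge>N. 0 \<le> s n" by (simp add: s_def sum_nonneg)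
  qed
  ultimately show "l2_inner m (frac_deriv m \<alpha> u) u \<in> \<real> \<and> 0 \<le> Re (l2_inner m (frac_deriv m \<alpha> u) u)"
    by (simp add: complex_is_Real_iff)
qed

lemma self_adjoint_extension_frac_deriv:
  assumes \<alpha>: "0 < \<alpha>"
  shows "self_adjoint_extension m (frac_deriv m \<alpha>) test_functions = multiplier_graph \<alpha>"
  unfolding self_adjoint_extension_def
proof (rule the_equality)
  show "self_adjoint m (multiplier_graph \<alpha>) \<and> operator_graph m (frac_deriv m \<alpha>) test_functions \<subseteq> multiplier_graph \<alpha>"
    using self_adjoint_multiplier[OF \<alpha>] operator_graph_subset[OF \<alpha>] by blast
  fix H assume H: "self_adjoint m H \<and> operator_graph m (frac_deriv m \<alpha>) test_functions \<subseteq> H"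
  show "H = multiplier_graph \<alpha>"
    unfolding graph_closure_frac_deriv[OF \<alpha>, symmetric]
    by (rule self_adjoint_extension_unique)
      (use H self_adjoint_multiplier[OF \<alpha>] in \<open>auto simp: graph_closure_frac_deriv[OF \<alpha>]\<close>)
qed

section \<open>Spectrum and eigenspaces\<close>

text \<open>The eigenvalues tend to 0 at coarse levels and to infinity at fine ones. Outside a
  finite range of levels they are at most |z|/2 or at least 2|z|, and inside it only finitely many
  distances remain.\<close>

lemma ev_lower_bound:
  assumes \<alpha>: "0 < \<alpha>" and z: "z \<noteq> 0" "\<And>k. z \<noteq> of_real (ev \<alpha> k)"
  obtains \<delta> where "0 < \<delta>" "\<And>k. \<delta> \<le> cmod (of_real (ev \<alpha> k) - z)"
proof -
  have "0 < cmod z / 2" using z(1) by simp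
  from order_tendstoD(2)[OF ev_tendsto_0[OF \<alpha>, of 0] this]
  obtain n1 where "ev \<alpha> (0 - int n1) < cmod z / 2" unfolding eventually_sequentially by blast
  then have n1: "ev \<alpha> k \<le> cmod z / 2" if "k \<le> - int n1" for k
    using ev_le_iff[OF \<alpha>, of k "- int n1"] that by simp
  have "0 < 1 / (2 * cmod z)" using z(1) by simp
  from order_tendstoD(2)[OF ev_tendsto_0[OF \<alpha>, of 0] this]
  obtain n2 where n2': "ev \<alpha> (0 - int n2) < 1 / (2 * cmod z)" unfolding eventually_sequentially by blast
  have "ev \<alpha> (- int n2) * ev \<alpha> (int n2) = 1" by (simp add: ev_def flip: powr_add)
  then have "ev \<alpha> (int n2) = 1 / ev \<alpha> (- int n2)"
    by (simp add: nonzero_eq_divide_eq less_imp_neq[OF ev_pos, symmetric] mult.commute)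
  also have "\<dots> > 2 * cmod z" using n2' z(1) ev_pos[of \<alpha> "- int n2"] by (simp add: field_simps)
  finally have n2: "2 * cmod z \<le> ev \<alpha> k" if "int n2 \<le> k" for k
    using ev_le_iff[OF \<alpha>, of "int n2" k] that by simp
  define S where "S = insert (cmod z / 2) ((\<lambda>k. cmod (of_real (ev \<alpha> k) - z)) ` {- int n1..int n2})"
  have S: "finite S" "S \<noteq> {}" by (simp_all add: S_def)
  show ?thesis
  proof (rule that[of "Min S"])
    show "0 < Min S" using S z by (subst Min_gr_iff) (auto simp: S_def)
    fix k
    have Mz: "Min S \<le> cmod z / 2" using S by (intro Min_le) (auto simp: S_def)
    consider "k \<le> - int n1" | "int n2 \<le> k" | "k \<in> {- int n1..int n2}" by force
    then show "Min S \<le> cmod (of_real (ev \<alpha> k) - z)"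
    proof cases
      case 1
      then show ?thesis
        using n1[OF 1] Mz norm_triangle_ineq2[of z "of_real (ev \<alpha> k)"] by (simp add: norm_minus_commute)
    next
      case 2
      have "ev \<alpha> k - cmod z \<le> cmod (of_real (ev \<alpha> k) - z)"
        using norm_triangle_ineq2[of "of_real (ev \<alpha> k)" z] by simp
      then show ?thesis using n2[OF 2] Mz norm_ge_zero[of z] by linarith
    next
      case 3
      then show ?thesis using S by (intro Min_le) (auto simp: S_def)
    qed
  qed
qed

text \<open>At every level the detail of g - z f is that of f times a number of modulus at least
  \<delta>; Pythagoras on bands and a limit give the estimate.\<close>

lemma resolvent_bound:
  assumes fg: "(f, g) \<in> multiplier_graph \<alpha>" and \<delta>: "0 < \<delta>" "\<And>k. \<delta> \<le> cmod (of_real (ev \<alpha> k) - z)"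
  shows "l2_norm m f \<le> 1 / \<delta> * l2_norm m (\<lambda>x. g x - z * f x)"
proof -
  note f = multiplier_graphD(1)[OF fg] and g = multiplier_graphD(2)[OF fg] and d = multiplier_graphD(3)[OF fg]
  let ?h = "\<lambda>x. g x - z * f x"
  have h: "?h \<in> L2 m" by (intro L2_diff L2_scale f g)
  have dh: "detail k ?h = (\<lambda>x. (of_real (ev \<alpha> k) - z) * detail k f x)" for k
  proof
    fix x
    have "detail k ?h x = detail k g x - detail k (\<lambda>x. z * f x) x" by (rule detail_diff[OF g L2_scale[OF f]])
    then show "detail k ?h x = (of_real (ev \<alpha> k) - z) * detail k f x"
      by (simp add: d detail_scale left_diff_distrib)
  qed
  have le: "\<delta> * l2_norm m (band n f) \<le> l2_norm m (band n ?h)" for n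
  proof (rule power2_le_imp_le)
    have "(\<delta> * l2_norm m (band n f))\<^sup>2 = (\<Sum>k\<in>{- int n<..int n}. (\<delta> * l2_norm m (detail k f))\<^sup>2)"
      by (simp add: power_mult_distrib l2_norm_band[OF f] sum_distrib_left)
    also have "\<dots> \<le> (\<Sum>k\<in>{- int n<..int n}. (l2_norm m (detail k ?h))\<^sup>2)"
      unfolding dh l2_norm_scale using \<delta> by (intro sum_mono power_mono mult_right_mono) auto
    also have "\<dots> = (l2_norm m (band n ?h))\<^sup>2" by (rule l2_norm_band[OF h, symmetric])
    finally show "(\<delta> * l2_norm m (band n f))\<^sup>2 \<le> (l2_norm m (band n ?h))\<^sup>2" .
  qed simp
  have "\<delta> * l2_norm m f \<le> l2_norm m ?h"
  proof (rule LIMSEQ_le)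
    show "(\<lambda>n. \<delta> * l2_norm m (band n f)) \<longlonglongrightarrow> \<delta> * l2_norm m f"
      by (intro tendsto_mult tendsto_const l2_norm_tendsto band_L2 f band_tendsto)
    show "(\<lambda>n. l2_norm m (band n ?h)) \<longlonglongrightarrow> l2_norm m ?h"
      by (intro l2_norm_tendsto band_L2 h band_tendsto)
  qed (use le in blast)
  then show ?thesis using \<delta>(1) by (simp add: field_simps)
qed

text \<open>
  The solution of \<open>(L - z) f = h\<close> is \<open>f = \<Sum>k. a k * Q k h\<close> with \<open>a k = 1 / (ev k - z)\<close> and \<open>Q k = detail k\<close>.
  Since \<open>a k \<longlonglongrightarrow> - 1 / z\<close> as \<open>k\<close> decreases, the constant \<open>- 1 / z\<close> is summed in closed form over all \<open>k < 0\<close>,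
  after which the series converges absolutely.
\<close>

lemma resolvent_surj:
  assumes \<alpha>: "0 < \<alpha>" and z: "z \<noteq> 0" and \<delta>: "0 < \<delta>" "\<And>k. \<delta> \<le> cmod (of_real (ev \<alpha> k) - z)"
    and h: "h \<in> L2 m"
  obtains f where "(f, \<lambda>x. h x + z * f x) \<in> multiplier_graph \<alpha>"
proof -
  define a where "a k = 1 / (complex_of_real (ev \<alpha> k) - z)" for k
  define b where "b k = (if 0 \<le> k then a k else a k + 1 / z)" for k
  have nz: "complex_of_real (ev \<alpha> k) - z \<noteq> 0" for k
    by (rule less_le_trans[OF \<delta>(1) \<delta>(2)[of k], unfolded zero_less_norm_iff])
  \<comment> \<open>Levels n and -1 - n are paired, so that a series over the natural numbers runs
    through every integer once.\<close>
  define t where "t n x = b (int n) * detail (int n) h x + b (- 1 - int n) * detail (- 1 - int n) h x" for n x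
  \<comment> \<open>M comes from ev k \<le> |ev k - z| + |z| and |z| \<le> (|z|/\<delta>) |ev k -
    z|.\<close>
  define M where "M = 1 + cmod z / \<delta>"
  have M: "0 \<le> M" using \<delta>(1) by (simp add: M_def)
  have a_pos: "cmod (a k) \<le> M * ev \<alpha> (- k)" for k
  proof -
    have "ev \<alpha> k \<le> cmod (of_real (ev \<alpha> k) - z) + cmod z"
      using norm_triangle_ineq[of "of_real (ev \<alpha> k) - z" z] by simp
    also have "cmod z \<le> cmod z / \<delta> * cmod (of_real (ev \<alpha> k) - z)"
      using mult_left_mono[OF \<delta>(2)[of k], of "cmod z / \<delta>"] \<delta>(1) by simp
    finally have "ev \<alpha> k \<le> M * cmod (of_real (ev \<alpha> k) - z)" by (simp add: M_def algebra_simps)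
    then have "ev \<alpha> k * ev \<alpha> (- k) \<le> M * cmod (of_real (ev \<alpha> k) - z) * ev \<alpha> (- k)"
      by (rule mult_right_mono) simp
    moreover have "ev \<alpha> k * ev \<alpha> (- k) = 1" by (simp add: ev_def flip: powr_add)
    moreover have "0 < cmod (of_real (ev \<alpha> k) - z)" using nz[of k] by simp
    ultimately show ?thesis by (simp add: a_def norm_divide divide_le_eq mult_ac)
  qed
  have a_neg: "cmod (a k + 1 / z) \<le> 1 / (cmod z * \<delta>) * ev \<alpha> k" for k
  proof -
    have "a k + 1 / z = of_real (ev \<alpha> k) / (z * (of_real (ev \<alpha> k) - z))"
      using nz[of k] z by (simp add: a_def add_frac_eq)
    then have "cmod (a k + 1 / z) = ev \<alpha> k / (cmod z * cmod (of_real (ev \<alpha> k) - z))"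
      by (simp add: norm_divide norm_mult)
    also have "\<dots> \<le> ev \<alpha> k / (cmod z * \<delta>)"
    proof (rule divide_left_mono)
      have "0 < cmod (of_real (ev \<alpha> k) - z)" using nz[of k] by (simp only: zero_less_norm_iff not_False_eq_True)
      then show "0 < cmod z * cmod (of_real (ev \<alpha> k) - z) * (cmod z * \<delta>)" using z \<delta>(1) by simp
    qed (use \<delta>(2)[of k] in \<open>auto intro: mult_left_mono\<close>)
    finally show ?thesis by simp
  qed
  have tL: "t n \<in> L2 m" for n unfolding t_def[abs_def] by (intro L2_add L2_scale detail_L2 h)
  have tn: "l2_norm m (t n) \<le> (M * ev \<alpha> (0 - int n) + 1 / (cmod z * \<delta>) * ev \<alpha> (- 1 - int n)) * (2 * l2_norm m h)" for n
  proof -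
    have "l2_norm m (t n) \<le> cmod (b (int n)) * l2_norm m (detail (int n) h)
        + cmod (b (- 1 - int n)) * l2_norm m (detail (- 1 - int n) h)"
      unfolding t_def[abs_def] l2_norm_scale[symmetric]
      by (intro l2_norm_triangle L2_scale detail_L2 h)
    also have "\<dots> \<le> (M * ev \<alpha> (0 - int n)) * (2 * l2_norm m h)
        + (1 / (cmod z * \<delta>) * ev \<alpha> (- 1 - int n)) * (2 * l2_norm m h)"
      using a_pos[of "int n"] a_neg[of "- 1 - int n"] M \<delta>(1)
      by (intro add_mono mult_mono l2_norm_detail_le h) (auto simp: b_def)
    finally show ?thesis by (simp add: distrib_right)
  qed
  have "summable (\<lambda>n. (M * ev \<alpha> (0 - int n) + 1 / (cmod z * \<delta>) * ev \<alpha> (- 1 - int n)) * (2 * l2_norm m h))"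
    by (intro summable_mult2 summable_add summable_mult summable_ev \<alpha>)
  then have sm: "summable (\<lambda>n. l2_norm m (t n))"
    by (rule summable_comparison_test'[of _ 0]) (use tn in simp)
  define F where "F x = (\<Sum>n. t n x)" for x
  have FL: "F \<in> L2 m" using L2_suminf(1)[OF tL sm] by (simp add: F_def[abs_def])
  have lim: "(\<lambda>n. l2_norm m (\<lambda>x. F x - (\<Sum>i<n. t i x))) \<longlonglongrightarrow> 0"
    using L2_suminf(2)[OF tL sm] by (simp add: F_def)
  have dF: "detail k F x = b k * detail k h x" for k x
  proof -
    have dt: "detail k (t i) x = (if i = (if 0 \<le> k then nat k else nat (- 1 - k)) then b k * detail k h x else 0)" for i
    proof -
      have "detail k (t i) x = b (int i) * detail k (detail (int i) h) x + b (- 1 - int i) * detail k (detail (- 1 - int i) h) x"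
        unfolding t_def[abs_def] detail_scale[symmetric] by (intro detail_add L2_scale detail_L2 h)
      then show ?thesis by (auto simp: detail_detail[OF h])
    qed
    let ?N = "if 0 \<le> k then nat k else nat (- 1 - k)"
    have "detail k (\<lambda>x. \<Sum>i<n. t i x) x = b k * detail k h x" if "?N < n" for n
    proof -
      have "detail k (\<lambda>x. \<Sum>i<n. t i x) x = (\<Sum>i<n. detail k (t i) x)"
        by (rule detail_sum) (use tL in auto)
      also have "\<dots> = b k * detail k h x" unfolding dt using that by (subst sum.delta) auto
      finally show ?thesis .
    qed
    then have "eventually (\<lambda>n. detail k (\<lambda>x. \<Sum>i<n. t i x) x = b k * detail k h x) sequentially"
      unfolding eventually_sequentially by (intro exI[of _ "Suc ?N"]) simp
    from LIMSEQ_unique[OF detail_tendsto[OF L2_sum[OF tL] FL lim] tendsto_eventually[OF this]]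
    show ?thesis .
  qed
  \<comment> \<open>P_(-1) is the sum of Q_k over all k < 0, so subtracting its multiple restores
    the coefficients \<open>a k\<close> there.\<close>
  define f where "f x = F x - 1 / z * avg (- 1) h x" for x
  have fL: "f \<in> L2 m" unfolding f_def[abs_def] by (intro L2_diff L2_scale avg_L2 FL h)
  have df: "detail k f x = a k * detail k h x" for k x
  proof -
    have "detail k f x = detail k F x - 1 / z * detail k (avg (- 1) h) x"
      unfolding f_def[abs_def] detail_scale[symmetric] by (intro detail_diff L2_scale avg_L2 FL h)
    then show ?thesis
      by (cases "0 \<le> k") (simp_all add: dF b_def detail_avg[OF h] distrib_right)
  qed
  have "detail k (\<lambda>x. h x + z * f x) x = of_real (ev \<alpha> k) * detail k f x" for k x
  proof -
    have "detail k (\<lambda>x. h x + z * f x) x = detail k h x + z * detail k f x"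
      unfolding detail_scale[symmetric] by (intro detail_add L2_scale h fL)
    also have "\<dots> = (1 + z * a k) * detail k h x" by (simp add: df algebra_simps)
    also have "1 + z * a k = of_real (ev \<alpha> k) * a k" using nz[of k] by (simp add: a_def field_simps)
    finally show ?thesis by (simp add: df)
  qed
  moreover have "(\<lambda>x. h x + z * f x) \<in> L2 m" by (intro L2_add L2_scale h fL)
  ultimately show ?thesis using fL by (intro that[of f]) (simp add: multiplier_graph_def)
qed

text \<open>A function in the range of Q_k that vanishes almost everywhere vanishes everywhere, but
  this one is nonzero at a.\<close>

lemma detail_indicator_norm_pos:
  "0 < l2_norm m (detail k (indicator (padic_ball k a)))"
proof (rule ccontr)
  let ?w = "detail k (indicator (padic_ball k a))"
  have w: "?w \<in> L2 m" by (intro detail_L2 indicator_ball_L2)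
  assume "\<not> 0 < l2_norm m ?w"
  then have "l2_norm m ?w = 0" using l2_norm_nonneg[of m ?w] by linarith
  then have "AE x in m. ?w x = 0" using l2_norm_eq_0[OF w] by simp
  from detail_AE_cong[OF w L2_0 this, of k] have "detail k ?w a = detail k (\<lambda>x. 0) a" by simp
  moreover have "detail k (\<lambda>x. 0) a = 0" using detail_scale[of k 0 "\<lambda>x. 0" a] by simp
  ultimately show False
    using detail_indicator_self_nonzero[of k a] by (simp add: detail_detail[OF indicator_ball_L2])
qed

text \<open>Outside the listed set the bound and the solution above apply. On it, eigenvectors
  defeat any constant c: directly for an eigenvalue, and asymptotically for 0, where level k yields
  \<open>1 \<le> c * ev \<alpha> k\<close>, impossible as k goes to minus infinity.\<close>

lemma spectrum_multiplier:
  assumes \<alpha>: "0 < \<alpha>"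
  shows "spectrum m (multiplier_graph \<alpha>) = {of_real (ev \<alpha> k) | k. True} \<union> {0}"
proof (intro subset_antisym subsetI)
  fix z assume z: "z \<in> spectrum m (multiplier_graph \<alpha>)"
  show "z \<in> {of_real (ev \<alpha> k) | k. True} \<union> {0}"
  proof (rule ccontr)
    assume "z \<notin> {of_real (ev \<alpha> k) | k. True} \<union> {0}"
    then have nz: "z \<noteq> 0" "\<And>k. z \<noteq> of_real (ev \<alpha> k)" by auto
    obtain \<delta> where \<delta>: "0 < \<delta>" "\<And>k. \<delta> \<le> cmod (of_real (ev \<alpha> k) - z)"
      using ev_lower_bound[OF \<alpha> nz] by blast
    have "\<exists>c. \<forall>(f, g)\<in>multiplier_graph \<alpha>. l2_norm m f \<le> c * l2_norm m (\<lambda>x. g x - z * f x)"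
    proof (intro exI ballI)
      fix fg assume "fg \<in> multiplier_graph \<alpha>"
      then show "case fg of (f, g) \<Rightarrow> l2_norm m f \<le> 1 / \<delta> * l2_norm m (\<lambda>x. g x - z * f x)"
        using resolvent_bound[OF _ \<delta>] by (cases fg) simp
    qed
    moreover have "\<exists>(f, g)\<in>multiplier_graph \<alpha>. AE x in m. g x - z * f x = h x" if h: "h \<in> L2 m" for h
    proof -
      obtain f where f: "(f, \<lambda>x. h x + z * f x) \<in> multiplier_graph \<alpha>"
        by (rule resolvent_surj[OF \<alpha> nz(1) \<delta> h])
      show ?thesis by (rule bexI[OF _ f]) simp
    qed
    ultimately have "z \<in> resolvent_set m (multiplier_graph \<alpha>)" unfolding resolvent_set_def by blast
    then show False using z by (simp add: spectrum_def)
  qed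
next
  fix z :: complex assume z: "z \<in> {of_real (ev \<alpha> k) | k. True} \<union> {0}"
  show "z \<in> spectrum m (multiplier_graph \<alpha>)"
  proof (rule ccontr)
    assume "z \<notin> spectrum m (multiplier_graph \<alpha>)"
    then obtain c where c: "\<forall>(f, g)\<in>multiplier_graph \<alpha>. l2_norm m f \<le> c * l2_norm m (\<lambda>x. g x - z * f x)"
      by (auto simp: spectrum_def resolvent_set_def)
    define w where "w k = detail k (indicator (padic_ball k (0 :: 'p padic)) :: 'p padic \<Rightarrow> complex)" for k
    have wpos: "0 < l2_norm m (w k)" for k unfolding w_def by (rule detail_indicator_norm_pos)
    have cw: "l2_norm m (w k) \<le> c * (cmod (of_real (ev \<alpha> k) - z) * l2_norm m (w k))" for k
    proof -
      have wm: "(w k, \<lambda>x. of_real (ev \<alpha> k) * w k x) \<in> multiplier_graph \<alpha>"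
        unfolding w_def by (rule detail_multiplier[OF indicator_ball_L2])
      from bspec[OF c wm] have "l2_norm m (w k) \<le> c * l2_norm m (\<lambda>x. of_real (ev \<alpha> k) * w k x - z * w k x)"
        by simp
      also have "(\<lambda>x. of_real (ev \<alpha> k) * w k x - z * w k x) = (\<lambda>x. (of_real (ev \<alpha> k) - z) * w k x)"
        by (simp add: left_diff_distrib)
      finally show ?thesis by (simp only: l2_norm_scale)
    qed
    show False
    proof (cases "z = 0")
      case True
      have one: "1 \<le> c * ev \<alpha> k" for k
        using cw[of k] wpos[of k] by (simp add: True flip: mult.assoc)
      then have "(\<lambda>n. c * ev \<alpha> (0 - int n)) \<longlonglongrightarrow> c * 0"
        by (intro tendsto_mult tendsto_const ev_tendsto_0 \<alpha>)
      from LIMSEQ_le_const[OF this, of 1] one show False by auto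
    next
      case False
      then obtain k where "z = of_real (ev \<alpha> k)" using z by blast
      then show False using cw[of k] wpos[of k] by simp
    qed
  qed
qed

lemma zero_islimpt_spectrum:
  assumes \<alpha>: "0 < \<alpha>" shows "0 islimpt spectrum m (multiplier_graph \<alpha>)"
  unfolding islimpt_approachable
proof (intro allI impI)
  fix e :: real assume e: "0 < e"
  from order_tendstoD(2)[OF ev_tendsto_0[OF \<alpha>, of 0] e]
  obtain n where n: "ev \<alpha> (0 - int n) < e" unfolding eventually_sequentially by blast
  have "complex_of_real (ev \<alpha> (0 - int n)) \<in> spectrum m (multiplier_graph \<alpha>)"
    unfolding spectrum_multiplier[OF \<alpha>] by blast
  then show "\<exists>x\<in>spectrum m (multiplier_graph \<alpha>). x \<noteq> 0 \<and> dist x 0 < e"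
    by (rule rev_bexI) (use n less_imp_neq[OF ev_pos] in \<open>auto simp: dist_norm\<close>)
qed

section \<open>Eigenspaces and multiplicity\<close>

text \<open>Different levels have different eigenvalues because \<alpha> > 0, so only the detail of
  level k can be nonzero.\<close>

lemma eigenspace_multiplier:
  assumes \<alpha>: "0 < \<alpha>"
  shows "eigenspace m (multiplier_graph \<alpha>) (of_real (ev \<alpha> k)) = {f \<in> L2 m. \<forall>j x. j \<noteq> k \<longrightarrow> detail j f x = 0}"
proof -
  have "ev \<alpha> k = ev \<alpha> j \<longleftrightarrow> j = k" for j
    unfolding order_eq_iff[of "ev \<alpha> k" "ev \<alpha> j"] order_eq_iff[of j k] ev_le_iff[OF \<alpha>] by blast
  then have "of_real (ev \<alpha> k) * c = of_real (ev \<alpha> j) * c \<longleftrightarrow> j = k \<or> c = 0" for j and c :: complex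
    unfolding mult_cancel_right of_real_eq_iff by blast
  then have eqv: "(\<forall>j x. of_real (ev \<alpha> k) * detail j f x = of_real (ev \<alpha> j) * detail j f x)
      \<longleftrightarrow> (\<forall>j x. j \<noteq> k \<longrightarrow> detail j f x = 0)" for f
    by metis
  have "(f, \<lambda>x. of_real (ev \<alpha> k) * f x) \<in> multiplier_graph \<alpha> \<longleftrightarrow> f \<in> L2 m \<and> (\<forall>j x. j \<noteq> k \<longrightarrow> detail j f x = 0)" for f
    unfolding multiplier_graph_def mem_Collect_eq case_prod_conv detail_scale eqv
    using L2_scale[of f m "of_real (ev \<alpha> k)"] by blast
  then show ?thesis by (auto simp: eigenspace_def)
qed

lemma detail_indicator_in_eigenspace:
  assumes \<alpha>: "0 < \<alpha>"
  shows "detail k (indicator (padic_ball k a)) \<in> eigenspace m (multiplier_graph \<alpha>) (of_real (ev \<alpha> k))"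
  unfolding eigenspace_def by (simp add: detail_multiplier)

lemma eigenvalue_multiplier:
  assumes \<alpha>: "0 < \<alpha>" shows "eigenvalue m (multiplier_graph \<alpha>) (of_real (ev \<alpha> k))"
  unfolding eigenvalue_def
proof (rule bexI[OF _ detail_indicator_in_eigenspace[OF \<alpha>, of k 0]])
  show "\<not> (AE x in m. detail k (indicator (padic_ball k 0)) x = 0)"
    using detail_indicator_norm_pos[of k 0] l2_norm_eq_0[OF detail_L2[OF indicator_ball_L2[of k 0]], of k]
    by auto
qed

text \<open>Both sides are differences of normalized ball indicators, which places the shifted waves
  in the range of Q_k; adding a to the argument moves the centre to -a.\<close>

lemma ball_wave_eq:
  "ball_wave m k (x + a) = of_real (real CARD('p) powi k) * detail k (indicator (padic_ball k (- a))) x"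
proof -
  have inv: "1 / complex_of_real (real CARD('p) powi (- j)) = of_real (real CARD('p) powi j)" for j
    by (simp add: power_int_minus divide_inverse)
  have "ball_wave m k (x + a) = (if x + a \<in> padic_ball k 0 then of_real (real CARD('p) powi k) else 0)
      - (if x + a \<in> padic_ball (k - 1) 0 then of_real (real CARD('p) powi (k - 1)) else 0)"
    unfolding ball_wave_def measure_ball inv by (simp add: indicator_def)
  then show ?thesis using detail_ball[of k k "- a" x] by simp
qed

text \<open>Spanning is meant in the Hilbert space sense. The details of other levels are continuous
  and vanish on the waves, hence on the closure. Conversely f equals Q_k f almost everywhere, and
  the cutoffs of Q_k f to large balls are finite combinations of waves.\<close>

lemma eigenspace_eq_closure:
  assumes \<alpha>: "0 < \<alpha>"
  shows "eigenspace m (multiplier_graph \<alpha>) (of_real (ev \<alpha> k))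
    = l2_closure m (fun_span {(\<lambda>x. ball_wave m k (x + a)) | a. True})" (is "?E = l2_closure m (fun_span ?W)")
proof (intro subset_antisym subsetI)
  fix f assume f: "f \<in> l2_closure m (fun_span ?W)"
  then have fL: "f \<in> L2 m" by (simp add: l2_closure_def)
  have W: "w \<in> L2 m \<and> (\<forall>j x. j \<noteq> k \<longrightarrow> detail j w x = 0)" if w: "w \<in> ?W" for w
  proof -
    obtain a where "w = (\<lambda>x. of_real (real CARD('p) powi k) * detail k (indicator (padic_ball k (- a))) x)"
      using w unfolding ball_wave_eq by blast
    then show ?thesis
      by (simp only: L2_scale detail_L2 indicator_ball_L2 detail_scale detail_detail) simp
  qed
  have "detail j f x = 0" if jk: "j \<noteq> k" for j x
  proof -
    define c where "c = 2 * sqrt (real CARD('p) powi j)"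
    have c: "0 < c" by (simp add: c_def)
    have "cmod (detail j f x) \<le> 0 + e" if "0 < e" for e
    proof -
      have "0 < e / c" using that c by simp
      then obtain g where g: "g \<in> fun_span ?W" "l2_norm m (\<lambda>x. f x - g x) < e / c"
        using f unfolding l2_closure_def by blast
      then obtain F d where F: "finite F" "F \<subseteq> ?W" and g_eq: "g = (\<lambda>x. \<Sum>u\<in>F. d u * u x)"
        unfolding fun_span_def by blast
      have FL: "u \<in> L2 m" "detail j u x = 0" if "u \<in> F" for u using W[of u] that F(2) jk by auto
      have gL: "g \<in> L2 m" unfolding g_eq by (intro L2_sum L2_scale FL(1))
      have "detail j g x = (\<Sum>u\<in>F. detail j (\<lambda>x. d u * u x) x)"
        unfolding g_eq by (intro detail_sum F L2_scale FL(1))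
      then have "detail j g x = 0" using FL(2) by (simp add: detail_scale)
      then have "detail j f x = detail j (\<lambda>x. f x - g x) x" by (simp add: detail_diff[OF fL gL])
      also have "cmod \<dots> \<le> c * l2_norm m (\<lambda>x. f x - g x)"
        unfolding c_def by (rule detail_bound[OF L2_diff[OF fL gL]])
      also have "\<dots> \<le> e" using g(2) c by (simp add: pos_less_divide_eq mult.commute)
      finally show ?thesis by simp
    qed
    then have "cmod (detail j f x) \<le> 0" by (rule field_le_epsilon)
    then show ?thesis by simp
  qed
  then show "f \<in> ?E" using fL by (simp add: eigenspace_multiplier[OF \<alpha>])
next
  fix f assume "f \<in> ?E"
  then have fL: "f \<in> L2 m" and f0: "\<And>j x. j \<noteq> k \<Longrightarrow> detail j f x = 0"
    by (auto simp: eigenspace_multiplier[OF \<alpha>])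
  have dL: "detail k f \<in> L2 m" by (rule detail_L2[OF fL])
  have ae: "AE x in m. f x = detail k f x"
    by (rule AE_eq_if_detail_eq[OF fL dL]) (use f0 in \<open>auto simp: detail_detail[OF fL]\<close>)
  define B where "B n = padic_ball (- int n) (0 :: 'p padic)" for n
  define g where "g n x = indicator (B n) x * detail k f x" for n x
  have gL: "g n \<in> L2 m" for n unfolding g_def[abs_def] B_def by (intro restrict_L2 dL) simp
  have lim: "(\<lambda>n. l2_norm m (\<lambda>x. detail k f x - g n x)) \<longlonglongrightarrow> 0"
    using restrict_tendsto[OF dL] by (simp add: g_def B_def)
  have span: "g n \<in> fun_span ?W" if n: "- int n < k" for n
  proof -
    have lc: "locally_const k (g n)"
      unfolding g_def[abs_def] B_def
      by (intro locally_const_comp2[of _ _ _ "(*)"] locally_const_indicator locally_const_detail less_imp_le[OF n])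
    have supp: "g n x = 0" if "x \<notin> padic_ball (- int n) 0" for x using that by (simp add: g_def B_def)
    obtain I :: "nat set" and c d where I: "finite I"
      and g_eq: "g n = (\<lambda>x. \<Sum>i\<in>I. d i * indicator (padic_ball k (c i)) x)"
      by (rule locally_const_decompose[OF lc supp less_imp_le[OF n]])
    \<comment> \<open>Q_k reproduces \<open>g n\<close>, because the cutoff commutes with it;
      applied to the expansion in ball indicators it turns each indicator into a multiple of a
      wave.\<close>
    have "g n x = (\<Sum>i\<in>I. (d i * of_real (real CARD('p) powi (- k))) * ball_wave m k (x + - c i))" for x
    proof -
      have "g n x = indicator (B n) x * detail k (detail k f) x" by (simp add: g_def detail_detail[OF fL])
      also have "\<dots> = detail k (g n) x" unfolding g_def[abs_def] B_def by (rule detail_restrict[OF n, symmetric])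
      also have "\<dots> = (\<Sum>i\<in>I. detail k (\<lambda>x. d i * indicator (padic_ball k (c i)) x) x)"
        unfolding g_eq by (intro detail_sum I L2_scale indicator_ball_L2)
      also have "\<dots> = (\<Sum>i\<in>I. (d i * of_real (real CARD('p) powi (- k))) * ball_wave m k (x + - c i))"
        unfolding ball_wave_eq detail_scale by (simp add: mult.assoc)
      finally show ?thesis .
    qed
    then have "g n = (\<lambda>x. \<Sum>i\<in>I. (d i * of_real (real CARD('p) powi (- k))) * (\<lambda>x. ball_wave m k (x + - c i)) x)"
      by (simp add: fun_eq_iff)
    also have "\<dots> \<in> fun_span ?W" by (rule fun_spanI[OF I]) blast
    finally show ?thesis .
  qed
  have "\<exists>h\<in>fun_span ?W. l2_norm m (\<lambda>x. f x - h x) < e" if "0 < e" for e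
  proof -
    from order_tendstoD(2)[OF lim that]
    obtain N where N: "\<forall>n\<ge>N. l2_norm m (\<lambda>x. detail k f x - g n x) < e" unfolding eventually_sequentially by blast
    \<comment> \<open>Beyond N the approximation is good, and n > -k lets the cutoff commute with
      Q_k.\<close>
    define n where "n = max N (Suc (nat (- k)))"
    have "l2_norm m (\<lambda>x. f x - g n x) = l2_norm m (\<lambda>x. detail k f x - g n x)"
      using ae L2_measurable[OF L2_diff[OF fL gL]] L2_measurable[OF L2_diff[OF dL gL]]
      by (intro l2_norm_AE_cong) auto
    moreover have "l2_norm m (\<lambda>x. detail k f x - g n x) < e" using N by (simp add: n_def)
    moreover have "- int n < k" by (simp add: n_def)
    ultimately show ?thesis by (intro bexI[OF _ span]) simp_all
  qed
  then show "f \<in> l2_closure m (fun_span ?W)" using fL by (simp add: l2_closure_def)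
qed

text \<open>
  Passing from \<open>f\<close> to \<open>detail k f\<close> turns almost everywhere identities into pointwise ones, so that
  the finite-dimensionality can be refuted in the vector space of all functions.
\<close>

lemma eigenspace_infinite_dim:
  assumes \<alpha>: "0 < \<alpha>"
  shows "l2_infinite_dim m (eigenspace m (multiplier_graph \<alpha>) (of_real (ev \<alpha> k)))"
  unfolding l2_infinite_dim_def
proof
  let ?E = "eigenspace m (multiplier_graph \<alpha>) (of_real (ev \<alpha> k))"
  assume "\<exists>F. finite F \<and> F \<subseteq> ?E \<and> (\<forall>f\<in>?E. \<exists>g\<in>fun_span F. AE x in m. f x = g x)"
  then obtain F where F: "finite F" "F \<subseteq> ?E" "\<And>f. f \<in> ?E \<Longrightarrow> \<exists>g\<in>fun_span F. AE x in m. f x = g x" by blast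
  interpret V: vector_space "\<lambda>(c :: complex) (f :: 'p padic \<Rightarrow> complex) x. c * f x"
    by unfold_locales (simp_all add: fun_eq_iff algebra_simps)
  have FL: "u \<in> L2 m" if "u \<in> F" for u using that F(2) by (auto simp: eigenspace_multiplier[OF \<alpha>])
  have span: "detail k f \<in> V.span (detail k ` F)" if f: "f \<in> ?E" for f
  proof -
    obtain g where g: "g \<in> fun_span F" "AE x in m. f x = g x" using F(3)[OF f] by blast
    obtain F' d where F': "finite F'" "F' \<subseteq> F" and g_eq: "g = (\<lambda>x. \<Sum>u\<in>F'. d u * u x)"
      using g(1) unfolding fun_span_def by blast
    have gL: "g \<in> L2 m" unfolding g_eq using F' FL by (intro L2_sum L2_scale) auto
    have fL: "f \<in> L2 m" using f by (auto simp: eigenspace_multiplier[OF \<alpha>])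
    have "detail k f = detail k g" by (rule detail_AE_cong[OF fL gL g(2)])
    also have "\<dots> = (\<lambda>x. \<Sum>u\<in>F'. d u * detail k u x)"
    proof
      fix x
      have "detail k g x = (\<Sum>u\<in>F'. detail k (\<lambda>x. d u * u x) x)"
        unfolding g_eq using F' FL by (intro detail_sum L2_scale) auto
      then show "detail k g x = (\<Sum>u\<in>F'. d u * detail k u x)" by (simp add: detail_scale)
    qed
    also have "\<dots> \<in> V.span (detail k ` F)"
      using F'
    proof (induction F')
      case empty
      then show ?case using V.span_zero by (simp add: zero_fun_def)
    next
      case (insert u F')
      have "detail k u \<in> V.span (detail k ` F)" using insert by (intro V.span_base) auto
      from V.span_add[OF V.span_scale[OF this, of "d u"], of "\<lambda>x. \<Sum>u\<in>F'. d u * detail k u x"]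
      have "(\<lambda>x. d u * detail k u x) + (\<lambda>x. \<Sum>u\<in>F'. d u * detail k u x) \<in> V.span (detail k ` F)"
        using insert by simp
      then show ?case using insert by (simp add: plus_fun_def)
    qed
    finally show ?thesis .
  qed
  \<comment> \<open>Points in different cosets of level k - 1, not merely of level k, give waves
    with disjoint supports, so that evaluation at \<open>a i\<close> isolates
    \<open>w i\<close>.\<close>
  obtain a :: "nat \<Rightarrow> 'p padic" where dis: "disjoint_family (\<lambda>i. padic_ball (k - 1) (a i))"
    and "(\<Union>i. padic_ball (k - 1) (a i)) = UNIV"
    by (rule coset_sequence)
  define w where "w i = detail k (indicator (padic_ball k (a i)) :: 'p padic \<Rightarrow> complex)" for i
  have w_self: "w i (a i) \<noteq> 0" for i unfolding w_def by (rule detail_indicator_self_nonzero)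
  have w_other: "w j (a i) = 0" if "i \<noteq> j" for i j
  proof -
    have "padic_ball (k - 1) (a i) \<inter> padic_ball (k - 1) (a j) = {}"
      using dis that by (simp add: disjoint_family_on_def)
    then have "a i \<notin> padic_ball (k - 1) (a j)" using padic_ball_self[of "a i" "k - 1"] by blast
    then have "a i - a j \<notin> padic_ball (k - 1) 0" by (simp add: mem_padic_ball)
    moreover have "a i - a j \<notin> padic_ball k 0" using padic_ball_mono[of "k - 1" k 0] calculation by auto
    ultimately show ?thesis using detail_ball[of k k "a j" "a i"] by (simp add: w_def)
  qed
  have w_inj: "inj w"
    by (rule injI) (metis w_self w_other)
  have ind: "\<not> V.dependent (range w)"
  proof
    assume "V.dependent (range w)"
    then obtain i where i: "w i \<in> V.span (range w - {w i})" unfolding V.dependent_def by blast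
    \<comment> \<open>Vanishing at \<open>a i\<close> is a linear condition that all other members
      satisfy and \<open>w i\<close> violates.\<close>
    have "V.span (range w - {w i}) \<subseteq> {f. f (a i) = 0}"
    proof (rule V.span_minimal)
      have "w j (a i) = 0" if "w j \<noteq> w i" for j using that by (intro w_other) blast
      then show "range w - {w i} \<subseteq> {f. f (a i) = 0}" by blast
      show "V.subspace {f. f (a i) = 0}"
        unfolding V.subspace_def by (simp add: zero_fun_def plus_fun_def)
    qed
    then show False using i w_self[of i] by blast
  qed
  have "range w \<subseteq> V.span (detail k ` F)"
  proof clarify
    fix i
    have "detail k (w i) = w i" by (simp add: fun_eq_iff w_def detail_detail[OF indicator_ball_L2])
    moreover have "w i \<in> ?E" unfolding w_def by (rule detail_indicator_in_eigenspace[OF \<alpha>])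
    ultimately show "w i \<in> V.span (detail k ` F)" using span by metis
  qed
  then have "finite (range w)" using V.independent_span_bound[OF _ ind] F(1) by blast
  then show False using w_inj by (simp add: finite_image_iff)
qed

end

theorem mainTheorem5:
  fixes p :: nat and \<alpha> :: real and m :: "'p::prime_card padic measure"
    and C :: "'p padic set \<Rightarrow> real" and H :: "'p padic l2_graph"
  assumes "p = CARD('p)" and "0 < \<alpha>" and "normalized_haar m"
    and "C = (\<lambda>B. (1 - p powr (- \<alpha>)) * (diameter B / p) powr (- \<alpha>))"
    and "H = self_adjoint_extension m (frac_deriv m \<alpha>) test_functions"
  shows
    "essentially_self_adjoint m (frac_deriv m \<alpha>) test_functions
   \<and> nonneg_definite m (frac_deriv m \<alpha>) test_functions
   \<and> choice_function C
   \<and> (\<forall>u\<in>test_functions. frac_deriv m \<alpha> u = hier_laplacian m C u)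
   \<and> (\<forall>C'. choice_function C' \<longrightarrow>
        (\<forall>B\<in>padic_balls. C' B = C B)
          \<longleftrightarrow> (\<forall>B\<in>padic_balls. ball_eigenvalue C' B = (diameter B / p) powr (- \<alpha>)))
   \<and> spectrum m H = {of_real (p powr (k * \<alpha>)) | k :: int. True} \<union> {0}
   \<and> (\<forall>k :: int. eigenvalue m H (of_real (p powr (k * \<alpha>)))
        \<and> l2_infinite_dim m (eigenspace m H (of_real (p powr (k * \<alpha>)))))
   \<and> 0 islimpt spectrum m H
   \<and> (\<forall>k :: int. eigenspace m H (of_real (p powr (k * \<alpha>)))
        = l2_closure m (fun_span {(\<lambda>x. ball_wave m k (x + a)) | a. True}))"
proof -
  interpret haar m by unfold_locales (rule assms(3))
  note \<alpha> = \<open>0 < \<alpha>\<close>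
  have C: "C = (\<lambda>B. (1 - real CARD('p) powr (- \<alpha>)) * (diameter B / real CARD('p)) powr (- \<alpha>))"
    using assms(1,4) by simp
  have H: "H = multiplier_graph \<alpha>"
    using assms(5) self_adjoint_extension_frac_deriv[OF \<alpha>] by simp
  have "\<forall>u\<in>test_functions. frac_deriv m \<alpha> u = hier_laplacian m C u"
    using hier_laplacian_eq_frac_deriv[OF \<alpha> C] by (auto simp: fun_eq_iff)
  then show ?thesis
    unfolding H assms(1) ev_def[symmetric]
    using essentially_self_adjoint_frac_deriv[OF \<alpha>] nonneg_definite_frac_deriv[OF \<alpha>]
      choice_function_ball_weight[OF \<alpha> C] choice_function_unique[OF \<alpha> C] spectrum_multiplier[OF \<alpha>]
      eigenvalue_multiplier[OF \<alpha>] eigenspace_infinite_dim[OF \<alpha>] zero_islimpt_spectrum[OF \<alpha>]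
      eigenspace_eq_closure[OF \<alpha>]
    by blast
qed

end
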